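(* Let $H$ be a Hopf $\pi$-coalgebra, let $(C,\sigma)$ be a left $\pi$-coisotropic quantum subgroup of $H$, and let $(V,\rho)$ and $(W,\rho')$ be right $\pi$-comodules over $C$. If there exists a vector space isomorphism $F_1:V_1\to W_1$ such that $$\rho'_{1,1}F_1=(F_1\otimes I_{C_1})\rho_{1,1},$$ then the induced representations $Ind(\rho)$ and $Ind(\rho')$ are equivalent right $\pi$-comodules over $H$.
   Context: Everything is over a field $K$: spaces, linear maps, tensor products; algebras are associative and unital. $I$ denotes identity maps. $\pi$ is a group with neutral element $1$. A $\pi$-coalgebra is a family $C=\{C_\alpha\}_{\alpha\in\pi}$ of $K$-spaces with linear maps $\Delta_{\alpha,\beta}:C_{\alpha\beta}\to C_\alpha\otimes C_\beta$ and $\epsilon:C_1\to K$ such that $(\Delta_{\alpha,\beta}\otimes I)\Delta_{\alpha\beta,\gamma}=(I\otimes\Delta_{\beta,\gamma})\Delta_{\alpha,\beta\gamma}$ and $(\epsilon\otimes I)\Delta_{1,\alpha}=I=(I\otimes\epsilon)\Delta_{\alpha,1}$ (identifying $K\otimes C_\alpha\cong C_\alpha\cong C_\alpha\otimes K$). A Hopf $\pi$-coalgebra is a $\pi$-coalgebra $H=\{H_\alpha\}$ with linear maps $S_\alpha:H_\alpha\to H_{\alpha^{-1}}$ such that each $H_\alpha$ is an algebra (multiplication $\mu_\alpha$, unit $1_\alpha$), all $\Delta_{\alpha,\beta}$ and $\epsilon$ are algebra maps, and $\mu_\alpha(S_{\alpha^{-1}}\otimes I)\Delta_{\alpha^{-1},\alpha}=1_\alpha\epsilon=\mu_\alpha(I\otimes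 S_{\alpha^{-1}})\Delta_{\alpha,\alpha^{-1}}$. A right $\pi$-comodule $(M,\theta)$ over a $\pi$-coalgebra $C$ is a family $M=\{M_\alpha\}$ of spaces with linear maps $\theta_{\alpha,\beta}:M_{\alpha\beta}\to M_\alpha\otimes C_\beta$ such that $(\theta_{\alpha,\beta}\otimes I)\theta_{\alpha\beta,\gamma}=(I\otimes\Delta_{\beta,\gamma})\theta_{\alpha,\beta\gamma}$ and $(I\otimes\epsilon)\theta_{\alpha,1}=I$ (up to $M_\alpha\otimes K\cong M_\alpha$). Two right $\pi$-comodules $(M,\theta)$, $(N,\theta')$ over $C$ are equivalent if there is a family of vector space isomorphisms $F_\alpha:M_\alpha\to N_\alpha$ with $\theta'_{\alpha,\beta}F_{\alpha\beta}=(F_\alpha\otimes I)\theta_{\alpha,\beta}$ for all $\alpha,\beta\in\pi$. A left $\pi$-coisotropic quantum subgroup of $H$ is a pair $(C,\sigma)$ where $C$ is a $\pi$-coalgebra, each $C_\alpha$ carries a left $H_\alpha$-module structure, and $\sigma=\{\sigma_\alpha:H_\alpha\to C_\alpha\}$ is a family of surjective linear maps such that each $\sigma_\alpha$ is left $H_\alpha$-linear, $\Delta^C_{\alpha,\beta}\sigma_{\alpha\beta}=(\sigma_\alpha\otimes\sigma_\beta)\Delta^H_{\alpha,\beta}$, and $\epsilon^C\sigma_1=\epsilon^H$. For a right $\pi$-comodule $(V,\rho)$ over $C$, the induced representation $Ind(\rho)$ is the right $\pi$-comodule over $H$ with $Ind(\rho)_\alpha=\{x\in V_1\otimes H_\alpha:(I_{V_1}\otimes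 L_{1,\alpha})(x)=(\rho_{1,1}\otimes I_{H_\alpha})(x)\}$, where $L_{1,\alpha}=(\sigma_1\otimes I_{H_\alpha})\Delta^H_{1,\alpha}$, and with coaction $I_{V_1}\otimes\Delta^H_{\alpha,\beta}:Ind(\rho)_{\alpha\beta}\to Ind(\rho)_\alpha\otimes H_\beta$. *)

theory Defs
  imports "HOL-Algebra.Module" "HOL-Algebra.AbelCoset" "HOL-Library.FuncSet"
begin

text \<open>
  A \<open>K\<close>-space is a module record over the field \<open>K\<close>; its fields \<open>mult\<close> and \<open>one\<close> carry meaning
  only where the space is required to be an algebra.  Each member of a family of spaces has its
  own carrier and its own operations.
\<close>

section \<open>Linear maps and algebras\<close>

definition linear_maps :: "'k ring \<Rightarrow> ('k, 'm) module \<Rightarrow> ('k, 'n) module \<Rightarrow> ('m \<Rightarrow> 'n) set" where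
  "linear_maps K M N = {f \<in> carrier M \<rightarrow> carrier N.
     (\<forall>x\<in>carrier M. \<forall>y\<in>carrier M. f (x \<oplus>\<^bsub>M\<^esub> y) = f x \<oplus>\<^bsub>N\<^esub> f y) \<and>
     (\<forall>a\<in>carrier K. \<forall>x\<in>carrier M. f (a \<odot>\<^bsub>M\<^esub> x) = a \<odot>\<^bsub>N\<^esub> f x)}"

definition linear_isos :: "'k ring \<Rightarrow> ('k, 'm) module \<Rightarrow> ('k, 'n) module \<Rightarrow> ('m \<Rightarrow> 'n) set" where
  "linear_isos K M N = {f \<in> linear_maps K M N. bij_betw f (carrier M) (carrier N)}"

text \<open>The library locale \<open>algebra\<close> is restricted to commutative algebras.\<close>

locale assoc_algebra = module K A + ring A for K :: "'k ring" and A :: "('k, 'a) module" +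
  assumes smult_mult_left: "\<lbrakk>a \<in> carrier K; x \<in> carrier A; y \<in> carrier A\<rbrakk> \<Longrightarrow>
      (a \<odot>\<^bsub>A\<^esub> x) \<otimes>\<^bsub>A\<^esub> y = a \<odot>\<^bsub>A\<^esub> (x \<otimes>\<^bsub>A\<^esub> y)"
    and smult_mult_right: "\<lbrakk>a \<in> carrier K; x \<in> carrier A; y \<in> carrier A\<rbrakk> \<Longrightarrow>
      x \<otimes>\<^bsub>A\<^esub> (a \<odot>\<^bsub>A\<^esub> y) = a \<odot>\<^bsub>A\<^esub> (x \<otimes>\<^bsub>A\<^esub> y)"

definition algebra_maps :: "'k ring \<Rightarrow> ('k, 'a) module \<Rightarrow> ('k, 'b) module \<Rightarrow> ('a \<Rightarrow> 'b) set" where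
  "algebra_maps K A B = linear_maps K A B \<inter> ring_hom A B"

definition base_space :: "'k ring \<Rightarrow> ('k, 'k) module" where
  "base_space K = \<lparr>carrier = carrier K, mult = mult K, one = one K, zero = zero K, add = add K,
     smult = mult K\<rparr>"

locale left_algebra_module = A: assoc_algebra K A + M: module K M
  for K :: "'k ring" and A :: "('k, 'a) module" and M :: "('k, 'm) module" +
  fixes act :: "'a \<Rightarrow> 'm \<Rightarrow> 'm"
  assumes act_linear_left: "m \<in> carrier M \<Longrightarrow> (\<lambda>a. act a m) \<in> linear_maps K A M"
    and act_linear_right: "a \<in> carrier A \<Longrightarrow> act a \<in> linear_maps K M M"
    and act_mult: "\<lbrakk>a \<in> carrier A; b \<in> carrier A; m \<in> carrier M\<rbrakk> \<Longrightarrow>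
      act (a \<otimes>\<^bsub>A\<^esub> b) m = act a (act b m)"
    and act_one: "m \<in> carrier M \<Longrightarrow> act \<one>\<^bsub>A\<^esub> m = m"

section \<open>Tensor products\<close>

text \<open>
  \<open>tensor K M N\<close> is the quotient of the free \<open>K\<close>-space on the set
  \<open>carrier M \<times> carrier N\<close> by the bilinearity relations, so its elements are cosets.
\<close>

definition free_space :: "'k ring \<Rightarrow> 'x set \<Rightarrow> ('k, 'x \<Rightarrow> 'k) module" where
  "free_space K X = \<lparr>
     carrier = {f. (\<forall>x. f x \<in> carrier K) \<and> finite {x. f x \<noteq> \<zero>\<^bsub>K\<^esub>} \<and> (\<forall>x. x \<notin> X \<longrightarrow> f x = \<zero>\<^bsub>K\<^esub>)},
     mult = undefined, one = undefined,
     zero = (\<lambda>x. \<zero>\<^bsub>K\<^esub>), add = (\<lambda>f g x. f x \<oplus>\<^bsub>K\<^esub> g x),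
     smult = (\<lambda>a f x. a \<otimes>\<^bsub>K\<^esub> f x)\<rparr>"

definition free_gen :: "'k ring \<Rightarrow> 'x \<Rightarrow> 'x \<Rightarrow> 'k" where
  "free_gen K x = (\<lambda>y. if y = x then \<one>\<^bsub>K\<^esub> else \<zero>\<^bsub>K\<^esub>)"

definition bilinear_relators ::
    "'k ring \<Rightarrow> ('k, 'm) module \<Rightarrow> ('k, 'n) module \<Rightarrow> ('m \<times> 'n \<Rightarrow> 'k) set" where
  "bilinear_relators K M N =
     (let F = free_space K (carrier M \<times> carrier N); e = (\<lambda>m n. free_gen K (m, n)) in
       {e (m \<oplus>\<^bsub>M\<^esub> m') n \<ominus>\<^bsub>F\<^esub> (e m n \<oplus>\<^bsub>F\<^esub> e m' n) | m m' n.
          m \<in> carrier M \<and> m' \<in> carrier M \<and> n \<in> carrier N} \<union>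
       {e m (n \<oplus>\<^bsub>N\<^esub> n') \<ominus>\<^bsub>F\<^esub> (e m n \<oplus>\<^bsub>F\<^esub> e m n') | m n n'.
          m \<in> carrier M \<and> n \<in> carrier N \<and> n' \<in> carrier N} \<union>
       {e (a \<odot>\<^bsub>M\<^esub> m) n \<ominus>\<^bsub>F\<^esub> a \<odot>\<^bsub>F\<^esub> e m n | a m n.
          a \<in> carrier K \<and> m \<in> carrier M \<and> n \<in> carrier N} \<union>
       {e m (a \<odot>\<^bsub>N\<^esub> n) \<ominus>\<^bsub>F\<^esub> a \<odot>\<^bsub>F\<^esub> e m n | a m n.
          a \<in> carrier K \<and> m \<in> carrier M \<and> n \<in> carrier N})"

definition bilinear_relations ::
    "'k ring \<Rightarrow> ('k, 'm) module \<Rightarrow> ('k, 'n) module \<Rightarrow> ('m \<times> 'n \<Rightarrow> 'k) set" where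
  "bilinear_relations K M N =
     \<Inter>{R. submodule R K (free_space K (carrier M \<times> carrier N)) \<and> bilinear_relators K M N \<subseteq> R}"

type_synonym ('k, 'm, 'n) tensor = "('m \<times> 'n \<Rightarrow> 'k) set"

definition tensor ::
    "'k ring \<Rightarrow> ('k, 'm) module \<Rightarrow> ('k, 'n) module \<Rightarrow> ('k, ('k, 'm, 'n) tensor) module" where
  "tensor K M N =
     (let F = free_space K (carrier M \<times> carrier N); R = bilinear_relations K M N in
       \<lparr>carrier = a_rcosets\<^bsub>F\<^esub> R, mult = undefined, one = undefined,
        zero = R, add = (<+>\<^bsub>F\<^esub>),
        smult = (\<lambda>a A. \<Union>f\<in>A. R +>\<^bsub>F\<^esub> (a \<odot>\<^bsub>F\<^esub> f))\<rparr>)"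

definition pure_tensor ::
    "'k ring \<Rightarrow> ('k, 'm) module \<Rightarrow> ('k, 'n) module \<Rightarrow> 'm \<Rightarrow> 'n \<Rightarrow> ('k, 'm, 'n) tensor" where
  "pure_tensor K M N m n =
     bilinear_relations K M N +>\<^bsub>free_space K (carrier M \<times> carrier N)\<^esub> free_gen K (m, n)"

text \<open>
  The linear map out of the tensor product determined by a bilinear map \<open>B\<close>.  Membership in
  \<open>extensional\<close> fixes the values off the carrier, so that the map is unique as a HOL function.
\<close>

definition tensor_lift ::
    "'k ring \<Rightarrow> ('k, 'm) module \<Rightarrow> ('k, 'n) module \<Rightarrow> ('k, 'p) module \<Rightarrow>
     ('m \<Rightarrow> 'n \<Rightarrow> 'p) \<Rightarrow> ('k, 'm, 'n) tensor \<Rightarrow> 'p" where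
  "tensor_lift K M N P B =
     (THE g. g \<in> linear_maps K (tensor K M N) P \<and> g \<in> extensional (carrier (tensor K M N)) \<and>
        (\<forall>m\<in>carrier M. \<forall>n\<in>carrier N. g (pure_tensor K M N m n) = B m n))"

text \<open>\<open>tensor_map K M N M' N' f g\<close> is \<open>f \<otimes> g : M \<otimes> N \<rightarrow> M' \<otimes> N'\<close>.\<close>

definition tensor_map ::
    "'k ring \<Rightarrow> ('k, 'm) module \<Rightarrow> ('k, 'n) module \<Rightarrow> ('k, 'p) module \<Rightarrow> ('k, 'q) module \<Rightarrow>
     ('m \<Rightarrow> 'p) \<Rightarrow> ('n \<Rightarrow> 'q) \<Rightarrow> ('k, 'm, 'n) tensor \<Rightarrow> ('k, 'p, 'q) tensor" where
  "tensor_map K M N M' N' f g =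
     tensor_lift K M N (tensor K M' N') (\<lambda>m n. pure_tensor K M' N' (f m) (g n))"

text \<open>The canonical map \<open>(M \<otimes> N) \<otimes> P \<rightarrow> M \<otimes> (N \<otimes> P)\<close>.\<close>

definition tensor_assoc ::
    "'k ring \<Rightarrow> ('k, 'm) module \<Rightarrow> ('k, 'n) module \<Rightarrow> ('k, 'p) module \<Rightarrow>
     ('k, ('k, 'm, 'n) tensor, 'p) tensor \<Rightarrow> ('k, 'm, ('k, 'n, 'p) tensor) tensor" where
  "tensor_assoc K M N P =
     tensor_lift K (tensor K M N) P (tensor K M (tensor K N P))
       (\<lambda>t p. tensor_lift K M N (tensor K M (tensor K N P))
          (\<lambda>m n. pure_tensor K M (tensor K N P) m (pure_tensor K N P n p)) t)"

text \<open>The canonical maps \<open>K \<otimes> M \<rightarrow> M\<close> and \<open>M \<otimes> K \<rightarrow> M\<close>.\<close>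

definition tensor_lunit :: "'k ring \<Rightarrow> ('k, 'm) module \<Rightarrow> ('k, 'k, 'm) tensor \<Rightarrow> 'm" where
  "tensor_lunit K M = tensor_lift K (base_space K) M M (\<lambda>a m. a \<odot>\<^bsub>M\<^esub> m)"

definition tensor_runit :: "'k ring \<Rightarrow> ('k, 'm) module \<Rightarrow> ('k, 'm, 'k) tensor \<Rightarrow> 'm" where
  "tensor_runit K M = tensor_lift K M (base_space K) M (\<lambda>m a. a \<odot>\<^bsub>M\<^esub> m)"

text \<open>
  The tensor product of two algebras, with \<open>(m \<otimes> n)(m' \<otimes> n') = m m' \<otimes> n n'\<close> extended
  bilinearly.
\<close>

definition tensor_algebra ::
    "'k ring \<Rightarrow> ('k, 'm) module \<Rightarrow> ('k, 'n) module \<Rightarrow> ('k, ('k, 'm, 'n) tensor) module" where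
  "tensor_algebra K M N = (tensor K M N)
     \<lparr>mult := (\<lambda>s t. tensor_lift K M N (tensor K M N)
          (\<lambda>m n. tensor_lift K M N (tensor K M N)
             (\<lambda>m' n'. pure_tensor K M N (m \<otimes>\<^bsub>M\<^esub> m') (n \<otimes>\<^bsub>N\<^esub> n')) t) s),
      one := pure_tensor K M N \<one>\<^bsub>M\<^esub> \<one>\<^bsub>N\<^esub>\<rparr>"

section \<open>Hopf group-coalgebras and comodules\<close>

locale pi_coalgebra = K: field K + G: group G
  for K :: "'k ring" and G :: "'g monoid" +
  fixes C :: "'g \<Rightarrow> ('k, 'c) module"
    and \<Delta> :: "'g \<Rightarrow> 'g \<Rightarrow> 'c \<Rightarrow> ('k, 'c, 'c) tensor"
    and \<epsilon> :: "'c \<Rightarrow> 'k"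
  assumes space: "\<alpha> \<in> carrier G \<Longrightarrow> module K (C \<alpha>)"
    and comult_linear: "\<lbrakk>\<alpha> \<in> carrier G; \<beta> \<in> carrier G\<rbrakk> \<Longrightarrow>
      \<Delta> \<alpha> \<beta> \<in> linear_maps K (C (\<alpha> \<otimes>\<^bsub>G\<^esub> \<beta>)) (tensor K (C \<alpha>) (C \<beta>))"
    and counit_linear: "\<epsilon> \<in> linear_maps K (C \<one>\<^bsub>G\<^esub>) (base_space K)"
    and coassoc: "\<lbrakk>\<alpha> \<in> carrier G; \<beta> \<in> carrier G; \<gamma> \<in> carrier G;
        x \<in> carrier (C (\<alpha> \<otimes>\<^bsub>G\<^esub> \<beta> \<otimes>\<^bsub>G\<^esub> \<gamma>))\<rbrakk> \<Longrightarrow>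
      tensor_assoc K (C \<alpha>) (C \<beta>) (C \<gamma>)
        (tensor_map K (C (\<alpha> \<otimes>\<^bsub>G\<^esub> \<beta>)) (C \<gamma>) (tensor K (C \<alpha>) (C \<beta>)) (C \<gamma>)
           (\<Delta> \<alpha> \<beta>) id (\<Delta> (\<alpha> \<otimes>\<^bsub>G\<^esub> \<beta>) \<gamma> x)) =
      tensor_map K (C \<alpha>) (C (\<beta> \<otimes>\<^bsub>G\<^esub> \<gamma>)) (C \<alpha>) (tensor K (C \<beta>) (C \<gamma>))
        id (\<Delta> \<beta> \<gamma>) (\<Delta> \<alpha> (\<beta> \<otimes>\<^bsub>G\<^esub> \<gamma>) x)"
    and counit_left: "\<lbrakk>\<alpha> \<in> carrier G; x \<in> carrier (C \<alpha>)\<rbrakk> \<Longrightarrow>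
      tensor_lunit K (C \<alpha>)
        (tensor_map K (C \<one>\<^bsub>G\<^esub>) (C \<alpha>) (base_space K) (C \<alpha>) \<epsilon> id (\<Delta> \<one>\<^bsub>G\<^esub> \<alpha> x)) = x"
    and counit_right: "\<lbrakk>\<alpha> \<in> carrier G; x \<in> carrier (C \<alpha>)\<rbrakk> \<Longrightarrow>
      tensor_runit K (C \<alpha>)
        (tensor_map K (C \<alpha>) (C \<one>\<^bsub>G\<^esub>) (C \<alpha>) (base_space K) id \<epsilon> (\<Delta> \<alpha> \<one>\<^bsub>G\<^esub> x)) = x"

locale hopf_pi_coalgebra = pi_coalgebra K G H \<Delta> \<epsilon>
  for K :: "'k ring" and G :: "'g monoid" and H :: "'g \<Rightarrow> ('k, 'h) module"
    and \<Delta> :: "'g \<Rightarrow> 'g \<Rightarrow> 'h \<Rightarrow> ('k, 'h, 'h) tensor" and \<epsilon> :: "'h \<Rightarrow> 'k" +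
  fixes S :: "'g \<Rightarrow> 'h \<Rightarrow> 'h"
  assumes algebra: "\<alpha> \<in> carrier G \<Longrightarrow> assoc_algebra K (H \<alpha>)"
    and comult_algebra_map: "\<lbrakk>\<alpha> \<in> carrier G; \<beta> \<in> carrier G\<rbrakk> \<Longrightarrow>
      \<Delta> \<alpha> \<beta> \<in> algebra_maps K (H (\<alpha> \<otimes>\<^bsub>G\<^esub> \<beta>)) (tensor_algebra K (H \<alpha>) (H \<beta>))"
    and counit_algebra_map: "\<epsilon> \<in> algebra_maps K (H \<one>\<^bsub>G\<^esub>) (base_space K)"
    and antipode_linear: "\<alpha> \<in> carrier G \<Longrightarrow> S \<alpha> \<in> linear_maps K (H \<alpha>) (H (inv\<^bsub>G\<^esub> \<alpha>))"
    and antipode_left: "\<lbrakk>\<alpha> \<in> carrier G; x \<in> carrier (H \<one>\<^bsub>G\<^esub>)\<rbrakk> \<Longrightarrow>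
      tensor_lift K (H \<alpha>) (H \<alpha>) (H \<alpha>) (mult (H \<alpha>))
        (tensor_map K (H (inv\<^bsub>G\<^esub> \<alpha>)) (H \<alpha>) (H \<alpha>) (H \<alpha>)
           (S (inv\<^bsub>G\<^esub> \<alpha>)) id (\<Delta> (inv\<^bsub>G\<^esub> \<alpha>) \<alpha> x)) =
      \<epsilon> x \<odot>\<^bsub>H \<alpha>\<^esub> \<one>\<^bsub>H \<alpha>\<^esub>"
    and antipode_right: "\<lbrakk>\<alpha> \<in> carrier G; x \<in> carrier (H \<one>\<^bsub>G\<^esub>)\<rbrakk> \<Longrightarrow>
      tensor_lift K (H \<alpha>) (H \<alpha>) (H \<alpha>) (mult (H \<alpha>))
        (tensor_map K (H \<alpha>) (H (inv\<^bsub>G\<^esub> \<alpha>)) (H \<alpha>) (H \<alpha>)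
           id (S (inv\<^bsub>G\<^esub> \<alpha>)) (\<Delta> \<alpha> (inv\<^bsub>G\<^esub> \<alpha>) x)) =
      \<epsilon> x \<odot>\<^bsub>H \<alpha>\<^esub> \<one>\<^bsub>H \<alpha>\<^esub>"

locale right_pi_comodule = pi_coalgebra K G C \<Delta> \<epsilon>
  for K :: "'k ring" and G :: "'g monoid" and C :: "'g \<Rightarrow> ('k, 'c) module"
    and \<Delta> :: "'g \<Rightarrow> 'g \<Rightarrow> 'c \<Rightarrow> ('k, 'c, 'c) tensor" and \<epsilon> :: "'c \<Rightarrow> 'k" +
  fixes M :: "'g \<Rightarrow> ('k, 'm) module"
    and \<theta> :: "'g \<Rightarrow> 'g \<Rightarrow> 'm \<Rightarrow> ('k, 'm, 'c) tensor"
  assumes comodule_space: "\<alpha> \<in> carrier G \<Longrightarrow> module K (M \<alpha>)"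
    and coaction_linear: "\<lbrakk>\<alpha> \<in> carrier G; \<beta> \<in> carrier G\<rbrakk> \<Longrightarrow>
      \<theta> \<alpha> \<beta> \<in> linear_maps K (M (\<alpha> \<otimes>\<^bsub>G\<^esub> \<beta>)) (tensor K (M \<alpha>) (C \<beta>))"
    and coaction_coassoc: "\<lbrakk>\<alpha> \<in> carrier G; \<beta> \<in> carrier G; \<gamma> \<in> carrier G;
        x \<in> carrier (M (\<alpha> \<otimes>\<^bsub>G\<^esub> \<beta> \<otimes>\<^bsub>G\<^esub> \<gamma>))\<rbrakk> \<Longrightarrow>
      tensor_assoc K (M \<alpha>) (C \<beta>) (C \<gamma>)
        (tensor_map K (M (\<alpha> \<otimes>\<^bsub>G\<^esub> \<beta>)) (C \<gamma>) (tensor K (M \<alpha>) (C \<beta>)) (C \<gamma>)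
           (\<theta> \<alpha> \<beta>) id (\<theta> (\<alpha> \<otimes>\<^bsub>G\<^esub> \<beta>) \<gamma> x)) =
      tensor_map K (M \<alpha>) (C (\<beta> \<otimes>\<^bsub>G\<^esub> \<gamma>)) (M \<alpha>) (tensor K (C \<beta>) (C \<gamma>))
        id (\<Delta> \<beta> \<gamma>) (\<theta> \<alpha> (\<beta> \<otimes>\<^bsub>G\<^esub> \<gamma>) x)"
    and coaction_counit: "\<lbrakk>\<alpha> \<in> carrier G; x \<in> carrier (M \<alpha>)\<rbrakk> \<Longrightarrow>
      tensor_runit K (M \<alpha>)
        (tensor_map K (M \<alpha>) (C \<one>\<^bsub>G\<^esub>) (M \<alpha>) (base_space K) id \<epsilon> (\<theta> \<alpha> \<one>\<^bsub>G\<^esub> x)) = x"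

definition equivalent_right_pi_comodules ::
    "'k ring \<Rightarrow> 'g monoid \<Rightarrow> ('g \<Rightarrow> ('k, 'c) module) \<Rightarrow>
     ('g \<Rightarrow> 'g \<Rightarrow> 'c \<Rightarrow> ('k, 'c, 'c) tensor) \<Rightarrow> ('c \<Rightarrow> 'k) \<Rightarrow>
     ('g \<Rightarrow> ('k, 'm) module) \<Rightarrow> ('g \<Rightarrow> 'g \<Rightarrow> 'm \<Rightarrow> ('k, 'm, 'c) tensor) \<Rightarrow>
     ('g \<Rightarrow> ('k, 'n) module) \<Rightarrow> ('g \<Rightarrow> 'g \<Rightarrow> 'n \<Rightarrow> ('k, 'n, 'c) tensor) \<Rightarrow> bool" where
  "equivalent_right_pi_comodules K G C \<Delta> \<epsilon> M \<theta> N \<theta>' \<longleftrightarrow>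
     right_pi_comodule K G C \<Delta> \<epsilon> M \<theta> \<and> right_pi_comodule K G C \<Delta> \<epsilon> N \<theta>' \<and>
     (\<exists>F. (\<forall>\<alpha>\<in>carrier G. F \<alpha> \<in> linear_isos K (M \<alpha>) (N \<alpha>)) \<and>
        (\<forall>\<alpha>\<in>carrier G. \<forall>\<beta>\<in>carrier G. \<forall>x\<in>carrier (M (\<alpha> \<otimes>\<^bsub>G\<^esub> \<beta>)).
           \<theta>' \<alpha> \<beta> (F (\<alpha> \<otimes>\<^bsub>G\<^esub> \<beta>) x) =
           tensor_map K (M \<alpha>) (C \<beta>) (N \<alpha>) (C \<beta>) (F \<alpha>) id (\<theta> \<alpha> \<beta> x)))"

section \<open>Coisotropic quantum subgroups and induced representations\<close>

locale left_pi_coisotropic_quantum_subgroup =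
  H: hopf_pi_coalgebra K G H \<Delta>H \<epsilon>H S + C: pi_coalgebra K G C \<Delta>C \<epsilon>C
  for K :: "'k ring" and G :: "'g monoid" and H :: "'g \<Rightarrow> ('k, 'h) module"
    and \<Delta>H :: "'g \<Rightarrow> 'g \<Rightarrow> 'h \<Rightarrow> ('k, 'h, 'h) tensor" and \<epsilon>H :: "'h \<Rightarrow> 'k"
    and S :: "'g \<Rightarrow> 'h \<Rightarrow> 'h"
    and C :: "'g \<Rightarrow> ('k, 'c) module"
    and \<Delta>C :: "'g \<Rightarrow> 'g \<Rightarrow> 'c \<Rightarrow> ('k, 'c, 'c) tensor" and \<epsilon>C :: "'c \<Rightarrow> 'k" +
  fixes act :: "'g \<Rightarrow> 'h \<Rightarrow> 'c \<Rightarrow> 'c"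
    and \<sigma> :: "'g \<Rightarrow> 'h \<Rightarrow> 'c"
  assumes act_module: "\<alpha> \<in> carrier G \<Longrightarrow> left_algebra_module K (H \<alpha>) (C \<alpha>) (act \<alpha>)"
    and proj_linear: "\<alpha> \<in> carrier G \<Longrightarrow> \<sigma> \<alpha> \<in> linear_maps K (H \<alpha>) (C \<alpha>)"
    and proj_surj: "\<alpha> \<in> carrier G \<Longrightarrow> \<sigma> \<alpha> ` carrier (H \<alpha>) = carrier (C \<alpha>)"
    and proj_act: "\<lbrakk>\<alpha> \<in> carrier G; a \<in> carrier (H \<alpha>); x \<in> carrier (H \<alpha>)\<rbrakk> \<Longrightarrow>
      \<sigma> \<alpha> (a \<otimes>\<^bsub>H \<alpha>\<^esub> x) = act \<alpha> a (\<sigma> \<alpha> x)"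
    and proj_comult: "\<lbrakk>\<alpha> \<in> carrier G; \<beta> \<in> carrier G; x \<in> carrier (H (\<alpha> \<otimes>\<^bsub>G\<^esub> \<beta>))\<rbrakk> \<Longrightarrow>
      \<Delta>C \<alpha> \<beta> (\<sigma> (\<alpha> \<otimes>\<^bsub>G\<^esub> \<beta>) x) =
      tensor_map K (H \<alpha>) (H \<beta>) (C \<alpha>) (C \<beta>) (\<sigma> \<alpha>) (\<sigma> \<beta>) (\<Delta>H \<alpha> \<beta> x)"
    and proj_counit: "x \<in> carrier (H \<one>\<^bsub>G\<^esub>) \<Longrightarrow> \<epsilon>C (\<sigma> \<one>\<^bsub>G\<^esub> x) = \<epsilon>H x"

text \<open>The map \<open>L\<^sub>1\<^sub>,\<^sub>\<alpha> = (\<sigma>\<^sub>1 \<otimes> I) \<Delta>\<^sub>1\<^sub>,\<^sub>\<alpha> : H\<^sub>\<alpha> \<rightarrow> C\<^sub>1 \<otimes> H\<^sub>\<alpha>\<close>.\<close>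

definition left_coaction ::
    "'k ring \<Rightarrow> 'g monoid \<Rightarrow> ('g \<Rightarrow> ('k, 'h) module) \<Rightarrow>
     ('g \<Rightarrow> 'g \<Rightarrow> 'h \<Rightarrow> ('k, 'h, 'h) tensor) \<Rightarrow> ('g \<Rightarrow> ('k, 'c) module) \<Rightarrow> ('g \<Rightarrow> 'h \<Rightarrow> 'c) \<Rightarrow>
     'g \<Rightarrow> 'h \<Rightarrow> ('k, 'c, 'h) tensor" where
  "left_coaction K G H \<Delta>H C \<sigma> \<alpha> h =
     tensor_map K (H \<one>\<^bsub>G\<^esub>) (H \<alpha>) (C \<one>\<^bsub>G\<^esub>) (H \<alpha>) (\<sigma> \<one>\<^bsub>G\<^esub>) id (\<Delta>H \<one>\<^bsub>G\<^esub> \<alpha> h)"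

definition Ind_space ::
    "'k ring \<Rightarrow> 'g monoid \<Rightarrow> ('g \<Rightarrow> ('k, 'h) module) \<Rightarrow>
     ('g \<Rightarrow> 'g \<Rightarrow> 'h \<Rightarrow> ('k, 'h, 'h) tensor) \<Rightarrow> ('g \<Rightarrow> ('k, 'c) module) \<Rightarrow> ('g \<Rightarrow> 'h \<Rightarrow> 'c) \<Rightarrow>
     ('g \<Rightarrow> ('k, 'v) module) \<Rightarrow> ('g \<Rightarrow> 'g \<Rightarrow> 'v \<Rightarrow> ('k, 'v, 'c) tensor) \<Rightarrow>
     'g \<Rightarrow> ('k, ('k, 'v, 'h) tensor) module" where
  "Ind_space K G H \<Delta>H C \<sigma> V \<rho> \<alpha> = (tensor K (V \<one>\<^bsub>G\<^esub>) (H \<alpha>))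
     \<lparr>carrier := {x \<in> carrier (tensor K (V \<one>\<^bsub>G\<^esub>) (H \<alpha>)).
        tensor_map K (V \<one>\<^bsub>G\<^esub>) (H \<alpha>) (V \<one>\<^bsub>G\<^esub>) (tensor K (C \<one>\<^bsub>G\<^esub>) (H \<alpha>))
          id (left_coaction K G H \<Delta>H C \<sigma> \<alpha>) x =
        tensor_assoc K (V \<one>\<^bsub>G\<^esub>) (C \<one>\<^bsub>G\<^esub>) (H \<alpha>)
          (tensor_map K (V \<one>\<^bsub>G\<^esub>) (H \<alpha>) (tensor K (V \<one>\<^bsub>G\<^esub>) (C \<one>\<^bsub>G\<^esub>)) (H \<alpha>)
             (\<rho> \<one>\<^bsub>G\<^esub> \<one>\<^bsub>G\<^esub>) id x)}\<rparr>"

text \<open>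
  The coaction is the corestriction of \<open>I \<otimes> \<Delta>\<^sub>\<alpha>\<^sub>,\<^sub>\<beta>\<close> along the canonical embedding of
  \<open>Ind(\<rho>)\<^sub>\<alpha> \<otimes> H\<^sub>\<beta>\<close> into \<open>(V\<^sub>1 \<otimes> H\<^sub>\<alpha>) \<otimes> H\<^sub>\<beta> \<cong> V\<^sub>1 \<otimes> (H\<^sub>\<alpha> \<otimes> H\<^sub>\<beta>)\<close>.  This embedding is the
  tensor product of an inclusion with an identity; it is injective as \<open>K\<close> is a field, but it is
  not a set inclusion, because cosets in the two tensor products differ.
\<close>

definition Ind_coaction ::
    "'k ring \<Rightarrow> 'g monoid \<Rightarrow> ('g \<Rightarrow> ('k, 'h) module) \<Rightarrow>
     ('g \<Rightarrow> 'g \<Rightarrow> 'h \<Rightarrow> ('k, 'h, 'h) tensor) \<Rightarrow> ('g \<Rightarrow> ('k, 'c) module) \<Rightarrow> ('g \<Rightarrow> 'h \<Rightarrow> 'c) \<Rightarrow>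
     ('g \<Rightarrow> ('k, 'v) module) \<Rightarrow> ('g \<Rightarrow> 'g \<Rightarrow> 'v \<Rightarrow> ('k, 'v, 'c) tensor) \<Rightarrow>
     'g \<Rightarrow> 'g \<Rightarrow> ('k, 'v, 'h) tensor \<Rightarrow> ('k, ('k, 'v, 'h) tensor, 'h) tensor" where
  "Ind_coaction K G H \<Delta>H C \<sigma> V \<rho> \<alpha> \<beta> x =
     (let I = Ind_space K G H \<Delta>H C \<sigma> V \<rho> \<alpha> in
      THE y. y \<in> carrier (tensor K I (H \<beta>)) \<and>
        tensor_assoc K (V \<one>\<^bsub>G\<^esub>) (H \<alpha>) (H \<beta>)
          (tensor_map K I (H \<beta>) (tensor K (V \<one>\<^bsub>G\<^esub>) (H \<alpha>)) (H \<beta>) id id y) =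
        tensor_map K (V \<one>\<^bsub>G\<^esub>) (H (\<alpha> \<otimes>\<^bsub>G\<^esub> \<beta>)) (V \<one>\<^bsub>G\<^esub>) (tensor K (H \<alpha>) (H \<beta>))
          id (\<Delta>H \<alpha> \<beta>) x)"

end

(* The map F_1 \<otimes> I carries Ind(\<rho>) isomorphically onto Ind(\<rho>') because both equalized maps are
   natural in V_1; compatibility with the coactions is checked after embedding Ind(\<rho>')_\<alpha> \<otimes> H_\<beta>
   into W_1 \<otimes> (H_\<alpha> \<otimes> H_\<beta>).  That the coaction of Ind(\<rho>) exists at all needs exactness of the
   tensor product: over a field every linear map has a pseudo-inverse, so tensoring preserves
   equalizers, and coassociativity of \<Delta> puts (I \<otimes> \<Delta>)(x) in the equalizer tensored with H_\<beta>. *)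
theory Submission
  imports Defs
begin

section \<open>Linear and bilinear maps\<close>

text \<open>Equivalence includes the claim that both families are comodules, so most of the work
  lies in the comodule axioms for \<open>Ind\<close>; the isomorphism itself is short. Two encodings
  shape that work. Elements of a tensor product are cosets, so a subspace of \<open>M\<close> does
  not yield a subset of \<open>M \<otimes> N\<close>: every passage from \<open>Ind \<alpha>\<close>
  to its ambient space is an explicit map, and so is every rebracketing. Naturality and the pentagon
  of the associator are therefore proved, not suppressed. Moreover \<open>tensor_lift\<close> and
  \<open>Ind_coaction\<close> are definite descriptions, about which nothing is known before
  existence and uniqueness are settled. For the former this is the universal property, after which
  linear maps are compared on pure tensors. For the latter it is the injectivity of
  \<open>emb\<close>, which turns the coaction into \<open>id \<otimes> \<Delta>\<close>; linearity
  and coassociativity then follow by cancelling \<open>emb\<close>. The inverse isomorphism comes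
  from the same construction, applied to the inverse of the given map.\<close>

lemma linear_mapsI:
  assumes "\<And>x. x \<in> carrier M \<Longrightarrow> f x \<in> carrier N"
    and "\<And>x y. \<lbrakk>x \<in> carrier M; y \<in> carrier M\<rbrakk> \<Longrightarrow> f (x \<oplus>\<^bsub>M\<^esub> y) = f x \<oplus>\<^bsub>N\<^esub> f y"
    and "\<And>a x. \<lbrakk>a \<in> carrier K; x \<in> carrier M\<rbrakk> \<Longrightarrow> f (a \<odot>\<^bsub>M\<^esub> x) = a \<odot>\<^bsub>N\<^esub> f x"
  shows "f \<in> linear_maps K M N"
  using assms unfolding linear_maps_def by auto

lemma linear_map_closed: "\<lbrakk>f \<in> linear_maps K M N; x \<in> carrier M\<rbrakk> \<Longrightarrow> f x \<in> carrier N"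
  unfolding linear_maps_def by auto

lemma linear_map_add:
  "\<lbrakk>f \<in> linear_maps K M N; x \<in> carrier M; y \<in> carrier M\<rbrakk> \<Longrightarrow> f (x \<oplus>\<^bsub>M\<^esub> y) = f x \<oplus>\<^bsub>N\<^esub> f y"
  unfolding linear_maps_def by auto

lemma linear_map_smult:
  "\<lbrakk>f \<in> linear_maps K M N; a \<in> carrier K; x \<in> carrier M\<rbrakk> \<Longrightarrow> f (a \<odot>\<^bsub>M\<^esub> x) = a \<odot>\<^bsub>N\<^esub> f x"
  unfolding linear_maps_def by auto

lemma linear_map_id: "id \<in> linear_maps K M M"
  unfolding linear_maps_def by auto

lemma linear_map_comp:
  "\<lbrakk>f \<in> linear_maps K M N; g \<in> linear_maps K N P\<rbrakk> \<Longrightarrow> (\<lambda>x. g (f x)) \<in> linear_maps K M P"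
  by (rule linear_mapsI) (simp_all add: linear_map_closed linear_map_add linear_map_smult)

lemma linear_map_zero:
  assumes "module K M" "module K N" "f \<in> linear_maps K M N"
  shows "f \<zero>\<^bsub>M\<^esub> = \<zero>\<^bsub>N\<^esub>"
proof -
  interpret M: module K M by fact
  interpret N: module K N by fact
  have "f (\<zero>\<^bsub>K\<^esub> \<odot>\<^bsub>M\<^esub> \<zero>\<^bsub>M\<^esub>) = \<zero>\<^bsub>K\<^esub> \<odot>\<^bsub>N\<^esub> f \<zero>\<^bsub>M\<^esub>"
    by (rule linear_map_smult[OF assms(3)]) simp_all
  then show ?thesis using linear_map_closed[OF assms(3), of "\<zero>\<^bsub>M\<^esub>"] by simp
qed

text \<open>Negation is multiplication by the scalar -1, so homogeneity suffices.\<close>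

lemma linear_map_a_inv:
  assumes "module K M" "module K N" "f \<in> linear_maps K M N" "x \<in> carrier M"
  shows "f (\<ominus>\<^bsub>M\<^esub> x) = \<ominus>\<^bsub>N\<^esub> f x"
proof -
  interpret M: module K M by fact
  interpret N: module K N by fact
  have "f ((\<ominus>\<^bsub>K\<^esub> \<one>\<^bsub>K\<^esub>) \<odot>\<^bsub>M\<^esub> x) = (\<ominus>\<^bsub>K\<^esub> \<one>\<^bsub>K\<^esub>) \<odot>\<^bsub>N\<^esub> f x"
    using assms M.R.add.inv_closed M.R.one_closed by (intro linear_map_smult)
  then show ?thesis using linear_map_closed[OF assms(3,4)] assms(4)
    by (simp add: M.smult_l_minus N.smult_l_minus)
qed

lemma linear_map_minus:
  assumes "module K M" "module K N" "f \<in> linear_maps K M N" "x \<in> carrier M" "y \<in> carrier M"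
  shows "f (x \<ominus>\<^bsub>M\<^esub> y) = f x \<ominus>\<^bsub>N\<^esub> f y"
proof -
  interpret M: module K M by fact
  interpret N: module K N by fact
  show ?thesis unfolding a_minus_def
    using assms by (simp add: linear_map_add linear_map_a_inv)
qed

text \<open>Differences such as \<open>x - e x\<close> need the identity as an abstraction, not as
  the constant \<open>id\<close>.\<close>

lemma linear_map_ident: "(\<lambda>x. x) \<in> linear_maps K M M"
  unfolding linear_maps_def by auto

lemma linear_map_sum:
  assumes M: "module K M" and N: "module K N" and f: "f \<in> linear_maps K M N" and g: "g \<in> linear_maps K M N"
  shows "(\<lambda>x. f x \<oplus>\<^bsub>N\<^esub> g x) \<in> linear_maps K M N"
proof -
  interpret N: module K N by fact
  show ?thesis
    by (rule linear_mapsI)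
      (simp_all add: linear_map_closed[OF f] linear_map_closed[OF g] linear_map_add[OF f]
        linear_map_add[OF g] linear_map_smult[OF f] linear_map_smult[OF g] N.a_ac N.smult_r_distr)
qed

lemma linear_map_scale:
  assumes M: "module K M" and N: "module K N" and f: "f \<in> linear_maps K M N" and a: "a \<in> carrier K"
  shows "(\<lambda>x. a \<odot>\<^bsub>N\<^esub> f x) \<in> linear_maps K M N"
proof -
  interpret N: module K N by fact
  show ?thesis
    by (rule linear_mapsI)
      (simp_all add: a linear_map_closed[OF f] linear_map_add[OF f] linear_map_smult[OF f]
        N.smult_r_distr N.smult_assoc1[symmetric] N.R.m_comm)
qed

lemma linear_map_diff:
  assumes M: "module K M" and N: "module K N" and f: "f \<in> linear_maps K M N" and g: "g \<in> linear_maps K M N"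
  shows "(\<lambda>x. f x \<ominus>\<^bsub>N\<^esub> g x) \<in> linear_maps K M N"
proof -
  interpret N: module K N by fact
  show ?thesis
    by (rule linear_mapsI)
      (simp_all add: linear_map_closed[OF f] linear_map_closed[OF g] linear_map_add[OF f]
        linear_map_add[OF g] linear_map_smult[OF f] linear_map_smult[OF g] a_minus_def[of N]
        N.a_ac N.minus_add N.smult_r_distr N.smult_r_minus)
qed

lemma linear_map_inclusion:
  assumes "f \<in> linear_maps K M (N\<lparr>carrier := U\<rparr>)" "U \<subseteq> carrier N"
  shows "f \<in> linear_maps K M N"
  using assms unfolding linear_maps_def by auto

text \<open>Beyond describing \<open>Ind\<close>, this acts as an induction principle: if the
  equalizer of two linear maps contains the generators, the maps agree. With \<open>g\<close> zero
  it gives kernels.\<close>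

lemma submodule_equalizer:
  assumes "module K M" "module K N" "f \<in> linear_maps K M N" "g \<in> linear_maps K M N"
  shows "submodule {x \<in> carrier M. f x = g x} K M"
proof -
  interpret M: module K M by fact
  interpret N: module K N by fact
  show ?thesis
    by (rule M.submoduleI)
      (use assms in \<open>auto simp: linear_map_zero[OF assms(1,2)] linear_map_a_inv[OF assms(1,2)]
        linear_map_add linear_map_smult\<close>)
qed

text \<open>The laws are equations, and each passes along the surjection \<open>q\<close> from
  \<open>M\<close> to \<open>N\<close>. About the record \<open>N\<close> nothing is assumed
  beforehand, which suits a space of cosets.\<close>

lemma module_surj_image:
  assumes M: "module K M"
    and onto: "q ` carrier M = carrier N"
    and zero: "q \<zero>\<^bsub>M\<^esub> = \<zero>\<^bsub>N\<^esub>"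
    and add: "\<And>x y. \<lbrakk>x \<in> carrier M; y \<in> carrier M\<rbrakk> \<Longrightarrow> q x \<oplus>\<^bsub>N\<^esub> q y = q (x \<oplus>\<^bsub>M\<^esub> y)"
    and smult: "\<And>a x. \<lbrakk>a \<in> carrier K; x \<in> carrier M\<rbrakk> \<Longrightarrow> a \<odot>\<^bsub>N\<^esub> q x = q (a \<odot>\<^bsub>M\<^esub> x)"
  shows "module K N"
proof -
  interpret M: module K M by fact
  have ex: "\<exists>x\<in>carrier M. y = q x" if "y \<in> carrier N" for y
    using that onto by auto
  have q: "q x \<in> carrier N" if "x \<in> carrier M" for x
    using that onto by auto
  have "abelian_group N"
  proof (rule abelian_groupI)
    fix x y z assume "x \<in> carrier N" "y \<in> carrier N" "z \<in> carrier N"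
    then obtain x' y' z' where *: "x' \<in> carrier M" "y' \<in> carrier M" "z' \<in> carrier M"
      "x = q x'" "y = q y'" "z = q z'" using ex by meson
    show "(x \<oplus>\<^bsub>N\<^esub> y) \<oplus>\<^bsub>N\<^esub> z = x \<oplus>\<^bsub>N\<^esub> (y \<oplus>\<^bsub>N\<^esub> z)"
      using * by (simp add: add M.a_assoc)
  next
    fix x y assume "x \<in> carrier N" "y \<in> carrier N"
    then obtain x' y' where *: "x' \<in> carrier M" "y' \<in> carrier M" "x = q x'" "y = q y'"
      using ex by meson
    show "x \<oplus>\<^bsub>N\<^esub> y \<in> carrier N" "x \<oplus>\<^bsub>N\<^esub> y = y \<oplus>\<^bsub>N\<^esub> x"
      using * by (simp_all add: add M.a_comm q)
  next
    show "\<zero>\<^bsub>N\<^esub> \<in> carrier N" using q[of "\<zero>\<^bsub>M\<^esub>"] zero by simp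
  next
    fix x assume "x \<in> carrier N"
    then obtain x' where *: "x' \<in> carrier M" "x = q x'" using ex by meson
    show "\<zero>\<^bsub>N\<^esub> \<oplus>\<^bsub>N\<^esub> x = x"
      using * by (simp add: add zero[symmetric])
    show "\<exists>y\<in>carrier N. y \<oplus>\<^bsub>N\<^esub> x = \<zero>\<^bsub>N\<^esub>"
      by (rule bexI[of _ "q (\<ominus>\<^bsub>M\<^esub> x')"]) (use * in \<open>simp_all add: add zero q M.l_neg\<close>)
  qed
  then show ?thesis
  proof (rule moduleI[OF M.is_cring])
    fix a b x y assume ab: "a \<in> carrier K" "b \<in> carrier K" and xy: "x \<in> carrier N" "y \<in> carrier N"
    then obtain x' y' where *: "x' \<in> carrier M" "y' \<in> carrier M" "x = q x'" "y = q y'"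
      using ex by meson
    show "a \<odot>\<^bsub>N\<^esub> x \<in> carrier N" using ab * by (simp add: smult q)
    show "(a \<oplus>\<^bsub>K\<^esub> b) \<odot>\<^bsub>N\<^esub> x = a \<odot>\<^bsub>N\<^esub> x \<oplus>\<^bsub>N\<^esub> b \<odot>\<^bsub>N\<^esub> x"
      using ab * by (simp add: smult add M.smult_l_distr)
    show "a \<odot>\<^bsub>N\<^esub> (x \<oplus>\<^bsub>N\<^esub> y) = a \<odot>\<^bsub>N\<^esub> x \<oplus>\<^bsub>N\<^esub> a \<odot>\<^bsub>N\<^esub> y"
      using ab * by (simp add: smult add M.smult_r_distr)
    show "(a \<otimes>\<^bsub>K\<^esub> b) \<odot>\<^bsub>N\<^esub> x = a \<odot>\<^bsub>N\<^esub> (b \<odot>\<^bsub>N\<^esub> x)"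
      using ab * by (simp add: smult M.smult_assoc1)
  next
    fix x assume "x \<in> carrier N"
    then obtain x' where *: "x' \<in> carrier M" "x = q x'" using ex by meson
    then show "\<one>\<^bsub>K\<^esub> \<odot>\<^bsub>N\<^esub> x = x" by (simp add: smult)
  qed
qed

section \<open>Maps that are linear in each of two arguments\<close>

definition bilinear_maps ::
    "'k ring \<Rightarrow> ('k, 'm) module \<Rightarrow> ('k, 'n) module \<Rightarrow> ('k, 'p) module \<Rightarrow> ('m \<Rightarrow> 'n \<Rightarrow> 'p) set" where
  "bilinear_maps K M N P = {B. (\<forall>m\<in>carrier M. B m \<in> linear_maps K N P) \<and>
     (\<forall>n\<in>carrier N. (\<lambda>m. B m n) \<in> linear_maps K M P)}"

lemma bilinear_mapsI:
  assumes "\<And>m. m \<in> carrier M \<Longrightarrow> B m \<in> linear_maps K N P"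
    and "\<And>n. n \<in> carrier N \<Longrightarrow> (\<lambda>m. B m n) \<in> linear_maps K M P"
  shows "B \<in> bilinear_maps K M N P"
  using assms unfolding bilinear_maps_def by auto

lemma bilinear_map_left: "\<lbrakk>B \<in> bilinear_maps K M N P; n \<in> carrier N\<rbrakk> \<Longrightarrow> (\<lambda>m. B m n) \<in> linear_maps K M P"
  and bilinear_map_right: "\<lbrakk>B \<in> bilinear_maps K M N P; m \<in> carrier M\<rbrakk> \<Longrightarrow> B m \<in> linear_maps K N P"
  unfolding bilinear_maps_def by auto

text \<open>With identities for some of \<open>f\<close>, \<open>g\<close> and \<open>h\<close>,
  this one rule yields the bilinearity behind \<open>tensor_map\<close> and behind nested pure
  tensors.\<close>

lemma bilinear_map_comp:
  assumes B: "B \<in> bilinear_maps K M' N' P" and f: "f \<in> linear_maps K M M'"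
    and g: "g \<in> linear_maps K N N'" and h: "h \<in> linear_maps K P P'"
  shows "(\<lambda>m n. h (B (f m) (g n))) \<in> bilinear_maps K M N P'"
proof (rule bilinear_mapsI)
  fix m assume "m \<in> carrier M"
  then show "(\<lambda>n. h (B (f m) (g n))) \<in> linear_maps K N P'"
    using bilinear_map_right[OF B] linear_map_closed[OF f] g h linear_map_comp by metis
next
  fix n assume "n \<in> carrier N"
  then show "(\<lambda>m. h (B (f m) (g n))) \<in> linear_maps K M P'"
    using linear_map_comp[OF linear_map_comp[OF f bilinear_map_left[OF B linear_map_closed[OF g]]] h] by auto
qed

section \<open>The free space\<close>

lemma carrier_free_space:
  "f \<in> carrier (free_space K X) \<longleftrightarrow>
     (\<forall>x. f x \<in> carrier K) \<and> finite {x. f x \<noteq> \<zero>\<^bsub>K\<^esub>} \<and> (\<forall>x. x \<notin> X \<longrightarrow> f x = \<zero>\<^bsub>K\<^esub>)"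
  unfolding free_space_def by simp

lemma free_space_simps:
  "\<zero>\<^bsub>free_space K X\<^esub> = (\<lambda>x. \<zero>\<^bsub>K\<^esub>)"
  "f \<oplus>\<^bsub>free_space K X\<^esub> g = (\<lambda>x. f x \<oplus>\<^bsub>K\<^esub> g x)"
  "a \<odot>\<^bsub>free_space K X\<^esub> f = (\<lambda>x. a \<otimes>\<^bsub>K\<^esub> f x)"
  unfolding free_space_def by simp_all

lemma free_space_module:
  assumes "cring K"
  shows "module K (free_space K X)"
proof -
  interpret K: cring K by fact
  \<comment> \<open>Sums, negatives and scalar multiples are supported in a union of supports; unary
    operations use it with \<open>g = f\<close>.\<close>
  have fin: "finite {x. h x \<noteq> \<zero>\<^bsub>K\<^esub>}"
    if "finite {x. f x \<noteq> \<zero>\<^bsub>K\<^esub>}" "finite {x. g x \<noteq> \<zero>\<^bsub>K\<^esub>}"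
      "\<And>x. f x = \<zero>\<^bsub>K\<^esub> \<Longrightarrow> g x = \<zero>\<^bsub>K\<^esub> \<Longrightarrow> h x = \<zero>\<^bsub>K\<^esub>" for f g h :: "'b \<Rightarrow> 'a"
    by (rule finite_subset[of _ "{x. f x \<noteq> \<zero>\<^bsub>K\<^esub>} \<union> {x. g x \<noteq> \<zero>\<^bsub>K\<^esub>}"]) (use that in auto)
  have "abelian_group (free_space K X)"
  proof (rule abelian_groupI)
    fix f g assume "f \<in> carrier (free_space K X)" "g \<in> carrier (free_space K X)"
    then show "f \<oplus>\<^bsub>free_space K X\<^esub> g \<in> carrier (free_space K X)"
      using fin[of f g "\<lambda>x. f x \<oplus>\<^bsub>K\<^esub> g x"] by (auto simp: carrier_free_space free_space_simps)
  next
    fix f assume f: "f \<in> carrier (free_space K X)"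
    show "\<exists>g\<in>carrier (free_space K X). g \<oplus>\<^bsub>free_space K X\<^esub> f = \<zero>\<^bsub>free_space K X\<^esub>"
      by (rule bexI[of _ "\<lambda>x. \<ominus>\<^bsub>K\<^esub> f x"])
        (use f fin[of f f "\<lambda>x. \<ominus>\<^bsub>K\<^esub> f x"] in \<open>auto simp: carrier_free_space free_space_simps K.l_neg\<close>)
  qed (auto simp: carrier_free_space free_space_simps K.a_ac)
  then show ?thesis
  proof (rule moduleI[OF assms])
    fix a f assume "a \<in> carrier K" "f \<in> carrier (free_space K X)"
    then show "a \<odot>\<^bsub>free_space K X\<^esub> f \<in> carrier (free_space K X)"
      using fin[of f f "\<lambda>x. a \<otimes>\<^bsub>K\<^esub> f x"] by (auto simp: carrier_free_space free_space_simps)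
  qed (auto simp: carrier_free_space free_space_simps K.l_distr K.r_distr K.m_assoc)
qed

lemma free_gen_closed:
  assumes "cring K" "x \<in> X"
  shows "free_gen K x \<in> carrier (free_space K X)"
proof -
  interpret K: cring K by fact
  have "finite {y. free_gen K x y \<noteq> \<zero>\<^bsub>K\<^esub>}"
    by (rule finite_subset[of _ "{x}"]) (auto simp: free_gen_def)
  then show ?thesis using assms(2) by (auto simp: carrier_free_space free_gen_def)
qed

text \<open>Induction on a finite set that contains the support: the value at one point is split off
  as a multiple of a generator.\<close>

lemma free_space_span:
  assumes K: "cring K" and U: "submodule U K (free_space K X)"
    and gen: "\<And>x. x \<in> X \<Longrightarrow> free_gen K x \<in> U"
  shows "carrier (free_space K X) \<subseteq> U"
proof -
  interpret K: cring K by fact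
  interpret F: module K "free_space K X" using free_space_module[OF K] .
  have "f \<in> U" if "finite A" "f \<in> carrier (free_space K X)" "{x. f x \<noteq> \<zero>\<^bsub>K\<^esub>} \<subseteq> A" for A f
    using that
  proof (induction A arbitrary: f)
    case empty
    then have "f = \<zero>\<^bsub>free_space K X\<^esub>" by (auto simp: free_space_simps)
    then show ?case using submodule.axioms(1)[OF U] subgroup.one_closed by fastforce
  next
    case (insert a A)
    let ?g = "\<lambda>x. if x = a then \<zero>\<^bsub>K\<^esub> else f x"
    have fin: "finite {x. ?g x \<noteq> \<zero>\<^bsub>K\<^esub>}"
      using insert.prems(1) by (auto simp: carrier_free_space elim!: rev_finite_subset)
    have g: "?g \<in> carrier (free_space K X)"
      using insert.prems(1) fin by (auto simp: carrier_free_space)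
    have gU: "?g \<in> U" by (rule insert.IH[OF g]) (use insert.prems(2) in auto)
    have fa: "f x \<in> carrier K" for x using insert.prems(1) by (auto simp: carrier_free_space)
    show ?case
    \<comment> \<open>The finite set is arbitrary and may leave \<open>X\<close>; there no generator
      is available, but \<open>f\<close> vanishes anyway.\<close>
    proof (cases "a \<in> X")
      case True
      have "f = ?g \<oplus>\<^bsub>free_space K X\<^esub> (f a \<odot>\<^bsub>free_space K X\<^esub> free_gen K a)"
        using fa by (auto simp: free_space_simps free_gen_def)
      then show ?thesis
        using F.submoduleE(4,5)[OF U] gU gen[OF True] fa by metis
    next
      case False
      then have "f = ?g" using insert.prems(1) by (auto simp: carrier_free_space)
      then show ?thesis using gU by simp
    qed
  qed
  then show ?thesis by (auto simp: carrier_free_space)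
qed

section \<open>Linear extension of a map given on the basis of a free space\<close>

definition free_lift :: "'k ring \<Rightarrow> ('k, 'p) module \<Rightarrow> ('x \<Rightarrow> 'p) \<Rightarrow> ('x \<Rightarrow> 'k) \<Rightarrow> 'p" where
  "free_lift K P b f = (\<Oplus>\<^bsub>P\<^esub>x\<in>{x. f x \<noteq> \<zero>\<^bsub>K\<^esub>}. f x \<odot>\<^bsub>P\<^esub> b x)"

text \<open>The support of a sum can be smaller than the union of the supports. Added zero terms do
  not change the value, so sums are compared over one common index set.\<close>

lemma free_lift_superset:
  assumes P: "module K P" and b: "\<And>x. x \<in> X \<Longrightarrow> b x \<in> carrier P"
    and f: "f \<in> carrier (free_space K X)"
    and A: "finite A" "{x. f x \<noteq> \<zero>\<^bsub>K\<^esub>} \<subseteq> A" "A \<subseteq> X"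
  shows "free_lift K P b f = (\<Oplus>\<^bsub>P\<^esub>x\<in>A. f x \<odot>\<^bsub>P\<^esub> b x)"
proof -
  interpret P: module K P by fact
  show ?thesis unfolding free_lift_def
    by (rule P.add.finprod_mono_neutral_cong_left) (use A b f in \<open>auto simp: carrier_free_space\<close>)
qed

lemma free_lift_linear:
  assumes P: "module K P" and b: "\<And>x. x \<in> X \<Longrightarrow> b x \<in> carrier P"
  shows "free_lift K P b \<in> linear_maps K (free_space K X) P"
proof -
  interpret P: module K P by fact
  interpret F: module K "free_space K X" using free_space_module[OF P.is_cring] .
  have supp: "{x. f x \<noteq> \<zero>\<^bsub>K\<^esub>} \<subseteq> X" "finite {x. f x \<noteq> \<zero>\<^bsub>K\<^esub>}" "\<And>x. f x \<in> carrier K"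
    if "f \<in> carrier (free_space K X)" for f
    using that by (auto simp: carrier_free_space)
  show ?thesis
  proof (rule linear_mapsI)
    fix f assume f: "f \<in> carrier (free_space K X)"
    show "free_lift K P b f \<in> carrier P" unfolding free_lift_def
      by (rule P.finsum_closed) (use supp[OF f] b in auto)
  next
    fix f g assume f: "f \<in> carrier (free_space K X)" and g: "g \<in> carrier (free_space K X)"
    let ?A = "{x. f x \<noteq> \<zero>\<^bsub>K\<^esub>} \<union> {x. g x \<noteq> \<zero>\<^bsub>K\<^esub>}"
    have A: "finite ?A" "?A \<subseteq> X" using supp f g by auto
    have fg: "f \<oplus>\<^bsub>free_space K X\<^esub> g \<in> carrier (free_space K X)" using f g by simp
    have "free_lift K P b (f \<oplus>\<^bsub>free_space K X\<^esub> g) =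
      (\<Oplus>\<^bsub>P\<^esub>x\<in>?A. (f \<oplus>\<^bsub>free_space K X\<^esub> g) x \<odot>\<^bsub>P\<^esub> b x)"
      by (rule free_lift_superset[OF P b fg]) (use A in \<open>auto simp: free_space_simps\<close>)
    also have "\<dots> = (\<Oplus>\<^bsub>P\<^esub>x\<in>?A. f x \<odot>\<^bsub>P\<^esub> b x \<oplus>\<^bsub>P\<^esub> g x \<odot>\<^bsub>P\<^esub> b x)"
    proof (rule P.finsum_cong')
      fix x assume "x \<in> ?A"
      then show "(f \<oplus>\<^bsub>free_space K X\<^esub> g) x \<odot>\<^bsub>P\<^esub> b x = f x \<odot>\<^bsub>P\<^esub> b x \<oplus>\<^bsub>P\<^esub> g x \<odot>\<^bsub>P\<^esub> b x"
        unfolding free_space_simps using A(2) supp(3)[OF f] supp(3)[OF g] b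
        by (intro P.smult_l_distr) auto
    qed (use A supp(3)[OF f] supp(3)[OF g] b in auto)
    also have "\<dots> = (\<Oplus>\<^bsub>P\<^esub>x\<in>?A. f x \<odot>\<^bsub>P\<^esub> b x) \<oplus>\<^bsub>P\<^esub> (\<Oplus>\<^bsub>P\<^esub>x\<in>?A. g x \<odot>\<^bsub>P\<^esub> b x)"
      by (rule P.finsum_addf) (use A supp(3)[OF f] supp(3)[OF g] b in auto)
    also have "(\<Oplus>\<^bsub>P\<^esub>x\<in>?A. f x \<odot>\<^bsub>P\<^esub> b x) = free_lift K P b f"
      by (rule free_lift_superset[OF P b f, symmetric]) (use A in auto)
    also have "(\<Oplus>\<^bsub>P\<^esub>x\<in>?A. g x \<odot>\<^bsub>P\<^esub> b x) = free_lift K P b g"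
      by (rule free_lift_superset[OF P b g, symmetric]) (use A in auto)
    finally show "free_lift K P b (f \<oplus>\<^bsub>free_space K X\<^esub> g) = free_lift K P b f \<oplus>\<^bsub>P\<^esub> free_lift K P b g" .
  next
    fix a f assume a: "a \<in> carrier K" and f: "f \<in> carrier (free_space K X)"
    let ?A = "{x. f x \<noteq> \<zero>\<^bsub>K\<^esub>}"
    have af: "a \<odot>\<^bsub>free_space K X\<^esub> f \<in> carrier (free_space K X)" using a f by simp
    have "free_lift K P b (a \<odot>\<^bsub>free_space K X\<^esub> f) = (\<Oplus>\<^bsub>P\<^esub>x\<in>?A. (a \<odot>\<^bsub>free_space K X\<^esub> f) x \<odot>\<^bsub>P\<^esub> b x)"
      by (rule free_lift_superset[OF P b af]) (use supp[OF f] a in \<open>auto simp: free_space_simps\<close>)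
    also have "\<dots> = (\<Oplus>\<^bsub>P\<^esub>x\<in>?A. a \<odot>\<^bsub>P\<^esub> (f x \<odot>\<^bsub>P\<^esub> b x))"
    proof (rule P.finsum_cong')
      fix x assume "x \<in> ?A"
      then show "(a \<odot>\<^bsub>free_space K X\<^esub> f) x \<odot>\<^bsub>P\<^esub> b x = a \<odot>\<^bsub>P\<^esub> (f x \<odot>\<^bsub>P\<^esub> b x)"
        unfolding free_space_simps using supp[OF f] a b by (intro P.smult_assoc1) auto
    qed (use supp[OF f] a b in auto)
    also have "\<dots> = a \<odot>\<^bsub>P\<^esub> free_lift K P b f" unfolding free_lift_def
      by (rule P.finsum_smult_ldistr[symmetric]) (use supp[OF f] a b in auto)
    finally show "free_lift K P b (a \<odot>\<^bsub>free_space K X\<^esub> f) = a \<odot>\<^bsub>P\<^esub> free_lift K P b f" .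
  qed
qed

lemma free_lift_gen:
  assumes P: "module K P" and b: "\<And>x. x \<in> X \<Longrightarrow> b x \<in> carrier P" and x: "x \<in> X"
  shows "free_lift K P b (free_gen K x) = b x"
proof -
  interpret P: module K P by fact
  \<comment> \<open>The singleton is only a superset of the support: in a zero ring the generator is
    zero.\<close>
  have "free_lift K P b (free_gen K x) = (\<Oplus>\<^bsub>P\<^esub>y\<in>{x}. free_gen K x y \<odot>\<^bsub>P\<^esub> b y)"
    by (rule free_lift_superset[OF P b free_gen_closed[OF P.is_cring x]])
      (use x in \<open>auto simp: free_gen_def\<close>)
  also have "\<dots> = b x" using b[OF x] by (simp add: free_gen_def)
  finally show ?thesis .
qed

section \<open>The universal property of the tensor product\<close>

lemma bilinear_relators_subset:
  assumes M: "module K M" and N: "module K N"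
  shows "bilinear_relators K M N \<subseteq> carrier (free_space K (carrier M \<times> carrier N))"
proof -
  interpret M: module K M by fact
  interpret N: module K N by fact
  interpret F: module K "free_space K (carrier M \<times> carrier N)"
    using free_space_module[OF M.is_cring] .
  have gen: "free_gen K (m, n) \<in> carrier (free_space K (carrier M \<times> carrier N))"
    if "m \<in> carrier M" "n \<in> carrier N" for m n
    using that by (intro free_gen_closed[OF M.is_cring]) simp
  show ?thesis unfolding bilinear_relators_def Let_def
    by (intro Un_least subsetI; clarify; intro F.minus_closed F.a_closed F.smult_closed gen) simp_all
qed

lemma submodule_bilinear_relations:
  assumes M: "module K M" and N: "module K N"
  shows "submodule (bilinear_relations K M N) K (free_space K (carrier M \<times> carrier N))"
proof -
  interpret M: module K M by fact
  let ?F = "free_space K (carrier M \<times> carrier N)"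
  interpret F: module K ?F using free_space_module[OF M.is_cring] .
  show ?thesis
  proof (rule F.submoduleI)
    \<comment> \<open>An intersection over no submodule at all would be the whole type; the full
      free space is one that qualifies.\<close>
    show "bilinear_relations K M N \<subseteq> carrier ?F"
      unfolding bilinear_relations_def
      using F.carrier_is_submodule bilinear_relators_subset[OF M N] by auto
    show "\<zero>\<^bsub>?F\<^esub> \<in> bilinear_relations K M N"
      unfolding bilinear_relations_def
      using submodule.axioms(1) subgroup.one_closed by fastforce
  next
    fix a b assume "a \<in> bilinear_relations K M N" "b \<in> bilinear_relations K M N"
    then show "a \<oplus>\<^bsub>?F\<^esub> b \<in> bilinear_relations K M N"
      unfolding bilinear_relations_def using F.submoduleE(5) by blast
  next
    fix a assume "a \<in> bilinear_relations K M N"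
    then show "\<ominus>\<^bsub>?F\<^esub> a \<in> bilinear_relations K M N"
      unfolding bilinear_relations_def using F.submoduleE(3) by blast
  next
    fix a b assume "a \<in> carrier K" "b \<in> bilinear_relations K M N"
    then show "a \<odot>\<^bsub>?F\<^esub> b \<in> bilinear_relations K M N"
      unfolding bilinear_relations_def using F.submoduleE(4) by blast
  qed
qed

lemma bilinear_relators_relations: "bilinear_relators K M N \<subseteq> bilinear_relations K M N"
  unfolding bilinear_relations_def by auto

lemma bilinear_relations_least:
  "\<lbrakk>submodule R K (free_space K (carrier M \<times> carrier N)); bilinear_relators K M N \<subseteq> R\<rbrakk> \<Longrightarrow>
     bilinear_relations K M N \<subseteq> R"
  unfolding bilinear_relations_def by auto

section \<open>The quotient map from the free space, and the operations on cosets\<close>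

definition tensor_proj ::
    "'k ring \<Rightarrow> ('k, 'm) module \<Rightarrow> ('k, 'n) module \<Rightarrow> ('m \<times> 'n \<Rightarrow> 'k) \<Rightarrow> ('k, 'm, 'n) tensor" where
  "tensor_proj K M N f = bilinear_relations K M N +>\<^bsub>free_space K (carrier M \<times> carrier N)\<^esub> f"

lemma pure_tensor_proj: "pure_tensor K M N m n = tensor_proj K M N (free_gen K (m, n))"
  unfolding pure_tensor_def tensor_proj_def by simp

context
  fixes K :: "'k ring" and M :: "('k, 'm) module" and N :: "('k, 'n) module"
  assumes M: "module K M" and N: "module K N"
begin

interpretation M: module K M by (rule M)
interpretation N: module K N by (rule N)

private abbreviation "F \<equiv> free_space K (carrier M \<times> carrier N)"
private abbreviation "R \<equiv> bilinear_relations K M N"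
private abbreviation "q \<equiv> tensor_proj K M N"

interpretation F: module K F using free_space_module[OF M.is_cring] .

private lemma R: "submodule R K F"
  using submodule_bilinear_relations[OF M N] .

interpretation R: abelian_subgroup R F
  by (rule abelian_subgroupI3[OF additive_subgroup.intro F.abelian_group_axioms])
    (rule submodule.axioms(1)[OF R])

private lemma gen: "\<lbrakk>m \<in> carrier M; n \<in> carrier N\<rbrakk> \<Longrightarrow> free_gen K (m, n) \<in> carrier F"
  by (intro free_gen_closed[OF M.is_cring]) simp

private lemma proj_eq_iff:
  assumes "f \<in> carrier F" "g \<in> carrier F"
  shows "q f = q g \<longleftrightarrow> f \<ominus>\<^bsub>F\<^esub> g \<in> R"
proof -
  have "q f = q g \<longleftrightarrow> f \<in> q g"
    using assms R.a_rcos_self R.a_repr_independence' unfolding tensor_proj_def by metis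
  then show ?thesis
    using R.a_rcos_module[OF assms(2,1)] unfolding tensor_proj_def a_minus_def by simp
qed

lemma tensor_proj_image: "q ` carrier F = carrier (tensor K M N)"
  unfolding tensor_def tensor_proj_def Let_def A_RCOSETS_def'
  by (simp only: partial_object.select_convs UNION_singleton_eq_range)

lemma tensor_proj_zero: "q \<zero>\<^bsub>F\<^esub> = \<zero>\<^bsub>tensor K M N\<^esub>"
  unfolding tensor_def tensor_proj_def Let_def by (simp add: R.a_subset)

lemma tensor_proj_add:
  "\<lbrakk>f \<in> carrier F; g \<in> carrier F\<rbrakk> \<Longrightarrow> q f \<oplus>\<^bsub>tensor K M N\<^esub> q g = q (f \<oplus>\<^bsub>F\<^esub> g)"
  unfolding tensor_def tensor_proj_def Let_def by (simp add: R.a_rcos_sum)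

text \<open>Scalar multiplication of a coset is a union over all representatives. Each contributes
  the same coset, because the relations are closed under scalars, and \<open>f\<close> itself shows
  that the union is not empty.\<close>

lemma tensor_proj_smult:
  assumes a: "a \<in> carrier K" and f: "f \<in> carrier F"
  shows "a \<odot>\<^bsub>tensor K M N\<^esub> q f = q (a \<odot>\<^bsub>F\<^esub> f)"
proof -
  have "q (a \<odot>\<^bsub>F\<^esub> g) = q (a \<odot>\<^bsub>F\<^esub> f)" if "g \<in> q f" for g
  proof -
    have g: "g \<in> carrier F" using that f unfolding tensor_proj_def
      using R.a_elemrcos_carrier by blast
    have "q g = q f" using that f unfolding tensor_proj_def
      using R.a_repr_independence' by blast
    then have "g \<ominus>\<^bsub>F\<^esub> f \<in> R" using proj_eq_iff f g by blast
    then have "a \<odot>\<^bsub>F\<^esub> (g \<ominus>\<^bsub>F\<^esub> f) \<in> R" using a F.submoduleE(4)[OF R] by blast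
    then show ?thesis using a f g
      by (subst proj_eq_iff) (simp_all add: a_minus_def F.smult_r_distr F.smult_r_minus)
  qed
  note eq = this
  have "a \<odot>\<^bsub>tensor K M N\<^esub> q f = (\<Union>g\<in>q f. q (a \<odot>\<^bsub>F\<^esub> g))"
    unfolding tensor_def tensor_proj_def Let_def by simp
  also have "\<dots> = (\<Union>g\<in>q f. q (a \<odot>\<^bsub>F\<^esub> f))" by (rule SUP_cong[OF refl eq])
  also have "\<dots> = q (a \<odot>\<^bsub>F\<^esub> f)"
    using f R.a_rcos_self unfolding tensor_proj_def by (intro UN_constant[THEN trans]) auto
  finally show ?thesis .
qed

lemma tensor_module: "module K (tensor K M N)"
  by (rule module_surj_image[OF F.module_axioms tensor_proj_image])
    (simp_all add: tensor_proj_zero tensor_proj_add tensor_proj_smult)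

interpretation T: module K "tensor K M N" by (rule tensor_module)

private lemma q_linear: "q \<in> linear_maps K F (tensor K M N)"
proof (rule linear_mapsI)
  show "q x \<in> carrier (tensor K M N)" if "x \<in> carrier F" for x
    using that tensor_proj_image by blast
qed (simp_all add: tensor_proj_add tensor_proj_smult)

private lemma proj_eq: "\<lbrakk>f \<ominus>\<^bsub>F\<^esub> g \<in> bilinear_relators K M N; f \<in> carrier F; g \<in> carrier F\<rbrakk> \<Longrightarrow> q f = q g"
  using proj_eq_iff bilinear_relators_relations by blast

text \<open>Additivity and homogeneity in the two arguments are precisely the four families of
  relators, which the quotient kills.\<close>

lemma pure_tensor_bilinear: "pure_tensor K M N \<in> bilinear_maps K M N (tensor K M N)"
proof (rule bilinear_mapsI; rule linear_mapsI)
  \<comment> \<open>Closedness occurs twice because linearity is asked for in each argument.\<close>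
  fix m n assume "m \<in> carrier M" "n \<in> carrier N"
  then show "pure_tensor K M N m n \<in> carrier (tensor K M N)"
    "pure_tensor K M N m n \<in> carrier (tensor K M N)"
    unfolding pure_tensor_proj using linear_map_closed[OF q_linear] gen by auto
next
  fix m m' n assume *: "m \<in> carrier M" "m' \<in> carrier M" "n \<in> carrier N"
  have "free_gen K (m \<oplus>\<^bsub>M\<^esub> m', n) \<ominus>\<^bsub>F\<^esub> (free_gen K (m, n) \<oplus>\<^bsub>F\<^esub> free_gen K (m', n)) \<in> bilinear_relators K M N"
    unfolding bilinear_relators_def Let_def using * by blast
  then show "pure_tensor K M N (m \<oplus>\<^bsub>M\<^esub> m') n = pure_tensor K M N m n \<oplus>\<^bsub>tensor K M N\<^esub> pure_tensor K M N m' n"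
    unfolding pure_tensor_proj using * by (simp add: gen tensor_proj_add proj_eq)
next
  fix m n n' assume *: "m \<in> carrier M" "n \<in> carrier N" "n' \<in> carrier N"
  have "free_gen K (m, n \<oplus>\<^bsub>N\<^esub> n') \<ominus>\<^bsub>F\<^esub> (free_gen K (m, n) \<oplus>\<^bsub>F\<^esub> free_gen K (m, n')) \<in> bilinear_relators K M N"
    unfolding bilinear_relators_def Let_def using * by blast
  then show "pure_tensor K M N m (n \<oplus>\<^bsub>N\<^esub> n') = pure_tensor K M N m n \<oplus>\<^bsub>tensor K M N\<^esub> pure_tensor K M N m n'"
    unfolding pure_tensor_proj using * by (simp add: gen tensor_proj_add proj_eq)
next
  fix a m n assume *: "a \<in> carrier K" "m \<in> carrier M" "n \<in> carrier N"
  have "free_gen K (a \<odot>\<^bsub>M\<^esub> m, n) \<ominus>\<^bsub>F\<^esub> a \<odot>\<^bsub>F\<^esub> free_gen K (m, n) \<in> bilinear_relators K M N"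
    unfolding bilinear_relators_def Let_def using * by blast
  then show "pure_tensor K M N (a \<odot>\<^bsub>M\<^esub> m) n = a \<odot>\<^bsub>tensor K M N\<^esub> pure_tensor K M N m n"
    unfolding pure_tensor_proj using * by (simp add: gen tensor_proj_smult proj_eq)
  have "free_gen K (m, a \<odot>\<^bsub>N\<^esub> n) \<ominus>\<^bsub>F\<^esub> a \<odot>\<^bsub>F\<^esub> free_gen K (m, n) \<in> bilinear_relators K M N"
    unfolding bilinear_relators_def Let_def using * by blast
  then show "pure_tensor K M N m (a \<odot>\<^bsub>N\<^esub> n) = a \<odot>\<^bsub>tensor K M N\<^esub> pure_tensor K M N m n"
    unfolding pure_tensor_proj using * by (simp add: gen tensor_proj_smult proj_eq)
qed

lemma pure_tensor_closed:
  "\<lbrakk>m \<in> carrier M; n \<in> carrier N\<rbrakk> \<Longrightarrow> pure_tensor K M N m n \<in> carrier (tensor K M N)"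
  using bilinear_map_right[OF pure_tensor_bilinear] linear_map_closed by metis

text \<open>Composed with the quotient map, the two maps have an equalizer in the free space that
  contains every generator, hence everything.\<close>

lemma tensor_ext:
  assumes P: "module K P" and f: "f \<in> linear_maps K (tensor K M N) P"
    and g: "g \<in> linear_maps K (tensor K M N) P"
    and eq: "\<And>m n. \<lbrakk>m \<in> carrier M; n \<in> carrier N\<rbrakk> \<Longrightarrow>
      f (pure_tensor K M N m n) = g (pure_tensor K M N m n)"
    and x: "x \<in> carrier (tensor K M N)"
  shows "f x = g x"
proof -
  have "submodule {x \<in> carrier F. f (q x) = g (q x)} K F"
    using submodule_equalizer[OF F.module_axioms P linear_map_comp[OF q_linear f] linear_map_comp[OF q_linear g]] .
  then have "carrier F \<subseteq> {x \<in> carrier F. f (q x) = g (q x)}"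
    by (rule free_space_span[OF M.is_cring]) (auto simp: gen eq pure_tensor_proj[symmetric])
  moreover obtain h where "h \<in> carrier F" "x = q h" using x tensor_proj_image by blast
  ultimately show ?thesis by blast
qed

section \<open>Existence and uniqueness of the linear map determined by a bilinear map\<close>

context
  fixes P :: "('k, 'p) module" and B :: "'m \<Rightarrow> 'n \<Rightarrow> 'p"
  assumes P: "module K P" and B: "B \<in> bilinear_maps K M N P"
begin

interpretation P: module K P by (rule P)

private abbreviation "l \<equiv> free_lift K P (\<lambda>(m, n). B m n)"

private lemma B_closed: "\<lbrakk>m \<in> carrier M; n \<in> carrier N\<rbrakk> \<Longrightarrow> B m n \<in> carrier P"
  using linear_map_closed[OF bilinear_map_right[OF B]] .

private lemma l_linear: "l \<in> linear_maps K F P"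
  by (rule free_lift_linear[OF P]) (auto simp: B_closed)

private lemma l_gen: "\<lbrakk>m \<in> carrier M; n \<in> carrier N\<rbrakk> \<Longrightarrow> l (free_gen K (m, n)) = B m n"
  by (subst free_lift_gen[OF P, of "carrier M \<times> carrier N"]) (auto simp: B_closed)

text \<open>The relations form the least submodule that contains the relators, so it is enough that
  the kernel of \<open>l\<close> is a submodule and contains them; the latter is the bilinearity of
  \<open>B\<close>.\<close>

private lemma l_zero: "f \<in> R \<Longrightarrow> l f = \<zero>\<^bsub>P\<^esub>"
proof -
  have zero: "(\<lambda>f. \<zero>\<^bsub>P\<^esub>) \<in> linear_maps K F P" by (rule linear_mapsI) auto
  note l = linear_map_minus[OF F.module_axioms P l_linear] linear_map_add[OF l_linear]
    linear_map_smult[OF l_linear] l_gen gen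
  note B' = linear_map_add[OF bilinear_map_right[OF B]] linear_map_smult[OF bilinear_map_right[OF B]]
    linear_map_add[OF bilinear_map_left[OF B]] linear_map_smult[OF bilinear_map_left[OF B]] B_closed
  have "R \<subseteq> {f \<in> carrier F. l f = \<zero>\<^bsub>P\<^esub>}"
  proof (rule bilinear_relations_least)
    show "submodule {f \<in> carrier F. l f = \<zero>\<^bsub>P\<^esub>} K F"
      using submodule_equalizer[OF F.module_axioms P l_linear zero] .
    show "bilinear_relators K M N \<subseteq> {f \<in> carrier F. l f = \<zero>\<^bsub>P\<^esub>}"
      unfolding bilinear_relators_def Let_def
      by (intro Un_least subsetI; clarify; simp add: l B' P.r_neg a_minus_def[of P] F.minus_closed)
  qed
  then show "f \<in> R \<Longrightarrow> l f = \<zero>\<^bsub>P\<^esub>" by auto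
qed

private lemma l_cong:
  assumes "f \<in> carrier F" "g \<in> carrier F" "q f = q g"
  shows "l f = l g"
proof -
  have "l (f \<ominus>\<^bsub>F\<^esub> g) = \<zero>\<^bsub>P\<^esub>" using assms proj_eq_iff l_zero by blast
  then have "l f \<ominus>\<^bsub>P\<^esub> l g = \<zero>\<^bsub>P\<^esub>"
    using linear_map_minus[OF F.module_axioms P l_linear] assms by simp
  \<comment> \<open>\<open>minus_equality\<close> reads a vanishing difference as saying that
    \<open>l f\<close> is the negative of \<open>- l g\<close>.\<close>
  then have "\<ominus>\<^bsub>P\<^esub> (\<ominus>\<^bsub>P\<^esub> l g) = l f"
    using assms linear_map_closed[OF l_linear] by (intro P.minus_equality) (auto simp: a_minus_def)
  then show ?thesis using assms linear_map_closed[OF l_linear] by simp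
qed

text \<open>Any representative will do, by \<open>l_cong\<close>; the restriction meets the
  \<open>extensional\<close> clause of \<open>tensor_lift\<close>.\<close>

private definition "tlift = restrict (\<lambda>t. l (SOME f. f \<in> carrier F \<and> q f = t)) (carrier (tensor K M N))"

private lemma tlift_proj:
  assumes "f \<in> carrier F"
  shows "tlift (q f) = l f"
proof -
  let ?g = "SOME g. g \<in> carrier F \<and> q g = q f"
  have "?g \<in> carrier F \<and> q ?g = q f" by (rule someI[of _ f]) (use assms in simp)
  moreover have "tlift (q f) = l ?g"
    unfolding tlift_def using linear_map_closed[OF q_linear] assms by simp
  ultimately show ?thesis using l_cong[of ?g f] assms by simp
qed

private lemma tlift_linear: "tlift \<in> linear_maps K (tensor K M N) P"
proof (rule linear_mapsI)
  fix x assume "x \<in> carrier (tensor K M N)"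
  then obtain f where f: "f \<in> carrier F" "x = q f" using tensor_proj_image by blast
  show "tlift x \<in> carrier P" using f linear_map_closed[OF l_linear] by (simp add: tlift_proj)
  fix a assume "a \<in> carrier K"
  then show "tlift (a \<odot>\<^bsub>tensor K M N\<^esub> x) = a \<odot>\<^bsub>P\<^esub> tlift x"
    using f linear_map_smult[OF l_linear] by (simp add: tlift_proj tensor_proj_smult)
next
  fix x y assume "x \<in> carrier (tensor K M N)" "y \<in> carrier (tensor K M N)"
  then obtain f g where "f \<in> carrier F" "x = q f" "g \<in> carrier F" "y = q g"
    unfolding tensor_proj_image[symmetric] by (elim imageE)
  then show "tlift (x \<oplus>\<^bsub>tensor K M N\<^esub> y) = tlift x \<oplus>\<^bsub>P\<^esub> tlift y"
    using linear_map_add[OF l_linear] by (simp add: tlift_proj tensor_proj_add)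
qed

text \<open>Uniqueness has two halves: on the carrier it is \<open>tensor_ext\<close>, off the
  carrier it is extensionality.\<close>

private lemma tensor_lift_tlift: "tensor_lift K M N P B = tlift"
  unfolding tensor_lift_def
proof (rule the_equality)
  show "tlift \<in> linear_maps K (tensor K M N) P \<and> tlift \<in> extensional (carrier (tensor K M N)) \<and>
    (\<forall>m\<in>carrier M. \<forall>n\<in>carrier N. tlift (pure_tensor K M N m n) = B m n)"
    using tlift_linear by (auto simp: pure_tensor_proj tlift_proj gen l_gen) (simp add: tlift_def)
next
  fix g assume g: "g \<in> linear_maps K (tensor K M N) P \<and> g \<in> extensional (carrier (tensor K M N)) \<and>
    (\<forall>m\<in>carrier M. \<forall>n\<in>carrier N. g (pure_tensor K M N m n) = B m n)"
  show "g = tlift"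
  proof (rule extensionalityI)
    show "g \<in> extensional (carrier (tensor K M N))" using g by blast
    show "tlift \<in> extensional (carrier (tensor K M N))" by (simp add: tlift_def)
    fix x assume "x \<in> carrier (tensor K M N)"
    then show "g x = tlift x"
      by (rule tensor_ext[OF P _ tlift_linear, rotated 2])
        (use g in \<open>auto simp: pure_tensor_proj tlift_proj gen l_gen\<close>)
  qed
qed

lemma tensor_lift_linear: "tensor_lift K M N P B \<in> linear_maps K (tensor K M N) P"
  using tensor_lift_tlift tlift_linear by simp

lemma tensor_lift_pure:
  "\<lbrakk>m \<in> carrier M; n \<in> carrier N\<rbrakk> \<Longrightarrow> tensor_lift K M N P B (pure_tensor K M N m n) = B m n"
  unfolding tensor_lift_tlift by (simp add: pure_tensor_proj tlift_proj gen l_gen)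

end

end

text \<open>Lifting with a parameter. Linearity in \<open>p\<close> at a general tensor
  \<open>t\<close> follows from that at pure tensors, since both sides of each law are linear in
  \<open>t\<close>.\<close>

lemma tensor_lift_bilinear:
  assumes M: "module K M" and N: "module K N" and P: "module K P" and Q: "module K Q"
    and B: "\<And>p. p \<in> carrier P \<Longrightarrow> B p \<in> bilinear_maps K M N Q"
    and B': "\<And>m n. \<lbrakk>m \<in> carrier M; n \<in> carrier N\<rbrakk> \<Longrightarrow> (\<lambda>p. B p m n) \<in> linear_maps K P Q"
  shows "(\<lambda>t p. tensor_lift K M N Q (B p) t) \<in> bilinear_maps K (tensor K M N) P Q"
proof (rule bilinear_mapsI)
  interpret P: module K P by fact
  note lin = tensor_lift_linear[OF M N Q B] and pure = tensor_lift_pure[OF M N Q B]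
  note T = tensor_module[OF M N]
  fix t assume t: "t \<in> carrier (tensor K M N)"
  show "(\<lambda>p. tensor_lift K M N Q (B p) t) \<in> linear_maps K P Q"
  proof (rule linear_mapsI)
    fix p assume p: "p \<in> carrier P"
    show "tensor_lift K M N Q (B p) t \<in> carrier Q" using linear_map_closed[OF lin[OF p] t] .
    fix a assume a: "a \<in> carrier K"
    show "tensor_lift K M N Q (B (a \<odot>\<^bsub>P\<^esub> p)) t = a \<odot>\<^bsub>Q\<^esub> tensor_lift K M N Q (B p) t"
      by (rule tensor_ext[OF M N Q lin linear_map_scale[OF T Q lin a]])
        (use a p t in \<open>simp_all add: pure linear_map_smult[OF B']\<close>)
  next
    fix p p' assume p: "p \<in> carrier P" "p' \<in> carrier P"
    show "tensor_lift K M N Q (B (p \<oplus>\<^bsub>P\<^esub> p')) t = tensor_lift K M N Q (B p) t \<oplus>\<^bsub>Q\<^esub> tensor_lift K M N Q (B p') t"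
      by (rule tensor_ext[OF M N Q lin linear_map_sum[OF T Q lin lin]])
        (use p t in \<open>simp_all add: pure linear_map_add[OF B']\<close>)
  qed
qed (rule tensor_lift_linear[OF M N Q B])

text \<open>Two uses of \<open>tensor_ext\<close>: once \<open>p\<close> is fixed, tensoring with
  \<open>p\<close> is linear in the inner tensor.\<close>

lemma tensor_ext3:
  assumes M: "module K M" and N: "module K N" and P: "module K P" and Q: "module K Q"
    and f: "f \<in> linear_maps K (tensor K (tensor K M N) P) Q"
    and g: "g \<in> linear_maps K (tensor K (tensor K M N) P) Q"
    and eq: "\<And>m n p. \<lbrakk>m \<in> carrier M; n \<in> carrier N; p \<in> carrier P\<rbrakk> \<Longrightarrow>
      f (pure_tensor K (tensor K M N) P (pure_tensor K M N m n) p) =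
      g (pure_tensor K (tensor K M N) P (pure_tensor K M N m n) p)"
    and x: "x \<in> carrier (tensor K (tensor K M N) P)"
  shows "f x = g x"
proof (rule tensor_ext[OF tensor_module[OF M N] P Q f g _ x])
  fix t p assume t: "t \<in> carrier (tensor K M N)" and p: "p \<in> carrier P"
  note lin = linear_map_comp[OF bilinear_map_left[OF pure_tensor_bilinear[OF tensor_module[OF M N] P] p]]
  show "f (pure_tensor K (tensor K M N) P t p) = g (pure_tensor K (tensor K M N) P t p)"
    by (rule tensor_ext[OF M N Q lin[OF f] lin[OF g] _ t]) (simp add: eq p)
qed

lemma tensor_ext3':
  assumes M: "module K M" and N: "module K N" and P: "module K P" and Q: "module K Q"
    and f: "f \<in> linear_maps K (tensor K M (tensor K N P)) Q"
    and g: "g \<in> linear_maps K (tensor K M (tensor K N P)) Q"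
    and eq: "\<And>m n p. \<lbrakk>m \<in> carrier M; n \<in> carrier N; p \<in> carrier P\<rbrakk> \<Longrightarrow>
      f (pure_tensor K M (tensor K N P) m (pure_tensor K N P n p)) =
      g (pure_tensor K M (tensor K N P) m (pure_tensor K N P n p))"
    and x: "x \<in> carrier (tensor K M (tensor K N P))"
  shows "f x = g x"
proof (rule tensor_ext[OF M tensor_module[OF N P] Q f g _ x])
  fix m t assume t: "t \<in> carrier (tensor K N P)" and m: "m \<in> carrier M"
  note lin = linear_map_comp[OF bilinear_map_right[OF pure_tensor_bilinear[OF M tensor_module[OF N P]] m]]
  show "f (pure_tensor K M (tensor K N P) m t) = g (pure_tensor K M (tensor K N P) m t)"
    by (rule tensor_ext[OF N P Q lin[OF f] lin[OF g] _ t]) (simp add: eq m)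
qed

section \<open>Tensor products of maps\<close>

lemma tensor_map_bilinear:
  assumes "module K M'" "module K N'" "f \<in> linear_maps K M M'" "g \<in> linear_maps K N N'"
  shows "(\<lambda>m n. pure_tensor K M' N' (f m) (g n)) \<in> bilinear_maps K M N (tensor K M' N')"
  using bilinear_map_comp[OF pure_tensor_bilinear[OF assms(1,2)] assms(3,4) linear_map_id] by simp

lemma tensor_map_linear:
  assumes "module K M" "module K N" "module K M'" "module K N'"
    "f \<in> linear_maps K M M'" "g \<in> linear_maps K N N'"
  shows "tensor_map K M N M' N' f g \<in> linear_maps K (tensor K M N) (tensor K M' N')"
  unfolding tensor_map_def using assms
  by (intro tensor_lift_linear tensor_map_bilinear tensor_module)

lemma tensor_map_closed:
  assumes "module K M" "module K N" "module K M'" "module K N'"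
    "f \<in> linear_maps K M M'" "g \<in> linear_maps K N N'" "x \<in> carrier (tensor K M N)"
  shows "tensor_map K M N M' N' f g x \<in> carrier (tensor K M' N')"
  using linear_map_closed[OF tensor_map_linear[OF assms(1-6)] assms(7)] .

lemma tensor_map_pure:
  assumes "module K M" "module K N" "module K M'" "module K N'"
    "f \<in> linear_maps K M M'" "g \<in> linear_maps K N N'" "m \<in> carrier M" "n \<in> carrier N"
  shows "tensor_map K M N M' N' f g (pure_tensor K M N m n) = pure_tensor K M' N' (f m) (g n)"
  unfolding tensor_map_def using assms
  by (intro tensor_lift_pure tensor_map_bilinear tensor_module)

lemma tensor_map_comp:
  assumes "module K M" "module K N" "module K M'" "module K N'" "module K M''" "module K N''"
    "f \<in> linear_maps K M M'" "g \<in> linear_maps K N N'"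
    "f' \<in> linear_maps K M' M''" "g' \<in> linear_maps K N' N''" "x \<in> carrier (tensor K M N)"
  shows "tensor_map K M' N' M'' N'' f' g' (tensor_map K M N M' N' f g x) =
    tensor_map K M N M'' N'' (\<lambda>m. f' (f m)) (\<lambda>n. g' (g n)) x"
  by (rule tensor_ext[OF assms(1,2) tensor_module[OF assms(5,6)]
        linear_map_comp[OF tensor_map_linear tensor_map_linear] tensor_map_linear _ assms(11)])
    (use assms in \<open>simp_all add: tensor_map_pure linear_map_comp[of f K M M' f' M'']
       linear_map_comp[of g K N N' g' N''] linear_map_closed[of f K M M'] linear_map_closed[of g K N N']\<close>)

text \<open>Only values on the carriers count, whereas the arguments of \<open>tensor_map\<close>
  are total functions that may differ elsewhere.\<close>

lemma tensor_map_cong: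
  assumes "module K M" "module K N" "module K M'" "module K N'"
    "f \<in> linear_maps K M M'" "g \<in> linear_maps K N N'"
    "f' \<in> linear_maps K M M'" "g' \<in> linear_maps K N N'"
    "\<And>m. m \<in> carrier M \<Longrightarrow> f m = f' m" "\<And>n. n \<in> carrier N \<Longrightarrow> g n = g' n"
    "x \<in> carrier (tensor K M N)"
  shows "tensor_map K M N M' N' f g x = tensor_map K M N M' N' f' g' x"
  by (rule tensor_ext[OF assms(1,2) tensor_module[OF assms(3,4)] tensor_map_linear tensor_map_linear _ assms(11)])
    (use assms(1-10) in \<open>simp_all add: tensor_map_pure\<close>)

lemma tensor_map_ident:
  assumes "module K M" "module K N" "f \<in> linear_maps K M M" "g \<in> linear_maps K N N"
    "\<And>m. m \<in> carrier M \<Longrightarrow> f m = m" "\<And>n. n \<in> carrier N \<Longrightarrow> g n = n"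
    "x \<in> carrier (tensor K M N)"
  shows "tensor_map K M N M N f g x = x"
proof -
  \<comment> \<open>The right side is written with \<open>id\<close> so that it is visibly a linear
    map applied to \<open>x\<close>.\<close>
  have "tensor_map K M N M N f g x = id x"
    by (rule tensor_ext[OF assms(1,2) tensor_module[OF assms(1,2)] tensor_map_linear linear_map_id _ assms(7)])
      (use assms(1-6) in \<open>simp_all add: tensor_map_pure\<close>)
  then show ?thesis by simp
qed

text \<open>Needed to expand an idempotent of the form \<open>1 - s d\<close> after tensoring with
  an identity.\<close>

lemma tensor_map_sum:
  assumes "module K M" "module K N" "module K M'" "module K N'"
    "f \<in> linear_maps K M M'" "f' \<in> linear_maps K M M'" "g \<in> linear_maps K N N'"
    "x \<in> carrier (tensor K M N)"
  shows "tensor_map K M N M' N' (\<lambda>m. f m \<oplus>\<^bsub>M'\<^esub> f' m) g x =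
    tensor_map K M N M' N' f g x \<oplus>\<^bsub>tensor K M' N'\<^esub> tensor_map K M N M' N' f' g x"
proof (rule tensor_ext[OF assms(1,2) tensor_module[OF assms(3,4)]
      tensor_map_linear linear_map_sum[OF _ _ tensor_map_linear tensor_map_linear] _ assms(8)])
  fix m n assume "m \<in> carrier M" "n \<in> carrier N"
  then show "tensor_map K M N M' N' (\<lambda>m. f m \<oplus>\<^bsub>M'\<^esub> f' m) g (pure_tensor K M N m n) =
    tensor_map K M N M' N' f g (pure_tensor K M N m n) \<oplus>\<^bsub>tensor K M' N'\<^esub>
    tensor_map K M N M' N' f' g (pure_tensor K M N m n)"
    using assms
    by (simp add: tensor_map_pure linear_map_sum linear_map_closed[of f K M M'] linear_map_closed[of f' K M M']
      linear_map_closed[of g K N N'] linear_map_add[OF bilinear_map_left[OF pure_tensor_bilinear]])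
qed (use assms in \<open>simp_all add: linear_map_sum tensor_module\<close>)

text \<open>Functoriality with the composites replaced by any linear maps that agree with them on
  the carriers.\<close>

lemma tensor_map_comp_eq:
  assumes "module K M" "module K N" "module K M'" "module K N'" "module K M''" "module K N''"
    "f \<in> linear_maps K M M'" "g \<in> linear_maps K N N'"
    "f' \<in> linear_maps K M' M''" "g' \<in> linear_maps K N' N''"
    "f'' \<in> linear_maps K M M''" "g'' \<in> linear_maps K N N''"
    "\<And>m. m \<in> carrier M \<Longrightarrow> f' (f m) = f'' m" "\<And>n. n \<in> carrier N \<Longrightarrow> g' (g n) = g'' n"
    "x \<in> carrier (tensor K M N)"
  shows "tensor_map K M' N' M'' N'' f' g' (tensor_map K M N M' N' f g x) = tensor_map K M N M'' N'' f'' g'' x"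
proof -
  have "tensor_map K M N M'' N'' (\<lambda>m. f' (f m)) (\<lambda>n. g' (g n)) x = tensor_map K M N M'' N'' f'' g'' x"
    by (rule tensor_map_cong)
      (use assms linear_map_comp[of f K M M' f' M''] linear_map_comp[of g K N N' g' N''] in auto)
  then show ?thesis using tensor_map_comp[OF assms(1-10,15)] by simp
qed

text \<open>Tensoring two commuting squares gives a commuting square. Exchanges of maps that act on
  different legs are instances, with identities on the remaining sides.\<close>

lemma tensor_map_square:
  assumes mods: "module K M" "module K N" "module K M'" "module K N'" "module K M'' " "module K N''"
      "module K P" "module K Q"
    and lins: "f \<in> linear_maps K M M'" "g \<in> linear_maps K N N'"
    "f' \<in> linear_maps K M' P" "g' \<in> linear_maps K N' Q"
    "h \<in> linear_maps K M M''" "k \<in> linear_maps K N N''"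
    "h' \<in> linear_maps K M'' P" "k' \<in> linear_maps K N'' Q"
    and eq: "\<And>m. m \<in> carrier M \<Longrightarrow> f' (f m) = h' (h m)" "\<And>n. n \<in> carrier N \<Longrightarrow> g' (g n) = k' (k n)"
    and x: "x \<in> carrier (tensor K M N)"
  shows "tensor_map K M' N' P Q f' g' (tensor_map K M N M' N' f g x) =
    tensor_map K M'' N'' P Q h' k' (tensor_map K M N M'' N'' h k x)"
  unfolding tensor_map_comp[OF mods(1,2,5,6,7,8) lins(5-8) x]
  by (rule tensor_map_comp_eq[OF mods(1-4,7,8) lins(1-4)
      linear_map_comp[OF lins(5,7)] linear_map_comp[OF lins(6,8)] eq x])

lemma tensor_map_id:
  assumes "module K M" "module K N" "x \<in> carrier (tensor K M N)"
  shows "tensor_map K M N M N id id x = x"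
  by (rule tensor_map_ident) (use assms linear_map_id in auto)

section \<open>Associativity and units\<close>

lemma triple_pure_bilinear:
  assumes "module K M" "module K N" "module K P" "p \<in> carrier P"
  shows "(\<lambda>m n. pure_tensor K M (tensor K N P) m (pure_tensor K N P n p)) \<in>
    bilinear_maps K M N (tensor K M (tensor K N P))"
  using bilinear_map_comp[OF pure_tensor_bilinear[OF assms(1) tensor_module[OF assms(2,3)]]
      linear_map_id bilinear_map_left[OF pure_tensor_bilinear[OF assms(2,3)] assms(4)] linear_map_id]
  by simp

text \<open>The associator is a lift of a lift; the third factor is the parameter of the inner
  one.\<close>

lemma tensor_assoc_bilinear:
  assumes M: "module K M" and N: "module K N" and P: "module K P"
  shows "(\<lambda>t p. tensor_lift K M N (tensor K M (tensor K N P))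
          (\<lambda>m n. pure_tensor K M (tensor K N P) m (pure_tensor K N P n p)) t) \<in>
    bilinear_maps K (tensor K M N) P (tensor K M (tensor K N P))"
proof (rule tensor_lift_bilinear[OF M N P tensor_module[OF M tensor_module[OF N P]] triple_pure_bilinear[OF M N P]])
  fix m n assume "m \<in> carrier M" "n \<in> carrier N"
  then show "(\<lambda>p. pure_tensor K M (tensor K N P) m (pure_tensor K N P n p)) \<in>
    linear_maps K P (tensor K M (tensor K N P))"
    by (intro linear_map_comp[OF bilinear_map_right[OF pure_tensor_bilinear[OF N P]]
      bilinear_map_right[OF pure_tensor_bilinear[OF M tensor_module[OF N P]]]])
qed

lemma tensor_assoc_linear:
  assumes "module K M" "module K N" "module K P"
  shows "tensor_assoc K M N P \<in> linear_maps K (tensor K (tensor K M N) P) (tensor K M (tensor K N P))"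
  unfolding tensor_assoc_def using assms
  by (intro tensor_lift_linear tensor_module tensor_assoc_bilinear)

lemma tensor_assoc_closed:
  assumes "module K M" "module K N" "module K P" "x \<in> carrier (tensor K (tensor K M N) P)"
  shows "tensor_assoc K M N P x \<in> carrier (tensor K M (tensor K N P))"
  using linear_map_closed[OF tensor_assoc_linear[OF assms(1-3)] assms(4)] .

lemma tensor_assoc_pure:
  assumes "module K M" "module K N" "module K P" "m \<in> carrier M" "n \<in> carrier N" "p \<in> carrier P"
  shows "tensor_assoc K M N P (pure_tensor K (tensor K M N) P (pure_tensor K M N m n) p) =
    pure_tensor K M (tensor K N P) m (pure_tensor K N P n p)"
  unfolding tensor_assoc_def using assms
  by (simp add: tensor_lift_pure[OF tensor_module _ _ tensor_assoc_bilinear] tensor_module pure_tensor_closed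
    tensor_lift_pure[OF _ _ _ triple_pure_bilinear])

text \<open>The inverse associator, built by lifting in the other order. It carries
  \<open>id \<otimes> \<Delta>\<close> applied to an element into
  \<open>(V1 \<otimes> H \<alpha>) \<otimes> H \<beta>\<close>, where the equalizer argument takes
  place.\<close>

definition tensor_assoc_inv ::
    "'k ring \<Rightarrow> ('k, 'm) module \<Rightarrow> ('k, 'n) module \<Rightarrow> ('k, 'p) module \<Rightarrow>
     ('k, 'm, ('k, 'n, 'p) tensor) tensor \<Rightarrow> ('k, ('k, 'm, 'n) tensor, 'p) tensor" where
  "tensor_assoc_inv K M N P =
     tensor_lift K M (tensor K N P) (tensor K (tensor K M N) P)
       (\<lambda>m. tensor_lift K N P (tensor K (tensor K M N) P)
          (\<lambda>n. pure_tensor K (tensor K M N) P (pure_tensor K M N m n)))"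

lemma triple_pure_bilinear':
  assumes "module K M" "module K N" "module K P" "m \<in> carrier M"
  shows "(\<lambda>n. pure_tensor K (tensor K M N) P (pure_tensor K M N m n)) \<in>
    bilinear_maps K N P (tensor K (tensor K M N) P)"
  using bilinear_map_comp[OF pure_tensor_bilinear[OF tensor_module[OF assms(1,2)] assms(3)]
      bilinear_map_right[OF pure_tensor_bilinear[OF assms(1,2)] assms(4)] linear_map_id linear_map_id]
  by simp

text \<open>\<open>tensor_lift_bilinear\<close> has its parameter last, while the inverse associator
  has it first.\<close>

lemma bilinear_maps_swap: "B \<in> bilinear_maps K M N P \<Longrightarrow> (\<lambda>n m. B m n) \<in> bilinear_maps K N M P"
  unfolding bilinear_maps_def by auto

lemma tensor_assoc_inv_bilinear:
  assumes M: "module K M" and N: "module K N" and P: "module K P"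
  shows "(\<lambda>m. tensor_lift K N P (tensor K (tensor K M N) P)
          (\<lambda>n. pure_tensor K (tensor K M N) P (pure_tensor K M N m n))) \<in>
    bilinear_maps K M (tensor K N P) (tensor K (tensor K M N) P)"
proof (rule bilinear_maps_swap[OF tensor_lift_bilinear[OF N P M tensor_module[OF tensor_module[OF M N] P]
    triple_pure_bilinear'[OF M N P]]])
  fix n p assume "n \<in> carrier N" "p \<in> carrier P"
  then show "(\<lambda>m. pure_tensor K (tensor K M N) P (pure_tensor K M N m n) p) \<in>
    linear_maps K M (tensor K (tensor K M N) P)"
    by (intro linear_map_comp[OF bilinear_map_left[OF pure_tensor_bilinear[OF M N]]
      bilinear_map_left[OF pure_tensor_bilinear[OF tensor_module[OF M N] P]]])
qed

lemma tensor_assoc_inv_linear: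
  assumes "module K M" "module K N" "module K P"
  shows "tensor_assoc_inv K M N P \<in> linear_maps K (tensor K M (tensor K N P)) (tensor K (tensor K M N) P)"
  unfolding tensor_assoc_inv_def using assms
  by (intro tensor_lift_linear tensor_module tensor_assoc_inv_bilinear)

lemma tensor_assoc_inv_closed:
  assumes "module K M" "module K N" "module K P" "x \<in> carrier (tensor K M (tensor K N P))"
  shows "tensor_assoc_inv K M N P x \<in> carrier (tensor K (tensor K M N) P)"
  using linear_map_closed[OF tensor_assoc_inv_linear[OF assms(1-3)] assms(4)] .

lemma tensor_assoc_inv_pure:
  assumes "module K M" "module K N" "module K P" "m \<in> carrier M" "n \<in> carrier N" "p \<in> carrier P"
  shows "tensor_assoc_inv K M N P (pure_tensor K M (tensor K N P) m (pure_tensor K N P n p)) =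
    pure_tensor K (tensor K M N) P (pure_tensor K M N m n) p"
  unfolding tensor_assoc_inv_def using assms
  by (simp add: tensor_lift_pure[OF _ tensor_module _ tensor_assoc_inv_bilinear] tensor_module pure_tensor_closed
    tensor_lift_pure[OF _ _ _ triple_pure_bilinear'])

lemma tensor_assoc_assoc_inv:
  assumes M: "module K M" and N: "module K N" and P: "module K P"
    and x: "x \<in> carrier (tensor K M (tensor K N P))"
  shows "tensor_assoc K M N P (tensor_assoc_inv K M N P x) = x"
proof -
  have "tensor_assoc K M N P (tensor_assoc_inv K M N P x) = id x"
    by (rule tensor_ext3'[OF M N P tensor_module[OF M tensor_module[OF N P]]
      linear_map_comp[OF tensor_assoc_inv_linear tensor_assoc_linear] linear_map_id _ x])
      (simp_all add: assms tensor_assoc_inv_pure tensor_assoc_pure)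
  then show ?thesis by simp
qed

lemma tensor_assoc_inv_assoc:
  assumes M: "module K M" and N: "module K N" and P: "module K P"
    and x: "x \<in> carrier (tensor K (tensor K M N) P)"
  shows "tensor_assoc_inv K M N P (tensor_assoc K M N P x) = x"
proof -
  have "tensor_assoc_inv K M N P (tensor_assoc K M N P x) = id x"
    by (rule tensor_ext3[OF M N P tensor_module[OF tensor_module[OF M N] P]
      linear_map_comp[OF tensor_assoc_linear tensor_assoc_inv_linear] linear_map_id _ x])
      (simp_all add: assms tensor_assoc_inv_pure tensor_assoc_pure)
  then show ?thesis by simp
qed

text \<open>This moves a map that acts on a single leg through a rebracketing. An identity on a
  tensor product must first be presented as \<open>id \<otimes> id\<close> to fit its shape.\<close>

lemma tensor_assoc_natural:
  assumes M: "module K M" "module K M'" and N: "module K N" "module K N'"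
    and P: "module K P" "module K P'"
    and f: "f \<in> linear_maps K M M'" and g: "g \<in> linear_maps K N N'" and h: "h \<in> linear_maps K P P'"
    and x: "x \<in> carrier (tensor K (tensor K M N) P)"
  shows "tensor_assoc K M' N' P'
      (tensor_map K (tensor K M N) P (tensor K M' N') P' (tensor_map K M N M' N' f g) h x) =
    tensor_map K M (tensor K N P) M' (tensor K N' P') f (tensor_map K N P N' P' g h)
      (tensor_assoc K M N P x)"
proof -
  note mods = M N P tensor_module
  show ?thesis
    by (rule tensor_ext3[OF M(1) N(1) P(1) tensor_module[OF M(2) tensor_module[OF N(2) P(2)]]
      linear_map_comp[OF tensor_map_linear tensor_assoc_linear]
      linear_map_comp[OF tensor_assoc_linear tensor_map_linear] _ x])
      (simp_all add: mods f g h tensor_map_linear tensor_map_pure tensor_assoc_pure pure_tensor_closed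
        linear_map_closed[OF f] linear_map_closed[OF g] linear_map_closed[OF h])
qed

text \<open>It trades two outer rebracketings for a chain of three in which one takes place inside
  the first leg and one inside the second. Both directions are used: one for the existence of the
  induced coaction, the other for its coassociativity.\<close>

lemma tensor_assoc_pentagon:
  assumes M: "module K M" and N: "module K N" and P: "module K P" and Q: "module K Q"
    and x: "x \<in> carrier (tensor K (tensor K (tensor K M N) P) Q)"
  shows "tensor_assoc K M N (tensor K P Q) (tensor_assoc K (tensor K M N) P Q x) =
    tensor_map K M (tensor K (tensor K N P) Q) M (tensor K N (tensor K P Q)) id (tensor_assoc K N P Q)
      (tensor_assoc K M (tensor K N P) Q
        (tensor_map K (tensor K (tensor K M N) P) Q (tensor K M (tensor K N P)) Q (tensor_assoc K M N P) id x))"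
    (is "?l x = ?r x")
proof -
  note mods = M N P Q tensor_module
  let ?T = "tensor K M (tensor K N (tensor K P Q))"
  have l: "?l \<in> linear_maps K (tensor K (tensor K (tensor K M N) P) Q) ?T"
    by (rule linear_map_comp[OF tensor_assoc_linear tensor_assoc_linear]) (simp_all add: mods)
  have r: "?r \<in> linear_maps K (tensor K (tensor K (tensor K M N) P) Q) ?T"
    by (rule linear_map_comp[OF tensor_map_linear
        linear_map_comp[OF tensor_assoc_linear tensor_map_linear]])
      (simp_all add: mods linear_map_id linear_map_ident tensor_assoc_linear)
  show ?thesis
  \<comment> \<open>The fourfold product is reduced in two stages: \<open>q\<close> is split off,
    then the triple product is handled by \<open>tensor_ext3\<close>.\<close>
  proof (rule tensor_ext[OF tensor_module[OF tensor_module[OF M N] P] Q _ l r _ x])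
    show "module K ?T" by (simp add: mods)
    fix t q assume t: "t \<in> carrier (tensor K (tensor K M N) P)" and q: "q \<in> carrier Q"
    note lin = linear_map_comp[OF bilinear_map_left[OF pure_tensor_bilinear[OF
      tensor_module[OF tensor_module[OF M N] P] Q] q]]
    show "?l (pure_tensor K (tensor K (tensor K M N) P) Q t q) =
        ?r (pure_tensor K (tensor K (tensor K M N) P) Q t q)"
      by (rule tensor_ext3[OF M N P _ lin[OF l] lin[OF r] _ t])
        (simp_all add: mods q linear_map_id linear_map_ident tensor_assoc_linear tensor_map_pure tensor_assoc_pure
          pure_tensor_closed)
  qed
qed

section \<open>The ground field as right unit of the tensor product\<close>

lemma base_space_module:
  assumes "cring K" shows "module K (base_space K)"
proof -
  interpret K: cring K by fact
  have "abelian_group (base_space K)"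
    by (rule abelian_groupI) (auto simp: base_space_def K.a_ac intro: K.l_neg)
  then show ?thesis
    by (rule moduleI[OF assms]) (auto simp: base_space_def K.l_distr K.r_distr K.m_assoc)
qed

lemma runit_bilinear:
  assumes M: "module K M"
  shows "(\<lambda>m a. a \<odot>\<^bsub>M\<^esub> m) \<in> bilinear_maps K M (base_space K) M"
proof -
  interpret M: module K M by fact
  show ?thesis
    by (rule bilinear_mapsI; rule linear_mapsI)
      (simp_all add: base_space_def M.smult_l_distr M.smult_r_distr M.smult_assoc1[symmetric] M.R.m_comm)
qed

lemma tensor_runit_linear:
  assumes "module K M"
  shows "tensor_runit K M \<in> linear_maps K (tensor K M (base_space K)) M"
  unfolding tensor_runit_def
  using assms base_space_module[OF module.axioms(1)[OF assms]]
  by (intro tensor_lift_linear runit_bilinear)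

lemma tensor_runit_pure:
  assumes "module K M" "m \<in> carrier M" "a \<in> carrier K"
  shows "tensor_runit K M (pure_tensor K M (base_space K) m a) = a \<odot>\<^bsub>M\<^esub> m"
  unfolding tensor_runit_def
  using assms(2,3)
  by (intro tensor_lift_pure[OF assms(1) base_space_module[OF module.axioms(1)[OF assms(1)]] assms(1)
    runit_bilinear[OF assms(1)]]) (simp_all add: base_space_def)

lemma tensor_runit_natural:
  assumes M: "module K M" and N: "module K N" and f: "f \<in> linear_maps K M N"
    and x: "x \<in> carrier (tensor K M (base_space K))"
  shows "f (tensor_runit K M x) = tensor_runit K N (tensor_map K M (base_space K) N (base_space K) f id x)"
proof -
  note B = base_space_module[OF module.axioms(1)[OF M]]
  have carrier: "a \<in> carrier (base_space K) \<longleftrightarrow> a \<in> carrier K" for a by (simp add: base_space_def)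
  show ?thesis
    by (rule tensor_ext[OF M B N linear_map_comp[OF tensor_runit_linear f]
      linear_map_comp[OF tensor_map_linear tensor_runit_linear] _ x])
      (simp_all add: assms B linear_map_id tensor_map_pure tensor_runit_pure
         linear_map_closed[OF f] linear_map_smult[OF f] carrier)
qed

text \<open>A unit triangle: removing the trailing scalar commutes with rebracketing. The counit law
  for \<open>Ind\<close> is thereby reduced to that for \<open>H\<close>.\<close>

lemma tensor_runit_assoc:
  assumes M: "module K M" and N: "module K N"
    and x: "x \<in> carrier (tensor K (tensor K M N) (base_space K))"
  shows "tensor_runit K (tensor K M N) x =
    tensor_map K M (tensor K N (base_space K)) M N id (tensor_runit K N) (tensor_assoc K M N (base_space K) x)"
proof -
  note B = base_space_module[OF module.axioms(1)[OF M]]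
  have carrier: "a \<in> carrier (base_space K) \<longleftrightarrow> a \<in> carrier K" for a by (simp add: base_space_def)
  show ?thesis
    by (rule tensor_ext3[OF M N B tensor_module[OF M N] tensor_runit_linear
       linear_map_comp[OF tensor_assoc_linear tensor_map_linear] _ x])
     (simp_all add: assms B tensor_module linear_map_id tensor_map_pure tensor_assoc_pure tensor_runit_pure
        tensor_runit_linear pure_tensor_closed carrier linear_map_smult[OF bilinear_map_right[OF pure_tensor_bilinear]])
qed

section \<open>Splitting of subspaces\<close>

text \<open>Zorn's lemma for the subspaces that meet \<open>U\<close> trivially; a maximal one is a
  complement, as any vector can be adjoined to it.\<close>

lemma subspace_complement:
  assumes K: "field K" and M: "module K M" and U: "submodule U K M"
  obtains W where "submodule W K M" "U \<inter> W \<subseteq> {\<zero>\<^bsub>M\<^esub>}"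
    "\<And>x. x \<in> carrier M \<Longrightarrow> \<exists>u\<in>U. \<exists>w\<in>W. x = u \<oplus>\<^bsub>M\<^esub> w"
proof -
  interpret K: field K by fact
  interpret M: module K M by fact
  let ?A = "{W. submodule W K M \<and> U \<inter> W \<subseteq> {\<zero>\<^bsub>M\<^esub>}}"
  have zero: "\<zero>\<^bsub>M\<^esub> \<in> W" if "submodule W K M" for W
    using subgroup.one_closed[OF submodule.axioms(1)[OF that]] by simp
  have "\<exists>W\<in>?A. \<forall>X\<in>?A. W \<subseteq> X \<longrightarrow> X = W"
  proof (rule subset_Zorn_nonempty)
    have "submodule {\<zero>\<^bsub>M\<^esub>} K M" by (rule M.submoduleI) auto
    then show "?A \<noteq> {}" by blast
  next
    fix \<C> assume ne: "\<C> \<noteq> {}" and ch: "subset.chain ?A \<C>"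
    have sub: "submodule W K M" "U \<inter> W \<subseteq> {\<zero>\<^bsub>M\<^esub>}" if "W \<in> \<C>" for W
      using ch that by (auto simp: subset_chain_def)
    \<comment> \<open>Closure of the union under addition needs both summands in one member, which
      comparability in the chain provides.\<close>
    have common: "\<exists>W\<in>\<C>. a \<in> W \<and> b \<in> W" if ab: "a \<in> \<Union>\<C>" "b \<in> \<Union>\<C>" for a b
    proof -
      obtain X Y where XY: "X \<in> \<C>" "Y \<in> \<C>" "a \<in> X" "b \<in> Y" using ab by blast
      then have "X \<subseteq> Y \<or> Y \<subseteq> X" using ch unfolding subset_chain_def by blast
      then show ?thesis using XY by blast
    qed
    have "submodule (\<Union>\<C>) K M"
    proof (rule M.submoduleI)
      show "\<Union>\<C> \<subseteq> carrier M" using M.submoduleE(1)[OF sub(1)] by blast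
      show "\<zero>\<^bsub>M\<^esub> \<in> \<Union>\<C>" using ne zero[OF sub(1)] by blast
    next
      fix a assume "a \<in> \<Union>\<C>"
      then obtain X where X: "X \<in> \<C>" "a \<in> X" by blast
      then show "\<ominus>\<^bsub>M\<^esub> a \<in> \<Union>\<C>" using M.submoduleE(3)[OF sub(1)[OF X(1)] X(2)] by blast
      fix c assume "c \<in> carrier K"
      then show "c \<odot>\<^bsub>M\<^esub> a \<in> \<Union>\<C>" using X M.submoduleE(4)[OF sub(1)[OF X(1)] _ X(2)] by blast
    next
      fix a b assume "a \<in> \<Union>\<C>" "b \<in> \<Union>\<C>"
      then obtain X where X: "X \<in> \<C>" "a \<in> X" "b \<in> X" using common by blast
      then show "a \<oplus>\<^bsub>M\<^esub> b \<in> \<Union>\<C>" using M.submoduleE(5)[OF sub(1)[OF X(1)] X(2,3)] by blast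
    qed
    moreover have "U \<inter> \<Union>\<C> \<subseteq> {\<zero>\<^bsub>M\<^esub>}" using sub(2) by blast
    ultimately show "\<Union>\<C> \<in> ?A" by simp
  qed
  then obtain W where "W \<in> ?A" and max: "\<forall>X\<in>?A. W \<subseteq> X \<longrightarrow> X = W" by (elim bexE)
  then have W: "submodule W K M" and UW: "U \<inter> W \<subseteq> {\<zero>\<^bsub>M\<^esub>}" by simp_all
  note Wc = subsetD[OF M.submoduleE(1)[OF W]] and Uc = subsetD[OF M.submoduleE(1)[OF U]]
  have "\<exists>u\<in>U. \<exists>w\<in>W. t = u \<oplus>\<^bsub>M\<^esub> w" if t: "t \<in> carrier M" for t
  proof -
    \<comment> \<open>The span of \<open>W\<close> and \<open>t\<close>.\<close>
    let ?X = "{w \<oplus>\<^bsub>M\<^esub> a \<odot>\<^bsub>M\<^esub> t | w a. w \<in> W \<and> a \<in> carrier K}"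
    have X: "submodule ?X K M"
    proof (rule M.submoduleI)
      show "?X \<subseteq> carrier M" using Wc t by auto
      have "\<zero>\<^bsub>M\<^esub> = \<zero>\<^bsub>M\<^esub> \<oplus>\<^bsub>M\<^esub> \<zero>\<^bsub>K\<^esub> \<odot>\<^bsub>M\<^esub> t" using t by simp
      then show "\<zero>\<^bsub>M\<^esub> \<in> ?X" using zero[OF W] K.zero_closed by blast
    next
      fix x assume "x \<in> ?X"
      then obtain w a where wa: "w \<in> W" "a \<in> carrier K" "x = w \<oplus>\<^bsub>M\<^esub> a \<odot>\<^bsub>M\<^esub> t" by blast
      have "\<ominus>\<^bsub>M\<^esub> x = \<ominus>\<^bsub>M\<^esub> w \<oplus>\<^bsub>M\<^esub> (\<ominus>\<^bsub>K\<^esub> a) \<odot>\<^bsub>M\<^esub> t"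
        using wa t Wc by (simp add: M.minus_add M.smult_l_minus)
      then show "\<ominus>\<^bsub>M\<^esub> x \<in> ?X" using M.submoduleE(3)[OF W wa(1)] K.add.inv_closed[OF wa(2)] by blast
      fix c assume c: "c \<in> carrier K"
      have "c \<odot>\<^bsub>M\<^esub> x = c \<odot>\<^bsub>M\<^esub> w \<oplus>\<^bsub>M\<^esub> (c \<otimes>\<^bsub>K\<^esub> a) \<odot>\<^bsub>M\<^esub> t"
        using wa t Wc c by (simp add: M.smult_r_distr M.smult_assoc1)
      then show "c \<odot>\<^bsub>M\<^esub> x \<in> ?X" using M.submoduleE(4)[OF W c wa(1)] K.m_closed[OF c wa(2)] by blast
    next
      fix x y assume "x \<in> ?X" "y \<in> ?X"
      then obtain w a w' a' where wa: "w \<in> W" "a \<in> carrier K" "x = w \<oplus>\<^bsub>M\<^esub> a \<odot>\<^bsub>M\<^esub> t"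
        "w' \<in> W" "a' \<in> carrier K" "y = w' \<oplus>\<^bsub>M\<^esub> a' \<odot>\<^bsub>M\<^esub> t" by blast
      have "x \<oplus>\<^bsub>M\<^esub> y = (w \<oplus>\<^bsub>M\<^esub> w') \<oplus>\<^bsub>M\<^esub> (a \<oplus>\<^bsub>K\<^esub> a') \<odot>\<^bsub>M\<^esub> t"
        using wa t Wc by (simp add: M.smult_l_distr M.a_ac)
      then show "x \<oplus>\<^bsub>M\<^esub> y \<in> ?X"
        using M.submoduleE(5)[OF W wa(1,4)] K.a_closed[OF wa(2,5)] by blast
    qed
    have WX: "w \<in> ?X" if "w \<in> W" for w
    proof -
      have "w = w \<oplus>\<^bsub>M\<^esub> \<zero>\<^bsub>K\<^esub> \<odot>\<^bsub>M\<^esub> t" using t Wc[OF that] by simp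
      then show ?thesis using that K.zero_closed by blast
    qed
    show ?thesis
    \<comment> \<open>If the larger space still meets \<open>U\<close> trivially, maximality puts
      \<open>t\<close> into \<open>W\<close>. Otherwise a nonzero \<open>u = w + a t\<close> in
      \<open>U\<close> can be solved for \<open>t\<close>, and this is where scalars must be
      invertible.\<close>
    proof (cases "U \<inter> ?X \<subseteq> {\<zero>\<^bsub>M\<^esub>}")
      case True
      then have "?X = W" using max X WX by (metis (no_types, lifting) mem_Collect_eq subsetI)
      moreover have "t = \<zero>\<^bsub>M\<^esub> \<oplus>\<^bsub>M\<^esub> \<one>\<^bsub>K\<^esub> \<odot>\<^bsub>M\<^esub> t" using t by simp
      then have "t \<in> ?X" using zero[OF W] K.one_closed by blast
      ultimately have "t \<in> W" by simp
      then show ?thesis using zero[OF U] M.l_zero[OF t] by metis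
    next
      case False
      then obtain u w a where u: "u \<in> U" "u \<noteq> \<zero>\<^bsub>M\<^esub>" "w \<in> W" "a \<in> carrier K" "u = w \<oplus>\<^bsub>M\<^esub> a \<odot>\<^bsub>M\<^esub> t"
        by blast
      \<comment> \<open>With \<open>a\<close> zero, the nonzero vector \<open>u\<close> would lie in
        both \<open>U\<close> and \<open>W\<close>.\<close>
      have a: "a \<noteq> \<zero>\<^bsub>K\<^esub>"
      proof
        assume "a = \<zero>\<^bsub>K\<^esub>"
        then have "u = w" using u t Wc by simp
        then show False using u UW by blast
      qed
      then have ia: "inv\<^bsub>K\<^esub> a \<in> carrier K" "inv\<^bsub>K\<^esub> a \<otimes>\<^bsub>K\<^esub> a = \<one>\<^bsub>K\<^esub>"
        using u(4) K.field_Units by auto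
      have "inv\<^bsub>K\<^esub> a \<odot>\<^bsub>M\<^esub> u \<oplus>\<^bsub>M\<^esub> \<ominus>\<^bsub>M\<^esub> (inv\<^bsub>K\<^esub> a \<odot>\<^bsub>M\<^esub> w) =
          (inv\<^bsub>K\<^esub> a \<odot>\<^bsub>M\<^esub> (a \<odot>\<^bsub>M\<^esub> t) \<oplus>\<^bsub>M\<^esub> inv\<^bsub>K\<^esub> a \<odot>\<^bsub>M\<^esub> w) \<oplus>\<^bsub>M\<^esub> \<ominus>\<^bsub>M\<^esub> (inv\<^bsub>K\<^esub> a \<odot>\<^bsub>M\<^esub> w)"
        using u(3-5) ia t Wc by (simp add: M.smult_r_distr M.a_comm)
      also have "\<dots> = inv\<^bsub>K\<^esub> a \<odot>\<^bsub>M\<^esub> (a \<odot>\<^bsub>M\<^esub> t)"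
        using u(3,4) ia t Wc by (simp add: M.a_assoc M.r_neg)
      also have "\<dots> = t" using u(4) ia t by (simp add: M.smult_assoc1[symmetric])
      finally have "t = inv\<^bsub>K\<^esub> a \<odot>\<^bsub>M\<^esub> u \<oplus>\<^bsub>M\<^esub> \<ominus>\<^bsub>M\<^esub> (inv\<^bsub>K\<^esub> a \<odot>\<^bsub>M\<^esub> w)" by simp
      moreover have "inv\<^bsub>K\<^esub> a \<odot>\<^bsub>M\<^esub> u \<in> U" using M.submoduleE(4)[OF U ia(1) u(1)] .
      moreover have "\<ominus>\<^bsub>M\<^esub> (inv\<^bsub>K\<^esub> a \<odot>\<^bsub>M\<^esub> w) \<in> W"
        using M.submoduleE(3)[OF W M.submoduleE(4)[OF W ia(1) u(3)]] .
      ultimately show ?thesis by blast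
    qed
  qed
  then show thesis using that W UW by blast
qed

text \<open>Projection along a complement. Its codomain is recorded as the restricted space, so that
  it can be tensored as a map into the subspace.\<close>

lemma subspace_retraction:
  assumes K: "field K" and M: "module K M" and U: "submodule U K M"
  obtains e where "e \<in> linear_maps K M (M\<lparr>carrier := U\<rparr>)" "\<And>u. u \<in> U \<Longrightarrow> e u = u"
proof -
  interpret M: module K M by fact
  obtain W where W: "submodule W K M" and UW: "U \<inter> W \<subseteq> {\<zero>\<^bsub>M\<^esub>}"
    and ex: "\<And>x. x \<in> carrier M \<Longrightarrow> \<exists>u\<in>U. \<exists>w\<in>W. x = u \<oplus>\<^bsub>M\<^esub> w"
    using subspace_complement[OF K M U] by blast
  note Wc = subsetD[OF M.submoduleE(1)[OF W]] and Uc = subsetD[OF M.submoduleE(1)[OF U]]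
  note Us = M.submoduleE(3-5)[OF U] and Ws = M.submoduleE(3-5)[OF W]
  have uniq: "u = u'" if "u \<in> U" "w \<in> W" "u' \<in> U" "w' \<in> W" "u \<oplus>\<^bsub>M\<^esub> w = u' \<oplus>\<^bsub>M\<^esub> w'" for u w u' w'
  proof -
    have c: "u \<in> carrier M" "u' \<in> carrier M" "w \<in> carrier M" "w' \<in> carrier M"
      using that Uc Wc by auto
    have "\<ominus>\<^bsub>M\<^esub> u' \<oplus>\<^bsub>M\<^esub> (u \<oplus>\<^bsub>M\<^esub> w) \<oplus>\<^bsub>M\<^esub> \<ominus>\<^bsub>M\<^esub> w = \<ominus>\<^bsub>M\<^esub> u' \<oplus>\<^bsub>M\<^esub> (u' \<oplus>\<^bsub>M\<^esub> w') \<oplus>\<^bsub>M\<^esub> \<ominus>\<^bsub>M\<^esub> w"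
      using that(5) by simp
    then have "\<ominus>\<^bsub>M\<^esub> u' \<oplus>\<^bsub>M\<^esub> u = w' \<oplus>\<^bsub>M\<^esub> \<ominus>\<^bsub>M\<^esub> w"
      using c by (simp add: M.a_assoc M.r_neg M.r_neg1)
    moreover have "\<ominus>\<^bsub>M\<^esub> u' \<oplus>\<^bsub>M\<^esub> u \<in> U" "w' \<oplus>\<^bsub>M\<^esub> \<ominus>\<^bsub>M\<^esub> w \<in> W" using that Us Ws by auto
    ultimately have "\<ominus>\<^bsub>M\<^esub> u' \<oplus>\<^bsub>M\<^esub> u = \<zero>\<^bsub>M\<^esub>" using UW by auto
    then have "\<ominus>\<^bsub>M\<^esub> u = \<ominus>\<^bsub>M\<^esub> u'" using c M.minus_equality by blast
    then show ?thesis using c M.minus_minus by metis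
  qed
  \<comment> \<open>The component in \<open>U\<close> is chosen, but \<open>uniq\<close> makes it
    the only one; linearity follows by adding and scaling decompositions.\<close>
  define e where "e x = (SOME u. u \<in> U \<and> (\<exists>w\<in>W. x = u \<oplus>\<^bsub>M\<^esub> w))" for x
  have e: "e x \<in> U \<and> (\<exists>w\<in>W. x = e x \<oplus>\<^bsub>M\<^esub> w)" if "x \<in> carrier M" for x
    unfolding e_def by (rule someI_ex) (use ex[OF that] in blast)
  have e_eq: "e (u \<oplus>\<^bsub>M\<^esub> w) = u" if "u \<in> U" "w \<in> W" for u w
    using e[of "u \<oplus>\<^bsub>M\<^esub> w"] uniq that Uc Wc M.a_closed by metis
  have "e \<in> linear_maps K M (M\<lparr>carrier := U\<rparr>)"
  proof (rule linear_mapsI)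
    fix x assume x: "x \<in> carrier M"
    show "e x \<in> carrier (M\<lparr>carrier := U\<rparr>)" using e[OF x] by simp
    fix a assume a: "a \<in> carrier K"
    obtain w where w: "w \<in> W" "x = e x \<oplus>\<^bsub>M\<^esub> w" using e[OF x] by blast
    have "a \<odot>\<^bsub>M\<^esub> (e x \<oplus>\<^bsub>M\<^esub> w) = a \<odot>\<^bsub>M\<^esub> e x \<oplus>\<^bsub>M\<^esub> a \<odot>\<^bsub>M\<^esub> w"
      using a w Wc Uc e[OF x] by (intro M.smult_r_distr) auto
    then have "e (a \<odot>\<^bsub>M\<^esub> x) = e (a \<odot>\<^bsub>M\<^esub> e x \<oplus>\<^bsub>M\<^esub> a \<odot>\<^bsub>M\<^esub> w)" using w(2) by simp
    also have "\<dots> = a \<odot>\<^bsub>M\<^esub> e x" by (rule e_eq) (use a w e[OF x] Us Ws in auto)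
    finally show "e (a \<odot>\<^bsub>M\<^esub> x) = a \<odot>\<^bsub>M\<lparr>carrier := U\<rparr>\<^esub> e x" by simp
  next
    fix x y assume x: "x \<in> carrier M" and y: "y \<in> carrier M"
    obtain w where w: "w \<in> W" "x = e x \<oplus>\<^bsub>M\<^esub> w" using e[OF x] by blast
    obtain z where z: "z \<in> W" "y = e y \<oplus>\<^bsub>M\<^esub> z" using e[OF y] by blast
    have "(e x \<oplus>\<^bsub>M\<^esub> w) \<oplus>\<^bsub>M\<^esub> (e y \<oplus>\<^bsub>M\<^esub> z) = (e x \<oplus>\<^bsub>M\<^esub> e y) \<oplus>\<^bsub>M\<^esub> (w \<oplus>\<^bsub>M\<^esub> z)"
      using w(1) z(1) Wc Uc e[OF x] e[OF y] by (simp add: M.a_ac)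
    then have "e (x \<oplus>\<^bsub>M\<^esub> y) = e ((e x \<oplus>\<^bsub>M\<^esub> e y) \<oplus>\<^bsub>M\<^esub> (w \<oplus>\<^bsub>M\<^esub> z))"
      using w(2) z(2) by simp
    also have "\<dots> = e x \<oplus>\<^bsub>M\<^esub> e y" by (rule e_eq) (use w z e[OF x] e[OF y] Us Ws in auto)
    finally show "e (x \<oplus>\<^bsub>M\<^esub> y) = e x \<oplus>\<^bsub>M\<lparr>carrier := U\<rparr>\<^esub> e y" by simp
  qed
  moreover have "e u = u" if "u \<in> U" for u
  proof -
    have "\<zero>\<^bsub>M\<^esub> \<in> W" using subgroup.one_closed[OF submodule.axioms(1)[OF W]] by simp
    then show ?thesis using e_eq[OF that, of "\<zero>\<^bsub>M\<^esub>"] Uc[OF that] by simp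
  qed
  ultimately show thesis using that by blast
qed

text \<open>Retract \<open>N\<close> onto the image of \<open>d\<close>, take any preimage, and
  correct it by a projection that kills the kernel of \<open>d\<close>. The correction makes the
  result independent of the preimage, hence linear.\<close>

lemma linear_pseudo_inverse:
  assumes K: "field K" and M: "module K M" and N: "module K N" and d: "d \<in> linear_maps K M N"
  obtains s where "s \<in> linear_maps K N M" "\<And>x. x \<in> carrier M \<Longrightarrow> d (s (d x)) = d x"
proof -
  interpret M: module K M by fact
  interpret N: module K N by fact
  note dc = linear_map_closed[OF d] and d_add = linear_map_add[OF d] and d_smult = linear_map_smult[OF d]
  have D: "submodule (d ` carrier M) K N"
  proof (rule N.submoduleI)
    show "d ` carrier M \<subseteq> carrier N" using dc by auto
    show "\<zero>\<^bsub>N\<^esub> \<in> d ` carrier M" using linear_map_zero[OF M N d] by (metis M.zero_closed imageI)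
  next
    fix y assume "y \<in> d ` carrier M"
    then obtain x where x: "x \<in> carrier M" "y = d x" by (elim imageE)
    show "\<ominus>\<^bsub>N\<^esub> y \<in> d ` carrier M"
      unfolding x(2) linear_map_a_inv[OF M N d x(1), symmetric] using x(1) by (intro imageI) simp
    fix a assume "a \<in> carrier K"
    then show "a \<odot>\<^bsub>N\<^esub> y \<in> d ` carrier M"
      unfolding x(2) using x(1) by (subst d_smult[symmetric]) (simp_all add: imageI)
  next
    fix y y' assume "y \<in> d ` carrier M" "y' \<in> d ` carrier M"
    then obtain x x' where x: "x \<in> carrier M" "y = d x" "x' \<in> carrier M" "y' = d x'" by (elim imageE)
    then show "y \<oplus>\<^bsub>N\<^esub> y' \<in> d ` carrier M"
      unfolding x(2,4) by (subst d_add[symmetric]) (simp_all add: imageI)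
  qed
  obtain p where p: "p \<in> linear_maps K N (N\<lparr>carrier := d ` carrier M\<rparr>)"
    and p_id: "\<And>y. y \<in> d ` carrier M \<Longrightarrow> p y = y"
    using subspace_retraction[OF K N D] by blast
  let ?Z = "{x \<in> carrier M. d x = \<zero>\<^bsub>N\<^esub>}"
  have zero: "(\<lambda>f. \<zero>\<^bsub>N\<^esub>) \<in> linear_maps K M N" by (rule linear_mapsI) simp_all
  have Z: "submodule ?Z K M" using submodule_equalizer[OF M N d zero] .
  obtain e where e': "e \<in> linear_maps K M (M\<lparr>carrier := ?Z\<rparr>)" and e_id: "\<And>x. x \<in> ?Z \<Longrightarrow> e x = x"
    using subspace_retraction[OF K M Z] by blast
  have e: "e \<in> linear_maps K M M" by (rule linear_map_inclusion[OF e']) simp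
  have de: "d (e x) = \<zero>\<^bsub>N\<^esub>" if "x \<in> carrier M" for x using linear_map_closed[OF e' that] by simp
  \<comment> \<open>\<open>e\<close> projects onto the kernel of \<open>d\<close>, so
    \<open>h\<close> vanishes on that kernel while \<open>d h = d\<close>.\<close>
  define h where "h x = x \<ominus>\<^bsub>M\<^esub> e x" for x
  have h: "h \<in> linear_maps K M M" unfolding h_def
    by (rule linear_map_diff[OF M M linear_map_ident e])
  have h_cong: "h x = h y" if x: "x \<in> carrier M" and y: "y \<in> carrier M" and "d x = d y" for x y
  proof -
    have "x \<ominus>\<^bsub>M\<^esub> y \<in> ?Z"
      using that dc[OF y] by (simp add: linear_map_minus[OF M N d] N.r_neg a_minus_def[of N])
    then have "h (x \<ominus>\<^bsub>M\<^esub> y) = \<zero>\<^bsub>M\<^esub>" unfolding h_def using e_id by (simp add: a_minus_def M.r_neg)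
    then have "h x \<ominus>\<^bsub>M\<^esub> h y = \<zero>\<^bsub>M\<^esub>" using linear_map_minus[OF M M h x y] by simp
    then have "\<ominus>\<^bsub>M\<^esub> (\<ominus>\<^bsub>M\<^esub> h y) = h x"
      using linear_map_closed[OF h] x y by (intro M.minus_equality) (auto simp: a_minus_def)
    then show ?thesis using linear_map_closed[OF h y] by simp
  qed
  have dh: "d (h x) = d x" if x: "x \<in> carrier M" for x
    unfolding h_def using x linear_map_closed[OF e x] dc[OF x]
    by (simp add: linear_map_minus[OF M N d] de a_minus_def[of N])
  define s where "s y = h (inv_into (carrier M) d (p y))" for y
  have pd: "\<exists>x\<in>carrier M. p y = d x" if "y \<in> carrier N" for y
    using linear_map_closed[OF p that] by auto
  \<comment> \<open>\<open>inv_into\<close> need not be linear, but any preimage may be used in its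
    place; for sums and multiples the obvious one is taken.\<close>
  have s_eq: "s y = h x" if x: "x \<in> carrier M" and y: "p y = d x" for x y
    unfolding s_def y
    by (rule h_cong) (use x in \<open>simp_all add: inv_into_into f_inv_into_f\<close>)
  have "s \<in> linear_maps K N M"
  proof (rule linear_mapsI)
    fix y assume y: "y \<in> carrier N"
    obtain x where x: "x \<in> carrier M" "p y = d x" using pd[OF y] by (elim bexE)
    show "s y \<in> carrier M" using s_eq[OF x] linear_map_closed[OF h x(1)] by simp
    fix a assume a: "a \<in> carrier K"
    have "s (a \<odot>\<^bsub>N\<^esub> y) = h (a \<odot>\<^bsub>M\<^esub> x)"
      by (rule s_eq) (use a x y in \<open>simp_all add: linear_map_smult[OF p] d_smult\<close>)
    then show "s (a \<odot>\<^bsub>N\<^esub> y) = a \<odot>\<^bsub>M\<^esub> s y"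
      using s_eq[OF x] linear_map_smult[OF h a x(1)] by simp
  next
    fix y y' assume y: "y \<in> carrier N" "y' \<in> carrier N"
    obtain x where x: "x \<in> carrier M" "p y = d x" using pd[OF y(1)] by (elim bexE)
    obtain x' where x': "x' \<in> carrier M" "p y' = d x'" using pd[OF y(2)] by (elim bexE)
    have "s (y \<oplus>\<^bsub>N\<^esub> y') = h (x \<oplus>\<^bsub>M\<^esub> x')"
      by (rule s_eq) (use x x' y in \<open>simp_all add: linear_map_add[OF p] d_add\<close>)
    then show "s (y \<oplus>\<^bsub>N\<^esub> y') = s y \<oplus>\<^bsub>M\<^esub> s y'"
      using s_eq[OF x] s_eq[OF x'] linear_map_add[OF h x(1) x'(1)] by simp
  qed
  moreover have "d (s (d x)) = d x" if x: "x \<in> carrier M" for x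
    using s_eq[OF x p_id] dh[OF x] x by simp
  ultimately show thesis using that by blast
qed

section \<open>Exactness of the tensor product over a field\<close>

text \<open>A retraction \<open>e\<close> of \<open>M\<close> onto \<open>U\<close> gives the left
  inverse \<open>e \<otimes> id\<close>.\<close>

lemma tensor_inclusion_inj:
  assumes K: "field K" and M: "module K M" and N: "module K N" and U: "submodule U K M"
  shows "inj_on (tensor_map K (M\<lparr>carrier := U\<rparr>) N M N id id) (carrier (tensor K (M\<lparr>carrier := U\<rparr>) N))"
proof -
  let ?U = "M\<lparr>carrier := U\<rparr>"
  have U': "module K ?U" using submodule.submodule_is_module[OF U M] .
  have incl: "id \<in> linear_maps K ?U M"
    using linear_map_inclusion[OF linear_map_id] module.submoduleE(1)[OF M U] .
  obtain e where e: "e \<in> linear_maps K M ?U" "\<And>u. u \<in> U \<Longrightarrow> e u = u"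
    using subspace_retraction[OF K M U] by blast
  show ?thesis
  proof (rule inj_on_inverseI)
    fix x assume x: "x \<in> carrier (tensor K ?U N)"
    have "tensor_map K M N ?U N e id (tensor_map K ?U N M N id id x) =
        tensor_map K ?U N ?U N (\<lambda>x. e (id x)) (\<lambda>x. id (id x)) x"
      by (rule tensor_map_comp) (use M N U' e incl x linear_map_id in auto)
    also have "\<dots> = x"
      by (rule tensor_map_ident)
        (use M N U' e x linear_map_comp[OF incl e(1)] linear_map_ident in auto)
    finally show "tensor_map K M N ?U N e id (tensor_map K ?U N M N id id x) = x" .
  qed
qed

text \<open>With \<open>s\<close> a pseudo-inverse of \<open>d = f - g\<close>, the idempotent \<open>1 - s d\<close> projects onto the
  equalizer, and \<open>(1 - s d) \<otimes> 1\<close> fixes every element equalized by \<open>f \<otimes> 1\<close> and \<open>g \<otimes> 1\<close>.\<close>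

lemma tensor_equalizer:
  assumes K: "field K" and M: "module K M" and N: "module K N" and P: "module K P"
    and f: "f \<in> linear_maps K M P" and g: "g \<in> linear_maps K M P"
    and y: "y \<in> carrier (tensor K M N)"
    and eq: "tensor_map K M N P N f id y = tensor_map K M N P N g id y"
  defines "U \<equiv> {x \<in> carrier M. f x = g x}"
  shows "y \<in> tensor_map K (M\<lparr>carrier := U\<rparr>) N M N id id ` carrier (tensor K (M\<lparr>carrier := U\<rparr>) N)"
proof -
  let ?U = "M\<lparr>carrier := U\<rparr>"
  interpret M: module K M by fact
  interpret P: module K P by fact
  interpret T: module K "tensor K M N" using tensor_module[OF M N] .
  have U: "submodule U K M" unfolding U_def using submodule_equalizer[OF M P f g] .
  have U': "module K ?U" using submodule.submodule_is_module[OF U M] .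
  have incl: "id \<in> linear_maps K ?U M"
    using linear_map_inclusion[OF linear_map_id] M.submoduleE(1)[OF U] .
  define d where "d x = f x \<ominus>\<^bsub>P\<^esub> g x" for x
  have d: "d \<in> linear_maps K M P" unfolding d_def by (rule linear_map_diff[OF M P f g])
  obtain s where s: "s \<in> linear_maps K P M" and sd: "\<And>x. x \<in> carrier M \<Longrightarrow> d (s (d x)) = d x"
    using linear_pseudo_inverse[OF K M P d] by blast
  define e where "e x = x \<ominus>\<^bsub>M\<^esub> s (d x)" for x
  have e: "e \<in> linear_maps K M M" unfolding e_def
    by (rule linear_map_diff[OF M M linear_map_ident linear_map_comp[OF d s]])
  note c = linear_map_closed[OF e] linear_map_closed[OF s] linear_map_closed[OF d]
    linear_map_closed[OF f] linear_map_closed[OF g]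
  have eU: "e x \<in> U" if x: "x \<in> carrier M" for x
  proof -
    have "d (e x) = \<zero>\<^bsub>P\<^esub>"
      using x c unfolding e_def
      by (simp add: linear_map_minus[OF M P d] sd a_minus_def[of P] P.r_neg)
    then have "f (e x) \<ominus>\<^bsub>P\<^esub> g (e x) = \<zero>\<^bsub>P\<^esub>" unfolding d_def .
    then have "\<ominus>\<^bsub>P\<^esub> (\<ominus>\<^bsub>P\<^esub> g (e x)) = f (e x)"
      using x c by (intro P.minus_equality) (auto simp: a_minus_def)
    then show ?thesis unfolding U_def using x c by simp
  qed
  have e': "e \<in> linear_maps K M ?U"
    by (rule linear_mapsI) (simp_all add: eU linear_map_add[OF e] linear_map_smult[OF e])
  \<comment> \<open>This is \<open>e = 1 - s f + s g\<close> with the negative term moved across, so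
    that additivity of \<open>tensor_map\<close> is enough.\<close>
  have sum: "e x \<oplus>\<^bsub>M\<^esub> s (f x) = x \<oplus>\<^bsub>M\<^esub> s (g x)" if x: "x \<in> carrier M" for x
  proof -
    have c': "s (f x) \<in> carrier M" "s (g x) \<in> carrier M" using x c by auto
    have "s (d x) = s (f x) \<ominus>\<^bsub>M\<^esub> s (g x)"
      unfolding d_def by (rule linear_map_minus[OF P M s]) (use x c in auto)
    then have "e x \<oplus>\<^bsub>M\<^esub> s (f x) = (x \<oplus>\<^bsub>M\<^esub> (\<ominus>\<^bsub>M\<^esub> s (f x) \<oplus>\<^bsub>M\<^esub> s (g x))) \<oplus>\<^bsub>M\<^esub> s (f x)"
      unfolding e_def using c' by (simp add: a_minus_def M.minus_add)
    also have "\<dots> = (x \<oplus>\<^bsub>M\<^esub> s (g x)) \<oplus>\<^bsub>M\<^esub> (\<ominus>\<^bsub>M\<^esub> s (f x) \<oplus>\<^bsub>M\<^esub> s (f x))"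
      using x c' by (simp only: M.a_ac M.a_closed M.add.inv_closed)
    finally show ?thesis using x c' by (simp add: M.l_neg)
  qed
  note lins = linear_map_comp[OF f s] linear_map_comp[OF g s] linear_map_id linear_map_ident e
  let ?t = "\<lambda>h. tensor_map K M N M N h id y"
  \<comment> \<open>Applying \<open>s \<otimes> id\<close> to the hypothesis makes these two terms
    coincide, so they cancel from the tensored form of \<open>sum\<close>.\<close>
  have sf: "?t (\<lambda>x. s (f x)) = ?t (\<lambda>x. s (g x))"
    using tensor_map_comp[OF M N P N M N f linear_map_id s linear_map_id y]
      tensor_map_comp[OF M N P N M N g linear_map_id s linear_map_id y] eq by (simp add: id_def)
  have "?t e \<oplus>\<^bsub>tensor K M N\<^esub> ?t (\<lambda>x. s (f x)) = ?t (\<lambda>x. e x \<oplus>\<^bsub>M\<^esub> s (f x))"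
    by (rule tensor_map_sum[symmetric]) (simp_all add: M N y lins)
  also have "\<dots> = ?t (\<lambda>x. x \<oplus>\<^bsub>M\<^esub> s (g x))"
    by (rule tensor_map_cong) (simp_all add: M N y lins sum linear_map_sum)
  also have "\<dots> = ?t (\<lambda>x. x) \<oplus>\<^bsub>tensor K M N\<^esub> ?t (\<lambda>x. s (g x))"
    by (rule tensor_map_sum) (simp_all add: M N y lins)
  also have "?t (\<lambda>x. x) = y" by (rule tensor_map_ident) (simp_all add: M N y lins)
  finally have "?t e \<oplus>\<^bsub>tensor K M N\<^esub> ?t (\<lambda>x. s (g x)) = y \<oplus>\<^bsub>tensor K M N\<^esub> ?t (\<lambda>x. s (g x))"
    unfolding sf .
  moreover have "?t (\<lambda>x. s (g x)) \<in> carrier (tensor K M N)" "?t e \<in> carrier (tensor K M N)"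
    by (rule tensor_map_closed; simp add: M N y lins)+
  ultimately have "?t e = y" using y T.add.right_cancel by blast
  \<comment> \<open>Since \<open>e\<close> takes values in \<open>U\<close>, the map
    \<open>e \<otimes> id\<close> factors through \<open>U \<otimes> N\<close>; the corestriction
    applied to \<open>y\<close> is the preimage sought.\<close>
  moreover have "?t e = tensor_map K ?U N M N id id (tensor_map K M N ?U N e id y)"
    using tensor_map_comp[OF M N U' N M N e' linear_map_id incl linear_map_id y] by (simp add: id_def)
  moreover have "tensor_map K M N ?U N e id y \<in> carrier (tensor K ?U N)"
    by (rule tensor_map_closed) (simp_all add: M N U' e' linear_map_id y)
  ultimately show ?thesis by (metis imageI)
qed

section \<open>The induced comodule\<close>

text \<open>The data that enter the definition of \<open>Ind\<close>. Both induced comodules are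
  instances, so their axioms are proved once.\<close>

locale induction_data = pi_coalgebra K G H \<Delta> \<epsilon>
  for K :: "'k ring" and G :: "'g monoid" and H :: "'g \<Rightarrow> ('k, 'h) module"
    and \<Delta> :: "'g \<Rightarrow> 'g \<Rightarrow> 'h \<Rightarrow> ('k, 'h, 'h) tensor" and \<epsilon> :: "'h \<Rightarrow> 'k" +
  fixes C :: "'g \<Rightarrow> ('k, 'c) module" and \<sigma> :: "'g \<Rightarrow> 'h \<Rightarrow> 'c"
    and V :: "'g \<Rightarrow> ('k, 'v) module" and \<rho> :: "'g \<Rightarrow> 'g \<Rightarrow> 'v \<Rightarrow> ('k, 'v, 'c) tensor"
  assumes C_module: "module K (C \<one>\<^bsub>G\<^esub>)" and V_module: "module K (V \<one>\<^bsub>G\<^esub>)"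
    and \<sigma>_linear: "\<sigma> \<one>\<^bsub>G\<^esub> \<in> linear_maps K (H \<one>\<^bsub>G\<^esub>) (C \<one>\<^bsub>G\<^esub>)"
    and \<rho>_linear: "\<rho> \<one>\<^bsub>G\<^esub> \<one>\<^bsub>G\<^esub> \<in> linear_maps K (V \<one>\<^bsub>G\<^esub>) (tensor K (V \<one>\<^bsub>G\<^esub>) (C \<one>\<^bsub>G\<^esub>))"
begin

abbreviation "V1 \<equiv> V \<one>\<^bsub>G\<^esub>"
abbreviation "C1 \<equiv> C \<one>\<^bsub>G\<^esub>"
abbreviation "L \<equiv> left_coaction K G H \<Delta> C \<sigma>"
abbreviation "Ind \<equiv> Ind_space K G H \<Delta> C \<sigma> V \<rho>"
abbreviation "\<theta> \<equiv> Ind_coaction K G H \<Delta> C \<sigma> V \<rho>"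

definition "I_L \<alpha> = tensor_map K V1 (H \<alpha>) V1 (tensor K C1 (H \<alpha>)) id (L \<alpha>)"
definition "\<rho>_I \<alpha> x = tensor_assoc K V1 C1 (H \<alpha>)
  (tensor_map K V1 (H \<alpha>) (tensor K V1 C1) (H \<alpha>) (\<rho> \<one>\<^bsub>G\<^esub> \<one>\<^bsub>G\<^esub>) id x)"
definition "I_\<Delta> \<alpha> \<beta> = tensor_map K V1 (H (\<alpha> \<otimes>\<^bsub>G\<^esub> \<beta>)) V1 (tensor K (H \<alpha>) (H \<beta>)) id (\<Delta> \<alpha> \<beta>)"
text \<open>The second factor is left general: \<open>H \<beta>\<close> for the coaction,
  \<open>H \<beta> \<otimes> H \<gamma>\<close> for coassociativity, and the ground field for the
  counit.\<close>

definition "emb \<alpha> N y = tensor_assoc K V1 (H \<alpha>) N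
  (tensor_map K (Ind \<alpha>) N (tensor K V1 (H \<alpha>)) N id id y)"

lemma Ind_eq:
  "Ind \<alpha> = (tensor K V1 (H \<alpha>))\<lparr>carrier := {x \<in> carrier (tensor K V1 (H \<alpha>)). I_L \<alpha> x = \<rho>_I \<alpha> x}\<rparr>"
  unfolding Ind_space_def I_L_def \<rho>_I_def by simp

lemmas [simp] = C_module V_module space tensor_module \<sigma>_linear \<rho>_linear comult_linear
  linear_map_id linear_map_ident

text \<open>\<open>comult_linear\<close> gives the domain at index
  \<open>\<one> \<otimes> \<alpha>\<close>; the normalized form is the one that later terms
  match.\<close>

lemma comult_one_linear [simp]:
  "\<alpha> \<in> carrier G \<Longrightarrow> \<Delta> \<one>\<^bsub>G\<^esub> \<alpha> \<in> linear_maps K (H \<alpha>) (tensor K (H \<one>\<^bsub>G\<^esub>) (H \<alpha>))"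
  using comult_linear[of "\<one>\<^bsub>G\<^esub>" \<alpha>] by simp

lemma L_linear [simp]: "\<alpha> \<in> carrier G \<Longrightarrow> L \<alpha> \<in> linear_maps K (H \<alpha>) (tensor K C1 (H \<alpha>))"
  unfolding left_coaction_def
  by (rule linear_map_comp[OF comult_one_linear tensor_map_linear]) simp_all

lemma I_L_linear [simp]:
  "\<alpha> \<in> carrier G \<Longrightarrow> I_L \<alpha> \<in> linear_maps K (tensor K V1 (H \<alpha>)) (tensor K V1 (tensor K C1 (H \<alpha>)))"
  unfolding I_L_def by (rule tensor_map_linear) simp_all

lemma \<rho>_I_linear [simp]:
  "\<alpha> \<in> carrier G \<Longrightarrow> \<rho>_I \<alpha> \<in> linear_maps K (tensor K V1 (H \<alpha>)) (tensor K V1 (tensor K C1 (H \<alpha>)))"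
  unfolding \<rho>_I_def by (rule linear_map_comp[OF tensor_map_linear tensor_assoc_linear]) simp_all

lemma I_\<Delta>_linear [simp]:
  "\<lbrakk>\<alpha> \<in> carrier G; \<beta> \<in> carrier G\<rbrakk> \<Longrightarrow> I_\<Delta> \<alpha> \<beta> \<in>
     linear_maps K (tensor K V1 (H (\<alpha> \<otimes>\<^bsub>G\<^esub> \<beta>))) (tensor K V1 (tensor K (H \<alpha>) (H \<beta>)))"
  unfolding I_\<Delta>_def by (rule tensor_map_linear) simp_all

lemma Ind_submodule:
  assumes "\<alpha> \<in> carrier G"
  shows "submodule {x \<in> carrier (tensor K V1 (H \<alpha>)). I_L \<alpha> x = \<rho>_I \<alpha> x} K (tensor K V1 (H \<alpha>))"
  by (rule submodule_equalizer[of K _ "tensor K V1 (tensor K C1 (H \<alpha>))"]) (use assms in simp_all)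

lemma Ind_module [simp]: "\<alpha> \<in> carrier G \<Longrightarrow> module K (Ind \<alpha>)"
  unfolding Ind_eq by (rule submodule.submodule_is_module[OF Ind_submodule]) simp_all

lemma Ind_incl [simp]: "id \<in> linear_maps K (Ind \<alpha>) (tensor K V1 (H \<alpha>))"
  unfolding Ind_eq by (rule linear_map_inclusion[OF linear_map_id]) auto

lemma Ind_carrierD:
  assumes "x \<in> carrier (Ind \<alpha>)"
  shows "x \<in> carrier (tensor K V1 (H \<alpha>))" "I_L \<alpha> x = \<rho>_I \<alpha> x"
  using assms unfolding Ind_eq by auto

lemma emb_linear [simp]:
  "\<lbrakk>\<alpha> \<in> carrier G; module K N\<rbrakk> \<Longrightarrow>
     emb \<alpha> N \<in> linear_maps K (tensor K (Ind \<alpha>) N) (tensor K V1 (tensor K (H \<alpha>) N))"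
  unfolding emb_def by (rule linear_map_comp[OF tensor_map_linear tensor_assoc_linear]) simp_all

text \<open>The inclusion stays injective after tensoring, and the associator has a left
  inverse.\<close>

lemma emb_inj:
  assumes \<alpha>: "\<alpha> \<in> carrier G" and N: "module K N"
  shows "inj_on (emb \<alpha> N) (carrier (tensor K (Ind \<alpha>) N))"
proof (rule inj_onI)
  fix x y assume x: "x \<in> carrier (tensor K (Ind \<alpha>) N)" and y: "y \<in> carrier (tensor K (Ind \<alpha>) N)"
    and eq: "emb \<alpha> N x = emb \<alpha> N y"
  let ?i = "tensor_map K (Ind \<alpha>) N (tensor K V1 (H \<alpha>)) N id id"
  have "?i x \<in> carrier (tensor K (tensor K V1 (H \<alpha>)) N)" "?i y \<in> carrier (tensor K (tensor K V1 (H \<alpha>)) N)"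
    by (rule tensor_map_closed; simp add: \<alpha> N x y)+
  then have "?i x = ?i y"
    using arg_cong[OF eq, of "tensor_assoc_inv K V1 (H \<alpha>) N"]
    unfolding emb_def by (simp add: \<alpha> N tensor_assoc_inv_assoc)
  moreover have "inj_on ?i (carrier (tensor K (Ind \<alpha>) N))"
    unfolding Ind_eq by (rule tensor_inclusion_inj[OF K.field_axioms _ N Ind_submodule]) (simp_all add: \<alpha>)
  ultimately show "x = y" using x y inj_onD by metis
qed

lemma emb_natural:
  assumes \<alpha>: "\<alpha> \<in> carrier G" and N: "module K N" "module K N'" and g: "g \<in> linear_maps K N N'"
    and z: "z \<in> carrier (tensor K (Ind \<alpha>) N)"
  shows "emb \<alpha> N' (tensor_map K (Ind \<alpha>) N (Ind \<alpha>) N' id g z) =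
    tensor_map K V1 (tensor K (H \<alpha>) N) V1 (tensor K (H \<alpha>) N') id (tensor_map K (H \<alpha>) N (H \<alpha>) N' id g)
      (emb \<alpha> N z)"
proof -
  let ?T = "tensor K V1 (H \<alpha>)"
  have "tensor_map K (Ind \<alpha>) N' ?T N' id id (tensor_map K (Ind \<alpha>) N (Ind \<alpha>) N' id g z) =
      tensor_map K ?T N ?T N' (tensor_map K V1 (H \<alpha>) V1 (H \<alpha>) id id) g (tensor_map K (Ind \<alpha>) N ?T N id id z)"
    by (rule tensor_map_square) (simp_all add: \<alpha> N g z tensor_map_linear tensor_map_id Ind_carrierD(1))
  then show ?thesis unfolding emb_def
    by (simp only:) (rule tensor_assoc_natural; simp add: \<alpha> N g z tensor_map_closed)
qed

text \<open>The left coaction of \<open>C1\<close> on \<open>H\<close> commutes with the right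
  coaction \<open>\<Delta>\<close>: coassociativity at the indices
  \<open>\<one>, \<alpha>, \<beta>\<close>, with \<open>\<sigma> \<one>\<close> applied to the first
  leg.\<close>

lemma L_coassoc:
  assumes \<alpha>: "\<alpha> \<in> carrier G" and \<beta>: "\<beta> \<in> carrier G" and h: "h \<in> carrier (H (\<alpha> \<otimes>\<^bsub>G\<^esub> \<beta>))"
  shows "tensor_assoc K C1 (H \<alpha>) (H \<beta>) (tensor_map K (H \<alpha>) (H \<beta>) (tensor K C1 (H \<alpha>)) (H \<beta>) (L \<alpha>) id (\<Delta> \<alpha> \<beta> h)) =
    tensor_map K C1 (H (\<alpha> \<otimes>\<^bsub>G\<^esub> \<beta>)) C1 (tensor K (H \<alpha>) (H \<beta>)) id (\<Delta> \<alpha> \<beta>) (L (\<alpha> \<otimes>\<^bsub>G\<^esub> \<beta>) h)"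
proof -
  let ?H1 = "H \<one>\<^bsub>G\<^esub>" and ?HH = "tensor K (H \<alpha>) (H \<beta>)" and ?\<alpha>\<beta> = "\<alpha> \<otimes>\<^bsub>G\<^esub> \<beta>"
  note [simp] = \<alpha> \<beta>
  have \<Delta>h: "\<Delta> \<alpha> \<beta> h \<in> carrier ?HH" using linear_map_closed[OF comult_linear h] by simp
  have \<Delta>1h: "\<Delta> \<one>\<^bsub>G\<^esub> ?\<alpha>\<beta> h \<in> carrier (tensor K ?H1 (H ?\<alpha>\<beta>))"
    using linear_map_closed[OF comult_one_linear h] by simp
  have "tensor_map K (H \<alpha>) (H \<beta>) (tensor K C1 (H \<alpha>)) (H \<beta>) (L \<alpha>) id (\<Delta> \<alpha> \<beta> h) =
      tensor_map K (tensor K ?H1 (H \<alpha>)) (H \<beta>) (tensor K C1 (H \<alpha>)) (H \<beta>)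
        (tensor_map K ?H1 (H \<alpha>) C1 (H \<alpha>) (\<sigma> \<one>\<^bsub>G\<^esub>) id) id
        (tensor_map K (H \<alpha>) (H \<beta>) (tensor K ?H1 (H \<alpha>)) (H \<beta>) (\<Delta> \<one>\<^bsub>G\<^esub> \<alpha>) id (\<Delta> \<alpha> \<beta> h))"
    by (rule tensor_map_comp_eq[symmetric])
      (simp_all add: tensor_map_linear \<Delta>h, simp add: left_coaction_def)
  then have "tensor_assoc K C1 (H \<alpha>) (H \<beta>)
      (tensor_map K (H \<alpha>) (H \<beta>) (tensor K C1 (H \<alpha>)) (H \<beta>) (L \<alpha>) id (\<Delta> \<alpha> \<beta> h)) =
    tensor_map K ?H1 ?HH C1 ?HH (\<sigma> \<one>\<^bsub>G\<^esub>) (tensor_map K (H \<alpha>) (H \<beta>) (H \<alpha>) (H \<beta>) id id)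
      (tensor_assoc K ?H1 (H \<alpha>) (H \<beta>)
        (tensor_map K (H \<alpha>) (H \<beta>) (tensor K ?H1 (H \<alpha>)) (H \<beta>) (\<Delta> \<one>\<^bsub>G\<^esub> \<alpha>) id (\<Delta> \<alpha> \<beta> h)))"
    by (simp only:) (rule tensor_assoc_natural; simp add: tensor_map_closed \<Delta>h)
  also have "tensor_assoc K ?H1 (H \<alpha>) (H \<beta>)
        (tensor_map K (H \<alpha>) (H \<beta>) (tensor K ?H1 (H \<alpha>)) (H \<beta>) (\<Delta> \<one>\<^bsub>G\<^esub> \<alpha>) id (\<Delta> \<alpha> \<beta> h)) =
      tensor_map K ?H1 (H ?\<alpha>\<beta>) ?H1 ?HH id (\<Delta> \<alpha> \<beta>) (\<Delta> \<one>\<^bsub>G\<^esub> ?\<alpha>\<beta> h)"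
    using coassoc[of "\<one>\<^bsub>G\<^esub>" \<alpha> \<beta> h] h by simp
  \<comment> \<open>\<open>\<sigma>\<close> and \<open>\<Delta>\<close> now act on different legs
    and may be exchanged.\<close>
  also have "tensor_map K ?H1 ?HH C1 ?HH (\<sigma> \<one>\<^bsub>G\<^esub>) (tensor_map K (H \<alpha>) (H \<beta>) (H \<alpha>) (H \<beta>) id id) \<dots> =
      tensor_map K C1 (H ?\<alpha>\<beta>) C1 ?HH id (\<Delta> \<alpha> \<beta>)
        (tensor_map K ?H1 (H ?\<alpha>\<beta>) C1 (H ?\<alpha>\<beta>) (\<sigma> \<one>\<^bsub>G\<^esub>) id (\<Delta> \<one>\<^bsub>G\<^esub> ?\<alpha>\<beta> h))"
    by (rule tensor_map_square)
      (simp_all add: tensor_map_linear \<Delta>1h tensor_map_id linear_map_closed[OF comult_linear])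
  finally show ?thesis unfolding left_coaction_def .
qed

text \<open>Fully rebracketed to the right, both sides are \<open>\<Delta>\<close> on the last leg,
  applied to \<open>I_L x\<close> on the left and to \<open>\<rho>_I x\<close> on the right. These
  agree because \<open>x\<close> lies in the induced space at
  \<open>\<alpha> \<otimes> \<beta>\<close>.\<close>

lemma I_\<Delta>_equalized:
  assumes \<alpha>: "\<alpha> \<in> carrier G" and \<beta>: "\<beta> \<in> carrier G" and x: "x \<in> carrier (Ind (\<alpha> \<otimes>\<^bsub>G\<^esub> \<beta>))"
  defines "y \<equiv> tensor_assoc_inv K V1 (H \<alpha>) (H \<beta>) (I_\<Delta> \<alpha> \<beta> x)"
  shows "tensor_map K (tensor K V1 (H \<alpha>)) (H \<beta>) (tensor K V1 (tensor K C1 (H \<alpha>))) (H \<beta>) (I_L \<alpha>) id y =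
    tensor_map K (tensor K V1 (H \<alpha>)) (H \<beta>) (tensor K V1 (tensor K C1 (H \<alpha>))) (H \<beta>) (\<rho>_I \<alpha>) id y"
    (is "?l = ?r")
proof -
  note [simp] = \<alpha> \<beta>
  let ?\<rho> = "\<rho> \<one>\<^bsub>G\<^esub> \<one>\<^bsub>G\<^esub>" and ?\<alpha>\<beta> = "\<alpha> \<otimes>\<^bsub>G\<^esub> \<beta>" and ?HH = "tensor K (H \<alpha>) (H \<beta>)"
    and ?T = "tensor K V1 (H \<alpha>)" and ?CH = "tensor K C1 (H \<alpha>)" and ?VC = "tensor K V1 C1"
  have xT: "x \<in> carrier (tensor K V1 (H ?\<alpha>\<beta>))" using Ind_carrierD(1)[OF x] .
  have Dx: "I_\<Delta> \<alpha> \<beta> x \<in> carrier (tensor K V1 ?HH)" using linear_map_closed[OF I_\<Delta>_linear xT] by simp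
  have y: "y \<in> carrier (tensor K ?T (H \<beta>))"
    unfolding y_def by (rule tensor_assoc_inv_closed) (simp_all add: Dx)
  have ay: "tensor_assoc K V1 (H \<alpha>) (H \<beta>) y = I_\<Delta> \<alpha> \<beta> x"
    unfolding y_def by (rule tensor_assoc_assoc_inv) (simp_all add: Dx)
  \<comment> \<open>\<open>?a\<close> rebrackets
    \<open>(V1 \<otimes> (C1 \<otimes> H \<alpha>)) \<otimes> H \<beta>\<close> completely to the
    right, \<open>?b\<close> undoes it, and \<open>?D\<close> is \<open>\<Delta>\<close> on the last
    leg.\<close>
  let ?a = "\<lambda>z. tensor_map K V1 (tensor K ?CH (H \<beta>)) V1 (tensor K C1 ?HH) id (tensor_assoc K C1 (H \<alpha>) (H \<beta>))
    (tensor_assoc K V1 ?CH (H \<beta>) z)"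
  let ?b = "\<lambda>z. tensor_assoc_inv K V1 ?CH (H \<beta>) (tensor_map K V1 (tensor K C1 ?HH) V1 (tensor K ?CH (H \<beta>)) id
    (tensor_assoc_inv K C1 (H \<alpha>) (H \<beta>)) z)"
  let ?D = "tensor_map K V1 (tensor K C1 (H ?\<alpha>\<beta>)) V1 (tensor K C1 ?HH) id
    (tensor_map K C1 (H ?\<alpha>\<beta>) C1 ?HH id (\<Delta> \<alpha> \<beta>))"
  have ba: "?b (?a z) = z" if z: "z \<in> carrier (tensor K (tensor K V1 ?CH) (H \<beta>))" for z
  proof -
    have "tensor_map K V1 (tensor K C1 ?HH) V1 (tensor K ?CH (H \<beta>)) id (tensor_assoc_inv K C1 (H \<alpha>) (H \<beta>)) (?a z) =
        tensor_map K V1 (tensor K ?CH (H \<beta>)) V1 (tensor K ?CH (H \<beta>)) id id (tensor_assoc K V1 ?CH (H \<beta>) z)"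
      by (rule tensor_map_comp_eq)
        (simp_all add: tensor_assoc_linear tensor_assoc_inv_linear tensor_assoc_inv_assoc tensor_assoc_closed z)
    then show ?thesis using z by (simp add: tensor_map_id tensor_assoc_closed tensor_assoc_inv_assoc)
  qed
  \<comment> \<open>On this side the comultiplication must pass \<open>L\<close>, which is
    \<open>L_coassoc\<close> under \<open>V1 \<otimes> _\<close>.\<close>
  have "?a ?l = ?D (I_L ?\<alpha>\<beta> x)"
  proof -
    have "tensor_assoc K V1 ?CH (H \<beta>) ?l =
        tensor_map K V1 ?HH V1 (tensor K ?CH (H \<beta>)) id
          (tensor_map K (H \<alpha>) (H \<beta>) ?CH (H \<beta>) (L \<alpha>) id) (I_\<Delta> \<alpha> \<beta> x)"
      unfolding I_L_def ay[symmetric] by (rule tensor_assoc_natural) (simp_all add: y)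
    also have "\<dots> = tensor_map K V1 (H ?\<alpha>\<beta>) V1 (tensor K ?CH (H \<beta>)) id
          (\<lambda>h. tensor_map K (H \<alpha>) (H \<beta>) ?CH (H \<beta>) (L \<alpha>) id (\<Delta> \<alpha> \<beta> h)) x"
      unfolding I_\<Delta>_def
      by (rule tensor_map_comp_eq)
        (simp_all add: xT tensor_map_linear linear_map_comp[OF comult_linear tensor_map_linear])
    finally have "?a ?l = tensor_map K V1 (tensor K ?CH (H \<beta>)) V1 (tensor K C1 ?HH) id (tensor_assoc K C1 (H \<alpha>) (H \<beta>))
        (tensor_map K V1 (H ?\<alpha>\<beta>) V1 (tensor K ?CH (H \<beta>)) id
          (\<lambda>h. tensor_map K (H \<alpha>) (H \<beta>) ?CH (H \<beta>) (L \<alpha>) id (\<Delta> \<alpha> \<beta> h)) x)"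
      by simp
    also have "\<dots> = ?D (I_L ?\<alpha>\<beta> x)"
      unfolding I_L_def
      by (rule tensor_map_square)
        (simp_all add: xT L_coassoc tensor_map_linear tensor_assoc_linear
          linear_map_comp[OF comult_linear tensor_map_linear])
    finally show ?thesis .
  qed
  also have "\<dots> = ?D (\<rho>_I ?\<alpha>\<beta> x)" using Ind_carrierD(2)[OF x] by simp
  also have "\<dots> = ?a ?r"
  proof -
    have \<rho>x: "tensor_map K V1 (H ?\<alpha>\<beta>) ?VC (H ?\<alpha>\<beta>) ?\<rho> id x \<in> carrier (tensor K ?VC (H ?\<alpha>\<beta>))"
      by (rule tensor_map_closed) (simp_all add: xT)
    let ?\<rho>I = "tensor_map K V1 (H \<alpha>) ?VC (H \<alpha>) ?\<rho> id"
    let ?r' = "tensor_map K ?T (H \<beta>) (tensor K ?VC (H \<alpha>)) (H \<beta>) ?\<rho>I id y"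
    have r': "?r' \<in> carrier (tensor K (tensor K ?VC (H \<alpha>)) (H \<beta>))"
      by (rule tensor_map_closed) (simp_all add: y tensor_map_linear)
    have "?r = tensor_map K (tensor K ?VC (H \<alpha>)) (H \<beta>) (tensor K V1 ?CH) (H \<beta>) (tensor_assoc K V1 C1 (H \<alpha>)) id ?r'"
      by (rule tensor_map_comp_eq[symmetric])
        (simp_all add: y tensor_map_linear tensor_assoc_linear, simp add: \<rho>_I_def)
    \<comment> \<open>The pentagon puts both rebracketings outside, where \<open>\<rho>\<close> and
      \<open>\<Delta>\<close> act on separate legs and commute by naturality.\<close>
    then have "?a ?r = tensor_assoc K V1 C1 ?HH (tensor_assoc K ?VC (H \<alpha>) (H \<beta>) ?r')"
      using tensor_assoc_pentagon[OF V_module C_module space space r'] by simp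
    also have "tensor_assoc K ?VC (H \<alpha>) (H \<beta>) ?r' =
        tensor_map K V1 ?HH ?VC ?HH ?\<rho> (tensor_map K (H \<alpha>) (H \<beta>) (H \<alpha>) (H \<beta>) id id) (I_\<Delta> \<alpha> \<beta> x)"
      unfolding ay[symmetric] by (rule tensor_assoc_natural) (simp_all add: y)
    \<comment> \<open>The identity of \<open>V1 \<otimes> C1\<close> appears as
      \<open>id \<otimes> id\<close>, ready for the next use of naturality.\<close>
    also have "\<dots> = tensor_map K ?VC (H ?\<alpha>\<beta>) ?VC ?HH (tensor_map K V1 C1 V1 C1 id id) (\<Delta> \<alpha> \<beta>)
        (tensor_map K V1 (H ?\<alpha>\<beta>) ?VC (H ?\<alpha>\<beta>) ?\<rho> id x)"
      unfolding I_\<Delta>_def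
      by (rule tensor_map_square)
        (simp_all add: xT tensor_map_linear tensor_map_id linear_map_closed[OF comult_linear]
          linear_map_closed[OF \<rho>_linear])
    also have "tensor_assoc K V1 C1 ?HH \<dots> = ?D (\<rho>_I ?\<alpha>\<beta> x)"
      unfolding \<rho>_I_def by (rule tensor_assoc_natural) (simp_all add: \<rho>x)
    finally show ?thesis by (rule sym)
  qed
  finally have "?b (?a ?l) = ?b (?a ?r)" by simp
  moreover have "?l \<in> carrier (tensor K (tensor K V1 ?CH) (H \<beta>))" "?r \<in> carrier (tensor K (tensor K V1 ?CH) (H \<beta>))"
    by (rule tensor_map_closed; simp add: y)+
  ultimately show ?thesis using ba by simp
qed

text \<open>\<open>Ind \<alpha>\<close> is the equalizer of \<open>I_L \<alpha>\<close> and
  \<open>\<rho>_I \<alpha>\<close>, so \<open>tensor_equalizer\<close> supplies a preimage of the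
  rebracketed element.\<close>

lemma Ind_coaction_ex:
  assumes \<alpha>: "\<alpha> \<in> carrier G" and \<beta>: "\<beta> \<in> carrier G" and x: "x \<in> carrier (Ind (\<alpha> \<otimes>\<^bsub>G\<^esub> \<beta>))"
  shows "\<exists>z\<in>carrier (tensor K (Ind \<alpha>) (H \<beta>)). emb \<alpha> (H \<beta>) z = I_\<Delta> \<alpha> \<beta> x"
proof -
  let ?y = "tensor_assoc_inv K V1 (H \<alpha>) (H \<beta>) (I_\<Delta> \<alpha> \<beta> x)"
  have Dx: "I_\<Delta> \<alpha> \<beta> x \<in> carrier (tensor K V1 (tensor K (H \<alpha>) (H \<beta>)))"
    using linear_map_closed[OF I_\<Delta>_linear Ind_carrierD(1)[OF x]] \<alpha> \<beta> by simp
  have "?y \<in> tensor_map K (Ind \<alpha>) (H \<beta>) (tensor K V1 (H \<alpha>)) (H \<beta>) id id ` carrier (tensor K (Ind \<alpha>) (H \<beta>))"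
    unfolding Ind_eq
    by (rule tensor_equalizer[OF K.field_axioms _ _ _ I_L_linear \<rho>_I_linear _ I_\<Delta>_equalized])
      (simp_all add: \<alpha> \<beta> x Dx tensor_assoc_inv_closed)
  then obtain z where z: "z \<in> carrier (tensor K (Ind \<alpha>) (H \<beta>))"
    "?y = tensor_map K (Ind \<alpha>) (H \<beta>) (tensor K V1 (H \<alpha>)) (H \<beta>) id id z" by (elim imageE)
  have "emb \<alpha> (H \<beta>) z = I_\<Delta> \<alpha> \<beta> x"
    unfolding emb_def z(2)[symmetric] by (rule tensor_assoc_assoc_inv) (simp_all add: \<alpha> \<beta> Dx)
  then show ?thesis using z(1) by blast
qed

text \<open>Existence and injectivity of \<open>emb\<close> justify the definite description; from
  here on only these two properties of the coaction are used.\<close>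

lemma Ind_coaction_emb:
  assumes "\<alpha> \<in> carrier G" "\<beta> \<in> carrier G" "x \<in> carrier (Ind (\<alpha> \<otimes>\<^bsub>G\<^esub> \<beta>))"
  shows "\<theta> \<alpha> \<beta> x \<in> carrier (tensor K (Ind \<alpha>) (H \<beta>)) \<and> emb \<alpha> (H \<beta>) (\<theta> \<alpha> \<beta> x) = I_\<Delta> \<alpha> \<beta> x"
proof -
  let ?P = "\<lambda>z. z \<in> carrier (tensor K (Ind \<alpha>) (H \<beta>)) \<and> emb \<alpha> (H \<beta>) z = I_\<Delta> \<alpha> \<beta> x"
  obtain z where "?P z" using Ind_coaction_ex[OF assms] by blast
  then have "?P (THE z. ?P z)"
    using inj_onD[OF emb_inj[OF assms(1) space[OF assms(2)]]] by (intro theI[of ?P z]) auto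
  then show ?thesis unfolding Ind_coaction_def Let_def emb_def I_\<Delta>_def .
qed

lemmas Ind_coaction_closed = Ind_coaction_emb[THEN conjunct1]
lemmas emb_Ind_coaction = Ind_coaction_emb[THEN conjunct2]

text \<open>The composite of the injective linear map \<open>emb\<close> with the coaction is the
  linear map \<open>I_\<Delta>\<close>, so the laws can be reflected along
  \<open>emb\<close>.\<close>

lemma Ind_coaction_linear [simp]:
  assumes \<alpha>: "\<alpha> \<in> carrier G" and \<beta>: "\<beta> \<in> carrier G"
  shows "\<theta> \<alpha> \<beta> \<in> linear_maps K (Ind (\<alpha> \<otimes>\<^bsub>G\<^esub> \<beta>)) (tensor K (Ind \<alpha>) (H \<beta>))"
proof -
  interpret I: module K "Ind (\<alpha> \<otimes>\<^bsub>G\<^esub> \<beta>)" using \<alpha> \<beta> by simp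
  interpret IH: module K "tensor K (Ind \<alpha>) (H \<beta>)" using \<alpha> \<beta> by simp
  note inj = inj_onD[OF emb_inj[OF \<alpha> space[OF \<beta>]]]
  have e: "emb \<alpha> (H \<beta>) \<in> linear_maps K (tensor K (Ind \<alpha>) (H \<beta>)) (tensor K V1 (tensor K (H \<alpha>) (H \<beta>)))"
    using \<alpha> \<beta> by simp
  have D: "I_\<Delta> \<alpha> \<beta> \<in> linear_maps K (Ind (\<alpha> \<otimes>\<^bsub>G\<^esub> \<beta>)) (tensor K V1 (tensor K (H \<alpha>) (H \<beta>)))"
    using linear_map_comp[OF Ind_incl I_\<Delta>_linear] \<alpha> \<beta> by simp
  note ops = Ind_coaction_closed[OF \<alpha> \<beta>] emb_Ind_coaction[OF \<alpha> \<beta>]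
  show ?thesis
  proof (rule linear_mapsI)
    fix x assume x: "x \<in> carrier (Ind (\<alpha> \<otimes>\<^bsub>G\<^esub> \<beta>))"
    show "\<theta> \<alpha> \<beta> x \<in> carrier (tensor K (Ind \<alpha>) (H \<beta>))" using ops(1)[OF x] .
    fix a assume a: "a \<in> carrier K"
    show "\<theta> \<alpha> \<beta> (a \<odot>\<^bsub>Ind (\<alpha> \<otimes>\<^bsub>G\<^esub> \<beta>)\<^esub> x) = a \<odot>\<^bsub>tensor K (Ind \<alpha>) (H \<beta>)\<^esub> \<theta> \<alpha> \<beta> x"
      by (rule inj) (simp_all add: a x ops linear_map_smult[OF e] linear_map_smult[OF D])
  next
    fix x y assume xy: "x \<in> carrier (Ind (\<alpha> \<otimes>\<^bsub>G\<^esub> \<beta>))" "y \<in> carrier (Ind (\<alpha> \<otimes>\<^bsub>G\<^esub> \<beta>))"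
    show "\<theta> \<alpha> \<beta> (x \<oplus>\<^bsub>Ind (\<alpha> \<otimes>\<^bsub>G\<^esub> \<beta>)\<^esub> y) = \<theta> \<alpha> \<beta> x \<oplus>\<^bsub>tensor K (Ind \<alpha>) (H \<beta>)\<^esub> \<theta> \<alpha> \<beta> y"
      by (rule inj) (simp_all add: xy ops linear_map_add[OF e] linear_map_add[OF D])
  qed
qed

text \<open>Both sides are compared under \<open>emb\<close> with second factor
  \<open>H \<beta> \<otimes> H \<gamma>\<close>, where they become the two iterated
  comultiplications under \<open>V1 \<otimes> _\<close>.\<close>

lemma Ind_coaction_coassoc:
  assumes \<alpha>: "\<alpha> \<in> carrier G" and \<beta>: "\<beta> \<in> carrier G" and \<gamma>: "\<gamma> \<in> carrier G"
    and x: "x \<in> carrier (Ind (\<alpha> \<otimes>\<^bsub>G\<^esub> \<beta> \<otimes>\<^bsub>G\<^esub> \<gamma>))"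
  shows "tensor_assoc K (Ind \<alpha>) (H \<beta>) (H \<gamma>)
      (tensor_map K (Ind (\<alpha> \<otimes>\<^bsub>G\<^esub> \<beta>)) (H \<gamma>) (tensor K (Ind \<alpha>) (H \<beta>)) (H \<gamma>)
        (\<theta> \<alpha> \<beta>) id (\<theta> (\<alpha> \<otimes>\<^bsub>G\<^esub> \<beta>) \<gamma> x)) =
    tensor_map K (Ind \<alpha>) (H (\<beta> \<otimes>\<^bsub>G\<^esub> \<gamma>)) (Ind \<alpha>) (tensor K (H \<beta>) (H \<gamma>))
      id (\<Delta> \<beta> \<gamma>) (\<theta> \<alpha> (\<beta> \<otimes>\<^bsub>G\<^esub> \<gamma>) x)"
    (is "?l = ?r")
proof -
  note [simp] = \<alpha> \<beta> \<gamma>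
  let ?\<alpha>\<beta> = "\<alpha> \<otimes>\<^bsub>G\<^esub> \<beta>" and ?\<beta>\<gamma> = "\<beta> \<otimes>\<^bsub>G\<^esub> \<gamma>" and ?\<alpha>\<beta>\<gamma> = "\<alpha> \<otimes>\<^bsub>G\<^esub> \<beta> \<otimes>\<^bsub>G\<^esub> \<gamma>"
  let ?HH = "tensor K (H \<beta>) (H \<gamma>)" and ?T = "tensor K V1 (H \<alpha>)" and ?HHl = "tensor K (H \<alpha>) (H \<beta>)"
  \<comment> \<open>The two sides bracket the group indices differently, so membership of
    \<open>x\<close> and the domain of \<open>\<Delta>\<close> have to be transported.\<close>
  have assoc: "\<alpha> \<otimes>\<^bsub>G\<^esub> ?\<beta>\<gamma> = ?\<alpha>\<beta>\<gamma>" by (simp add: G.m_assoc)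
  have x': "x \<in> carrier (Ind (\<alpha> \<otimes>\<^bsub>G\<^esub> ?\<beta>\<gamma>))" using x assoc by simp
  have xT: "x \<in> carrier (tensor K V1 (H ?\<alpha>\<beta>\<gamma>))" using Ind_carrierD(1)[OF x] .
  have \<Delta>_lin: "\<Delta> \<alpha> ?\<beta>\<gamma> \<in> linear_maps K (H ?\<alpha>\<beta>\<gamma>) (tensor K (H \<alpha>) (H ?\<beta>\<gamma>))"
    using comult_linear[of \<alpha> ?\<beta>\<gamma>] assoc by simp
  let ?w = "\<theta> ?\<alpha>\<beta> \<gamma> x" and ?z = "\<theta> \<alpha> ?\<beta>\<gamma> x"
  have w: "?w \<in> carrier (tensor K (Ind ?\<alpha>\<beta>) (H \<gamma>))" and ew: "emb ?\<alpha>\<beta> (H \<gamma>) ?w = I_\<Delta> ?\<alpha>\<beta> \<gamma> x"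
    using Ind_coaction_emb[of ?\<alpha>\<beta> \<gamma> x] x by simp_all
  have z: "?z \<in> carrier (tensor K (Ind \<alpha>) (H ?\<beta>\<gamma>))" and ez: "emb \<alpha> (H ?\<beta>\<gamma>) ?z = I_\<Delta> \<alpha> ?\<beta>\<gamma> x"
    using Ind_coaction_emb[of \<alpha> ?\<beta>\<gamma> x] x' by simp_all
  let ?u = "tensor_map K (Ind ?\<alpha>\<beta>) (H \<gamma>) (tensor K (Ind \<alpha>) (H \<beta>)) (H \<gamma>) (\<theta> \<alpha> \<beta>) id ?w"
  have u: "?u \<in> carrier (tensor K (tensor K (Ind \<alpha>) (H \<beta>)) (H \<gamma>))"
    by (rule tensor_map_closed) (simp_all add: w)
  let ?i = "tensor_map K (Ind \<alpha>) (H \<beta>) ?T (H \<beta>) id id"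
  let ?iu = "tensor_map K (tensor K (Ind \<alpha>) (H \<beta>)) (H \<gamma>) (tensor K ?T (H \<beta>)) (H \<gamma>) ?i id ?u"
  have iu: "?iu \<in> carrier (tensor K (tensor K ?T (H \<beta>)) (H \<gamma>))"
    by (rule tensor_map_closed) (simp_all add: u tensor_map_linear)
  let ?A = "tensor_map K V1 (tensor K ?HHl (H \<gamma>)) V1 (tensor K (H \<alpha>) ?HH) id (tensor_assoc K (H \<alpha>) (H \<beta>) (H \<gamma>))"
  have l: "?l \<in> carrier (tensor K (Ind \<alpha>) ?HH)" by (rule tensor_assoc_closed[OF _ _ _ u]) simp_all
  \<comment> \<open>The identity of \<open>H \<beta> \<otimes> H \<gamma>\<close> is split so that
    the inclusion can pass inside the associator.\<close>
  have "tensor_map K (Ind \<alpha>) ?HH ?T ?HH id id ?l =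
      tensor_map K (Ind \<alpha>) ?HH ?T ?HH id (tensor_map K (H \<beta>) (H \<gamma>) (H \<beta>) (H \<gamma>) id id) ?l"
    by (rule tensor_map_cong) (simp_all add: l tensor_map_linear tensor_map_id)
  also have "\<dots> = tensor_assoc K ?T (H \<beta>) (H \<gamma>) ?iu"
    by (rule tensor_assoc_natural[symmetric]) (simp_all add: u)
  finally have "emb \<alpha> ?HH ?l = ?A (tensor_assoc K V1 ?HHl (H \<gamma>)
      (tensor_map K (tensor K ?T (H \<beta>)) (H \<gamma>) (tensor K V1 ?HHl) (H \<gamma>) (tensor_assoc K V1 (H \<alpha>) (H \<beta>)) id ?iu))"
    unfolding emb_def using tensor_assoc_pentagon[OF V_module space space space iu] by simp
  also have "tensor_map K (tensor K ?T (H \<beta>)) (H \<gamma>) (tensor K V1 ?HHl) (H \<gamma>) (tensor_assoc K V1 (H \<alpha>) (H \<beta>)) id ?iu =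
      tensor_map K (tensor K (Ind \<alpha>) (H \<beta>)) (H \<gamma>) (tensor K V1 ?HHl) (H \<gamma>) (emb \<alpha> (H \<beta>)) id ?u"
    by (rule tensor_map_comp_eq)
      (simp_all add: u tensor_map_linear tensor_assoc_linear, simp add: emb_def)
  \<comment> \<open>The defining property of the inner coaction, tensored with
    \<open>H \<gamma>\<close>, replaces it by \<open>I_\<Delta>\<close> on the ambient
    space.\<close>
  also have "\<dots> = tensor_map K (tensor K V1 (H ?\<alpha>\<beta>)) (H \<gamma>) (tensor K V1 ?HHl) (H \<gamma>) (I_\<Delta> \<alpha> \<beta>) id
      (tensor_map K (Ind ?\<alpha>\<beta>) (H \<gamma>) (tensor K V1 (H ?\<alpha>\<beta>)) (H \<gamma>) id id ?w)"
    by (rule tensor_map_square) (simp_all add: w emb_Ind_coaction)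
  also have "tensor_assoc K V1 ?HHl (H \<gamma>) \<dots> =
      tensor_map K V1 (tensor K (H ?\<alpha>\<beta>) (H \<gamma>)) V1 (tensor K ?HHl (H \<gamma>)) id
        (tensor_map K (H ?\<alpha>\<beta>) (H \<gamma>) ?HHl (H \<gamma>) (\<Delta> \<alpha> \<beta>) id) (emb ?\<alpha>\<beta> (H \<gamma>) ?w)"
    unfolding I_\<Delta>_def emb_def by (rule tensor_assoc_natural) (simp_all add: w tensor_map_closed)
  also have "\<dots> = tensor_map K V1 (H ?\<alpha>\<beta>\<gamma>) V1 (tensor K ?HHl (H \<gamma>)) id
      (\<lambda>h. tensor_map K (H ?\<alpha>\<beta>) (H \<gamma>) ?HHl (H \<gamma>) (\<Delta> \<alpha> \<beta>) id (\<Delta> ?\<alpha>\<beta> \<gamma> h)) x"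
    unfolding ew unfolding I_\<Delta>_def
    by (rule tensor_map_comp_eq)
      (simp_all add: xT tensor_map_linear linear_map_comp[OF comult_linear tensor_map_linear])
  \<comment> \<open>Coassociativity of \<open>\<Delta>\<close> under
    \<open>V1 \<otimes> _\<close>.\<close>
  also have "?A \<dots> = tensor_map K V1 (tensor K (H \<alpha>) (H ?\<beta>\<gamma>)) V1 (tensor K (H \<alpha>) ?HH) id
      (tensor_map K (H \<alpha>) (H ?\<beta>\<gamma>) (H \<alpha>) ?HH id (\<Delta> \<beta> \<gamma>)) (emb \<alpha> (H ?\<beta>\<gamma>) ?z)"
    unfolding ez unfolding I_\<Delta>_def assoc
    by (rule tensor_map_square)
      (simp_all add: xT tensor_map_linear tensor_assoc_linear \<Delta>_lin coassoc
        linear_map_comp[OF comult_linear tensor_map_linear])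
  also have "\<dots> = emb \<alpha> ?HH ?r"
    by (rule emb_natural[symmetric]) (simp_all add: z)
  finally show ?thesis
    by (rule inj_onD[OF emb_inj, rotated 2, OF _ l]) (simp_all add: z tensor_map_closed)
qed

text \<open>Here the result lies in \<open>Ind \<alpha>\<close> itself, whose inclusion is
  \<open>id\<close> on elements. Naturality of the unit map moves the computation into
  \<open>V1 \<otimes> H \<alpha>\<close>, where the counit law of \<open>H\<close> applies.\<close>

lemma Ind_coaction_counit:
  assumes \<alpha>: "\<alpha> \<in> carrier G" and x: "x \<in> carrier (Ind \<alpha>)"
  shows "tensor_runit K (Ind \<alpha>)
    (tensor_map K (Ind \<alpha>) (H \<one>\<^bsub>G\<^esub>) (Ind \<alpha>) (base_space K) id \<epsilon> (\<theta> \<alpha> \<one>\<^bsub>G\<^esub> x)) = x"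
proof -
  note [simp] = \<alpha> counit_linear
  have B [simp]: "module K (base_space K)" using base_space_module[OF K.is_cring] .
  let ?T = "tensor K V1 (H \<alpha>)" and ?H1 = "H \<one>\<^bsub>G\<^esub>"
  have xT: "x \<in> carrier ?T" using Ind_carrierD(1)[OF x] .
  have \<Delta>_lin: "\<Delta> \<alpha> \<one>\<^bsub>G\<^esub> \<in> linear_maps K (H \<alpha>) (tensor K (H \<alpha>) ?H1)"
    using comult_linear[of \<alpha> "\<one>\<^bsub>G\<^esub>"] by simp
  let ?w = "\<theta> \<alpha> \<one>\<^bsub>G\<^esub> x"
  have w: "?w \<in> carrier (tensor K (Ind \<alpha>) ?H1)" and ew: "emb \<alpha> ?H1 ?w = I_\<Delta> \<alpha> \<one>\<^bsub>G\<^esub> x"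
    using Ind_coaction_emb[of \<alpha> "\<one>\<^bsub>G\<^esub>" x] x by simp_all
  let ?v = "tensor_map K (Ind \<alpha>) ?H1 (Ind \<alpha>) (base_space K) id \<epsilon> ?w"
  have v: "?v \<in> carrier (tensor K (Ind \<alpha>) (base_space K))" by (rule tensor_map_closed) (simp_all add: w)
  have "tensor_runit K (Ind \<alpha>) ?v =
      tensor_runit K ?T (tensor_map K (Ind \<alpha>) (base_space K) ?T (base_space K) id id ?v)"
    using tensor_runit_natural[OF _ _ Ind_incl v] by simp
  also have "\<dots> = tensor_map K V1 (tensor K (H \<alpha>) (base_space K)) V1 (H \<alpha>) id (tensor_runit K (H \<alpha>))
      (emb \<alpha> (base_space K) ?v)"
    unfolding emb_def by (rule tensor_runit_assoc) (simp_all add: v tensor_map_closed)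
  also have "emb \<alpha> (base_space K) ?v =
      tensor_map K V1 (tensor K (H \<alpha>) ?H1) V1 (tensor K (H \<alpha>) (base_space K)) id
        (tensor_map K (H \<alpha>) ?H1 (H \<alpha>) (base_space K) id \<epsilon>) (I_\<Delta> \<alpha> \<one>\<^bsub>G\<^esub> x)"
    unfolding ew[symmetric] by (rule emb_natural) (simp_all add: w)
  also have "\<dots> = tensor_map K V1 (H \<alpha>) V1 (tensor K (H \<alpha>) (base_space K)) id
      (\<lambda>h. tensor_map K (H \<alpha>) ?H1 (H \<alpha>) (base_space K) id \<epsilon> (\<Delta> \<alpha> \<one>\<^bsub>G\<^esub> h)) x"
    unfolding I_\<Delta>_def G.r_one[OF \<alpha>]
    by (rule tensor_map_comp_eq)
      (simp_all add: xT \<Delta>_lin tensor_map_linear linear_map_comp[OF \<Delta>_lin tensor_map_linear])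
  also have "tensor_map K V1 (tensor K (H \<alpha>) (base_space K)) V1 (H \<alpha>) id (tensor_runit K (H \<alpha>)) \<dots> =
      tensor_map K V1 (H \<alpha>) V1 (H \<alpha>) id id x"
    by (rule tensor_map_comp_eq)
      (simp_all add: xT \<Delta>_lin tensor_runit_linear counit_right linear_map_comp[OF \<Delta>_lin tensor_map_linear])
  also have "\<dots> = x" by (rule tensor_map_id) (simp_all add: xT)
  finally show ?thesis .
qed

lemma Ind_comodule: "right_pi_comodule K G H \<Delta> \<epsilon> Ind \<theta>"
  by (intro right_pi_comodule.intro right_pi_comodule_axioms.intro pi_coalgebra_axioms Ind_module
      Ind_coaction_linear Ind_coaction_coassoc Ind_coaction_counit)

end

section \<open>Functoriality of induction\<close>

text \<open>Stated for a colinear map at the neutral element rather than an isomorphism, so that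
  \<open>F\<close> and its inverse are two instances.\<close>

locale induction_morphism =
  V: induction_data K G H \<Delta> \<epsilon> C \<sigma> V \<rho> + W: induction_data K G H \<Delta> \<epsilon> C \<sigma> W \<rho>'
  for K :: "'k ring" and G :: "'g monoid" and H :: "'g \<Rightarrow> ('k, 'h) module"
    and \<Delta> :: "'g \<Rightarrow> 'g \<Rightarrow> 'h \<Rightarrow> ('k, 'h, 'h) tensor" and \<epsilon> :: "'h \<Rightarrow> 'k"
    and C :: "'g \<Rightarrow> ('k, 'c) module" and \<sigma> :: "'g \<Rightarrow> 'h \<Rightarrow> 'c"
    and V :: "'g \<Rightarrow> ('k, 'v) module" and \<rho> :: "'g \<Rightarrow> 'g \<Rightarrow> 'v \<Rightarrow> ('k, 'v, 'c) tensor"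
    and W :: "'g \<Rightarrow> ('k, 'w) module" and \<rho>' :: "'g \<Rightarrow> 'g \<Rightarrow> 'w \<Rightarrow> ('k, 'w, 'c) tensor" +
  fixes F :: "'v \<Rightarrow> 'w"
  assumes F_linear: "F \<in> linear_maps K (V \<one>\<^bsub>G\<^esub>) (W \<one>\<^bsub>G\<^esub>)"
    and F_comodule: "v \<in> carrier (V \<one>\<^bsub>G\<^esub>) \<Longrightarrow> \<rho>' \<one>\<^bsub>G\<^esub> \<one>\<^bsub>G\<^esub> (F v) =
      tensor_map K (V \<one>\<^bsub>G\<^esub>) (C \<one>\<^bsub>G\<^esub>) (W \<one>\<^bsub>G\<^esub>) (C \<one>\<^bsub>G\<^esub>) F id (\<rho> \<one>\<^bsub>G\<^esub> \<one>\<^bsub>G\<^esub> v)"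
begin

definition "F_I \<alpha> = tensor_map K V.V1 (H \<alpha>) W.V1 (H \<alpha>) F id"

lemmas [simp] = F_linear

lemma F_I_linear [simp]:
  "\<alpha> \<in> carrier G \<Longrightarrow> F_I \<alpha> \<in> linear_maps K (tensor K V.V1 (H \<alpha>)) (tensor K W.V1 (H \<alpha>))"
  unfolding F_I_def by (rule tensor_map_linear) simp_all

text \<open>\<open>F \<otimes> id\<close> passes through \<open>I_L\<close> because the two act on
  different legs, and through \<open>\<rho>_I\<close> because \<open>F\<close> is colinear; so the
  equalizing condition is preserved.\<close>

lemma F_I_closed:
  assumes \<alpha>: "\<alpha> \<in> carrier G" and x: "x \<in> carrier (V.Ind \<alpha>)"
  shows "F_I \<alpha> x \<in> carrier (W.Ind \<alpha>)"
proof -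
  note [simp] = \<alpha>
  let ?CH = "tensor K V.C1 (H \<alpha>)" and ?\<rho> = "\<rho> \<one>\<^bsub>G\<^esub> \<one>\<^bsub>G\<^esub>" and ?\<rho>' = "\<rho>' \<one>\<^bsub>G\<^esub> \<one>\<^bsub>G\<^esub>"
    and ?VC = "tensor K V.V1 V.C1" and ?WC = "tensor K W.V1 V.C1"
  have xT: "x \<in> carrier (tensor K V.V1 (H \<alpha>))" using V.Ind_carrierD(1)[OF x] .
  have \<rho>x: "tensor_map K V.V1 (H \<alpha>) ?VC (H \<alpha>) ?\<rho> id x \<in> carrier (tensor K ?VC (H \<alpha>))"
    by (rule tensor_map_closed) (simp_all add: xT)
  let ?FCH = "tensor_map K V.V1 ?CH W.V1 ?CH F (tensor_map K V.C1 (H \<alpha>) V.C1 (H \<alpha>) id id)"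
  have "W.I_L \<alpha> (F_I \<alpha> x) = ?FCH (V.I_L \<alpha> x)"
    unfolding W.I_L_def V.I_L_def F_I_def
    by (rule tensor_map_square)
      (simp_all add: xT tensor_map_linear tensor_map_id linear_map_closed[OF V.L_linear])
  also have "V.I_L \<alpha> x = V.\<rho>_I \<alpha> x" using V.Ind_carrierD(2)[OF x] .
  also have "?FCH \<dots> = tensor_assoc K W.V1 V.C1 (H \<alpha>) (tensor_map K ?VC (H \<alpha>) ?WC (H \<alpha>)
      (tensor_map K V.V1 V.C1 W.V1 V.C1 F id) id (tensor_map K V.V1 (H \<alpha>) ?VC (H \<alpha>) ?\<rho> id x))"
    unfolding V.\<rho>_I_def by (rule tensor_assoc_natural[symmetric]) (simp_all add: \<rho>x)
  \<comment> \<open>Colinearity of \<open>F\<close>, tensored with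
    \<open>H \<alpha>\<close>.\<close>
  also have "tensor_map K ?VC (H \<alpha>) ?WC (H \<alpha>)
      (tensor_map K V.V1 V.C1 W.V1 V.C1 F id) id (tensor_map K V.V1 (H \<alpha>) ?VC (H \<alpha>) ?\<rho> id x) =
      tensor_map K W.V1 (H \<alpha>) ?WC (H \<alpha>) ?\<rho>' id (F_I \<alpha> x)"
    unfolding F_I_def by (rule tensor_map_square) (simp_all add: xT tensor_map_linear F_comodule)
  finally have "W.I_L \<alpha> (F_I \<alpha> x) = W.\<rho>_I \<alpha> (F_I \<alpha> x)" unfolding W.\<rho>_I_def .
  then show ?thesis unfolding W.Ind_eq using linear_map_closed[OF F_I_linear[OF \<alpha>] xT] by simp
qed

lemma F_I_Ind_linear [simp]:
  assumes \<alpha>: "\<alpha> \<in> carrier G"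
  shows "F_I \<alpha> \<in> linear_maps K (V.Ind \<alpha>) (W.Ind \<alpha>)"
  using linear_map_add[OF F_I_linear[OF \<alpha>]] linear_map_smult[OF F_I_linear[OF \<alpha>]]
  by (intro linear_mapsI) (auto simp: F_I_closed \<alpha> V.Ind_carrierD(1), simp_all add: V.Ind_eq W.Ind_eq)

text \<open>Under the injective \<open>W.emb\<close> both sides become
  \<open>F \<otimes> \<Delta>\<close> applied to \<open>x\<close>.\<close>

lemma F_I_coaction:
  assumes \<alpha>: "\<alpha> \<in> carrier G" and \<beta>: "\<beta> \<in> carrier G" and x: "x \<in> carrier (V.Ind (\<alpha> \<otimes>\<^bsub>G\<^esub> \<beta>))"
  shows "W.\<theta> \<alpha> \<beta> (F_I (\<alpha> \<otimes>\<^bsub>G\<^esub> \<beta>) x) =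
    tensor_map K (V.Ind \<alpha>) (H \<beta>) (W.Ind \<alpha>) (H \<beta>) (F_I \<alpha>) id (V.\<theta> \<alpha> \<beta> x)"
    (is "?l = ?r")
proof -
  note [simp] = \<alpha> \<beta>
  let ?\<alpha>\<beta> = "\<alpha> \<otimes>\<^bsub>G\<^esub> \<beta>" and ?HH = "tensor K (H \<alpha>) (H \<beta>)" and ?VT = "tensor K V.V1 (H \<alpha>)"
    and ?WT = "tensor K W.V1 (H \<alpha>)"
  have xT: "x \<in> carrier (tensor K V.V1 (H ?\<alpha>\<beta>))" using V.Ind_carrierD(1)[OF x] .
  have Fx: "F_I ?\<alpha>\<beta> x \<in> carrier (W.Ind ?\<alpha>\<beta>)" by (rule F_I_closed) (simp_all add: x)
  let ?z = "V.\<theta> \<alpha> \<beta> x"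
  have z: "?z \<in> carrier (tensor K (V.Ind \<alpha>) (H \<beta>))" and ez: "V.emb \<alpha> (H \<beta>) ?z = V.I_\<Delta> \<alpha> \<beta> x"
    using V.Ind_coaction_emb[OF \<alpha> \<beta> x] by simp_all
  have l: "?l \<in> carrier (tensor K (W.Ind \<alpha>) (H \<beta>))" and el: "W.emb \<alpha> (H \<beta>) ?l = W.I_\<Delta> \<alpha> \<beta> (F_I ?\<alpha>\<beta> x)"
    using W.Ind_coaction_emb[OF \<alpha> \<beta> Fx] by simp_all
  have r: "?r \<in> carrier (tensor K (W.Ind \<alpha>) (H \<beta>))" by (rule tensor_map_closed) (simp_all add: z)
  have "tensor_map K (W.Ind \<alpha>) (H \<beta>) ?WT (H \<beta>) id id ?r =
      tensor_map K ?VT (H \<beta>) ?WT (H \<beta>) (F_I \<alpha>) id (tensor_map K (V.Ind \<alpha>) (H \<beta>) ?VT (H \<beta>) id id ?z)"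
    by (rule tensor_map_square) (simp_all add: z)
  then have "W.emb \<alpha> (H \<beta>) ?r = tensor_map K V.V1 ?HH W.V1 ?HH F (tensor_map K (H \<alpha>) (H \<beta>) (H \<alpha>) (H \<beta>) id id)
      (V.emb \<alpha> (H \<beta>) ?z)"
    unfolding W.emb_def V.emb_def F_I_def
    by (simp only:) (rule tensor_assoc_natural; simp add: z tensor_map_closed)
  also have "\<dots> = W.I_\<Delta> \<alpha> \<beta> (F_I ?\<alpha>\<beta> x)"
    unfolding ez unfolding V.I_\<Delta>_def W.I_\<Delta>_def F_I_def
    by (rule tensor_map_square)
      (simp_all add: xT tensor_map_linear tensor_map_id linear_map_closed[OF V.comult_linear])
  finally show ?thesis
    unfolding el[symmetric] by (rule inj_onD[OF W.emb_inj, rotated 2, OF sym]) (simp_all add: l r)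
qed

end

section \<open>Inverse isomorphisms and the resulting equivalence\<close>

lemma linear_iso_inverse:
  assumes M: "module K M" and f: "f \<in> linear_isos K M N"
  shows "inv_into (carrier M) f \<in> linear_maps K N M"
proof -
  interpret M: module K M by fact
  let ?g = "inv_into (carrier M) f"
  have lin: "f \<in> linear_maps K M N" and bij: "bij_betw f (carrier M) (carrier N)"
    using f unfolding linear_isos_def by auto
  have g: "?g y \<in> carrier M" "f (?g y) = y" if "y \<in> carrier N" for y
    using that bij by (auto simp: bij_betw_def inv_into_into f_inv_into_f)
  have gf: "?g (f x) = x" if "x \<in> carrier M" for x using that bij by (simp add: bij_betw_def)
  show ?thesis
  proof (rule linear_mapsI)
    fix x y assume xy: "x \<in> carrier N" "y \<in> carrier N"
    have "f (?g x \<oplus>\<^bsub>M\<^esub> ?g y) = x \<oplus>\<^bsub>N\<^esub> y" using xy g linear_map_add[OF lin] by simp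
    then show "?g (x \<oplus>\<^bsub>N\<^esub> y) = ?g x \<oplus>\<^bsub>M\<^esub> ?g y" using gf[of "?g x \<oplus>\<^bsub>M\<^esub> ?g y"] g xy by simp
  next
    fix a y assume a: "a \<in> carrier K" and y: "y \<in> carrier N"
    have "f (a \<odot>\<^bsub>M\<^esub> ?g y) = a \<odot>\<^bsub>N\<^esub> y" using a y g linear_map_smult[OF lin] by simp
    then show "?g (a \<odot>\<^bsub>N\<^esub> y) = a \<odot>\<^bsub>M\<^esub> ?g y" using gf[of "a \<odot>\<^bsub>M\<^esub> ?g y"] g a y by simp
  qed (rule g)
qed

lemma induced_equivalence:
  assumes V: "induction_data K G H \<Delta> \<epsilon> C \<sigma> V \<rho>" and W: "induction_data K G H \<Delta> \<epsilon> C \<sigma> W \<rho>'"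
    and F: "F \<in> linear_isos K (V \<one>\<^bsub>G\<^esub>) (W \<one>\<^bsub>G\<^esub>)"
    and comm: "\<And>v. v \<in> carrier (V \<one>\<^bsub>G\<^esub>) \<Longrightarrow> \<rho>' \<one>\<^bsub>G\<^esub> \<one>\<^bsub>G\<^esub> (F v) =
      tensor_map K (V \<one>\<^bsub>G\<^esub>) (C \<one>\<^bsub>G\<^esub>) (W \<one>\<^bsub>G\<^esub>) (C \<one>\<^bsub>G\<^esub>) F id (\<rho> \<one>\<^bsub>G\<^esub> \<one>\<^bsub>G\<^esub> v)"
  shows "equivalent_right_pi_comodules K G H \<Delta> \<epsilon>
    (Ind_space K G H \<Delta> C \<sigma> V \<rho>) (Ind_coaction K G H \<Delta> C \<sigma> V \<rho>)
    (Ind_space K G H \<Delta> C \<sigma> W \<rho>') (Ind_coaction K G H \<Delta> C \<sigma> W \<rho>')"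
proof -
  interpret V: induction_data K G H \<Delta> \<epsilon> C \<sigma> V \<rho> by fact
  interpret W: induction_data K G H \<Delta> \<epsilon> C \<sigma> W \<rho>' by fact
  have F_lin: "F \<in> linear_maps K V.V1 W.V1" and bij: "bij_betw F (carrier V.V1) (carrier W.V1)"
    using F unfolding linear_isos_def by auto
  let ?E = "inv_into (carrier V.V1) F"
  have E_lin: "?E \<in> linear_maps K W.V1 V.V1" by (rule linear_iso_inverse[OF V.V_module F])
  have FE: "F (?E w) = w" if "w \<in> carrier W.V1" for w using that bij by (simp add: bij_betw_def f_inv_into_f)
  have EF: "?E (F v) = v" if "v \<in> carrier V.V1" for v using that bij by (simp add: bij_betw_def)
  interpret VW: induction_morphism K G H \<Delta> \<epsilon> C \<sigma> V \<rho> W \<rho>' F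
    by unfold_locales (simp_all add: F_lin comm)
  interpret WV: induction_morphism K G H \<Delta> \<epsilon> C \<sigma> W \<rho>' V \<rho> ?E
  proof unfold_locales
    fix w assume w: "w \<in> carrier W.V1"
    have Ew: "?E w \<in> carrier V.V1" using linear_map_closed[OF E_lin w] .
    have \<rho>Ew: "\<rho> \<one>\<^bsub>G\<^esub> \<one>\<^bsub>G\<^esub> (?E w) \<in> carrier (tensor K V.V1 V.C1)"
      using linear_map_closed[OF V.\<rho>_linear Ew] .
    \<comment> \<open>The inverse is again colinear: writing \<open>w\<close> as
      \<open>F (?E w)\<close> brings in the colinearity of \<open>F\<close>, and \<open>?E\<close>
      then cancels \<open>F\<close>.\<close>
    have "tensor_map K W.V1 V.C1 V.V1 V.C1 ?E id (\<rho>' \<one>\<^bsub>G\<^esub> \<one>\<^bsub>G\<^esub> w) =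
        tensor_map K W.V1 V.C1 V.V1 V.C1 ?E id
          (tensor_map K V.V1 V.C1 W.V1 V.C1 F id (\<rho> \<one>\<^bsub>G\<^esub> \<one>\<^bsub>G\<^esub> (?E w)))"
      using comm[OF Ew] FE[OF w] by simp
    also have "\<dots> = tensor_map K V.V1 V.C1 V.V1 V.C1 id id (\<rho> \<one>\<^bsub>G\<^esub> \<one>\<^bsub>G\<^esub> (?E w))"
      by (rule tensor_map_comp_eq) (simp_all add: F_lin E_lin EF \<rho>Ew)
    also have "\<dots> = \<rho> \<one>\<^bsub>G\<^esub> \<one>\<^bsub>G\<^esub> (?E w)" by (rule tensor_map_id) (simp_all add: \<rho>Ew)
    finally show "\<rho> \<one>\<^bsub>G\<^esub> \<one>\<^bsub>G\<^esub> (?E w) = tensor_map K W.V1 V.C1 V.V1 V.C1 ?E id (\<rho>' \<one>\<^bsub>G\<^esub> \<one>\<^bsub>G\<^esub> w)" by simp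
  qed (rule E_lin)
  \<comment> \<open>\<open>F \<otimes> id\<close> and \<open>?E \<otimes> id\<close> undo each other
    on the full tensor products and both preserve the induced subspaces.\<close>
  have iso: "VW.F_I \<alpha> \<in> linear_isos K (V.Ind \<alpha>) (W.Ind \<alpha>)" if \<alpha>: "\<alpha> \<in> carrier G" for \<alpha>
  proof -
    have 1: "WV.F_I \<alpha> (VW.F_I \<alpha> x) = x" if "x \<in> carrier (V.Ind \<alpha>)" for x
    proof -
      have x: "x \<in> carrier (tensor K V.V1 (H \<alpha>))" using V.Ind_carrierD(1)[OF that] .
      have "WV.F_I \<alpha> (VW.F_I \<alpha> x) = tensor_map K V.V1 (H \<alpha>) V.V1 (H \<alpha>) id id x"
        unfolding WV.F_I_def VW.F_I_def
        by (rule tensor_map_comp_eq) (simp_all add: \<alpha> x F_lin E_lin EF)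
      then show ?thesis using x \<alpha> by (simp add: tensor_map_id)
    qed
    have 2: "VW.F_I \<alpha> (WV.F_I \<alpha> x) = x" if "x \<in> carrier (W.Ind \<alpha>)" for x
    proof -
      have x: "x \<in> carrier (tensor K W.V1 (H \<alpha>))" using W.Ind_carrierD(1)[OF that] .
      have "VW.F_I \<alpha> (WV.F_I \<alpha> x) = tensor_map K W.V1 (H \<alpha>) W.V1 (H \<alpha>) id id x"
        unfolding WV.F_I_def VW.F_I_def
        by (rule tensor_map_comp_eq) (simp_all add: \<alpha> x F_lin E_lin FE)
      then show ?thesis using x \<alpha> by (simp add: tensor_map_id)
    qed
    have "bij_betw (VW.F_I \<alpha>) (carrier (V.Ind \<alpha>)) (carrier (W.Ind \<alpha>))"
      by (rule bij_betw_byWitness[where f' = "WV.F_I \<alpha>"])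
        (use 1 2 VW.F_I_closed[OF \<alpha>] WV.F_I_closed[OF \<alpha>] in auto)
    then show ?thesis unfolding linear_isos_def using VW.F_I_Ind_linear[OF \<alpha>] by simp
  qed
  show ?thesis
    unfolding equivalent_right_pi_comodules_def
    using V.Ind_comodule W.Ind_comodule iso VW.F_I_coaction by blast
qed

lemma induction_dataI:
  assumes Q: "left_pi_coisotropic_quantum_subgroup K G H \<Delta>H \<epsilon>H S C \<Delta>C \<epsilon>C act \<sigma>"
    and V: "right_pi_comodule K G C \<Delta>C \<epsilon>C V \<rho>"
  shows "induction_data K G H \<Delta>H \<epsilon>H C \<sigma> V \<rho>"
proof (intro induction_data.intro induction_data_axioms.intro)
  have G: "group G"
    using pi_coalgebra.axioms(2)[OF right_pi_comodule.axioms(1)[OF V]] .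
  \<comment> \<open>The linearity axiom for \<open>\<rho>\<close> at two neutral indices has its
    domain at their product, which must be rewritten to the neutral element.\<close>
  have one: "\<one>\<^bsub>G\<^esub> \<in> carrier G" "\<one>\<^bsub>G\<^esub> \<otimes>\<^bsub>G\<^esub> \<one>\<^bsub>G\<^esub> = \<one>\<^bsub>G\<^esub>"
    using monoid.one_closed[OF group.is_monoid[OF G]] monoid.l_one[OF group.is_monoid[OF G]] by auto
  show "pi_coalgebra K G H \<Delta>H \<epsilon>H"
    using hopf_pi_coalgebra.axioms(1)[OF left_pi_coisotropic_quantum_subgroup.axioms(1)[OF Q]] .
  show "module K (C \<one>\<^bsub>G\<^esub>)"
    using pi_coalgebra.space[OF right_pi_comodule.axioms(1)[OF V] one(1)] .
  show "module K (V \<one>\<^bsub>G\<^esub>)"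
    using right_pi_comodule.comodule_space[OF V one(1)] .
  show "\<sigma> \<one>\<^bsub>G\<^esub> \<in> linear_maps K (H \<one>\<^bsub>G\<^esub>) (C \<one>\<^bsub>G\<^esub>)"
    using left_pi_coisotropic_quantum_subgroup.proj_linear[OF Q one(1)] .
  show "\<rho> \<one>\<^bsub>G\<^esub> \<one>\<^bsub>G\<^esub> \<in> linear_maps K (V \<one>\<^bsub>G\<^esub>) (tensor K (V \<one>\<^bsub>G\<^esub>) (C \<one>\<^bsub>G\<^esub>))"
    using right_pi_comodule.coaction_linear[OF V one(1) one(1)] unfolding one(2) .
qed

theorem theorem5p1:
  fixes K :: "'k ring" and G :: "'g monoid"
    and H :: "'g \<Rightarrow> ('k, 'h) module"
    and \<Delta>H :: "'g \<Rightarrow> 'g \<Rightarrow> 'h \<Rightarrow> ('k, 'h, 'h) tensor" and \<epsilon>H :: "'h \<Rightarrow> 'k" and S :: "'g \<Rightarrow> 'h \<Rightarrow> 'h"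
    and C :: "'g \<Rightarrow> ('k, 'c) module"
    and \<Delta>C :: "'g \<Rightarrow> 'g \<Rightarrow> 'c \<Rightarrow> ('k, 'c, 'c) tensor" and \<epsilon>C :: "'c \<Rightarrow> 'k"
    and act :: "'g \<Rightarrow> 'h \<Rightarrow> 'c \<Rightarrow> 'c" and \<sigma> :: "'g \<Rightarrow> 'h \<Rightarrow> 'c"
    and V :: "'g \<Rightarrow> ('k, 'v) module" and \<rho> :: "'g \<Rightarrow> 'g \<Rightarrow> 'v \<Rightarrow> ('k, 'v, 'c) tensor"
    and W :: "'g \<Rightarrow> ('k, 'w) module" and \<rho>' :: "'g \<Rightarrow> 'g \<Rightarrow> 'w \<Rightarrow> ('k, 'w, 'c) tensor"
  assumes "hopf_pi_coalgebra K G H \<Delta>H \<epsilon>H S"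
    and "left_pi_coisotropic_quantum_subgroup K G H \<Delta>H \<epsilon>H S C \<Delta>C \<epsilon>C act \<sigma>"
    and "right_pi_comodule K G C \<Delta>C \<epsilon>C V \<rho>"
    and "right_pi_comodule K G C \<Delta>C \<epsilon>C W \<rho>'"
    and "\<exists>F1 \<in> linear_isos K (V \<one>\<^bsub>G\<^esub>) (W \<one>\<^bsub>G\<^esub>). \<forall>v \<in> carrier (V \<one>\<^bsub>G\<^esub>).
           \<rho>' \<one>\<^bsub>G\<^esub> \<one>\<^bsub>G\<^esub> (F1 v) =
           tensor_map K (V \<one>\<^bsub>G\<^esub>) (C \<one>\<^bsub>G\<^esub>) (W \<one>\<^bsub>G\<^esub>) (C \<one>\<^bsub>G\<^esub>) F1 id (\<rho> \<one>\<^bsub>G\<^esub> \<one>\<^bsub>G\<^esub> v)"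
  shows "equivalent_right_pi_comodules K G H \<Delta>H \<epsilon>H
           (Ind_space K G H \<Delta>H C \<sigma> V \<rho>) (Ind_coaction K G H \<Delta>H C \<sigma> V \<rho>)
           (Ind_space K G H \<Delta>H C \<sigma> W \<rho>') (Ind_coaction K G H \<Delta>H C \<sigma> W \<rho>')"
  using assms(5) induced_equivalence[OF induction_dataI[OF assms(2,3)] induction_dataI[OF assms(2,4)]]
  by (elim bexE) simp

end
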